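(* For every integer $t\ge 3$ there is $n_0>0$ such that the following holds. Every $(n,d,\lambda)$-graph $G$ with $n\ge n_0$ and \[ \lambda\le \frac{1}{50t\,4^{t-2}}\cdot\frac{d^{t-1}}{n^{t-2}} \] contains a collection of pairwise vertex-disjoint copies of $K_t$ covering all but at most $n^{1-1/(8t^4)}$ vertices of $G$.
   Context: An $(n,d,\lambda)$-graph is an $n$-vertex $d$-regular graph whose second largest eigenvalue in absolute value (of its adjacency matrix) is at most $\lambda$.
   Formalization: The degree d is assumed positive; for d = 0 the edgeless graph is an (n,0,0)-graph that meets the bound on λ but contains no copy of K_t, so the claim as written fails there. *)

theory Defs
  imports
    "HOL-Analysis.Analysis"
    "HOL-Computational_Algebra.Computational_Algebra"
    "Jordan_Normal_Form.Char_Poly"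
    "Graph_Theory.Kuratowski"
begin

text \<open>
  Finite simple graphs are rendered by the locale \<open>pair_graph\<close>: finitely many vertices and a
  symmetric, irreflexive arc relation, so that an edge \<open>{u, v}\<close> is the pair of arcs \<open>(u, v)\<close> and
  \<open>(v, u)\<close>, and the degree of a vertex is its out-degree.
\<close>

definition adjacency_mat :: "'a list \<Rightarrow> 'a pair_pre_digraph \<Rightarrow> real mat" where
  "adjacency_mat vs G =
     mat (length vs) (length vs) (\<lambda>(i, j). if (vs ! i, vs ! j) \<in> parcs G then 1 else 0)"

text \<open>
  Eigenvalues are counted with algebraic multiplicity and sorted by decreasing absolute value. The
  definition is meant for real symmetric matrices (whose characteristic polynomial splits over the
  reals) of dimension at least 2; for smaller dimensions the value is unspecified.
\<close>

definition second_abs_eigenvalue :: "real mat \<Rightarrow> real" where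
  "second_abs_eigenvalue A =
     rev (sorted_list_of_multiset (image_mset abs (proots (char_poly A)))) ! 1"

text \<open>
  The spectrum of the adjacency matrix does not depend on the enumeration \<open>vs\<close> of the vertices, so
  the existential quantifier could equivalently be a universal one.
\<close>

definition ndl_graph :: "nat \<Rightarrow> nat \<Rightarrow> real \<Rightarrow> 'a pair_pre_digraph \<Rightarrow> bool" where
  "ndl_graph n d lam G \<longleftrightarrow>
     pair_graph G \<and>
     card (pverts G) = n \<and>
     (\<forall>v \<in> pverts G. out_degree (with_proj G) v = d) \<and>
     (\<exists>vs. distinct vs \<and> set vs = pverts G \<and>
        second_abs_eigenvalue (adjacency_mat vs G) \<le> lam)"

definition disjoint_clique_copies ::
    "nat \<Rightarrow> 'a pair_pre_digraph \<Rightarrow> 'a pair_pre_digraph set \<Rightarrow> bool" where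
  "disjoint_clique_copies t G F \<longleftrightarrow>
     (\<forall>H \<in> F. subgraph (with_proj H) (with_proj G) \<and> K\<^bsub>t\<^esub> (with_proj H)) \<and>
     (\<forall>H \<in> F. \<forall>H' \<in> F. H \<noteq> H' \<longrightarrow> pverts H \<inter> pverts H' = {})"

end

theory Submission
  imports Defs "Jordan_Normal_Form.Schur_Decomposition"
begin

text \<open>
  The bound on the second eigenvalue controls, for every vertex set \<open>S\<close>, the mean square deviation of
  \<open>|N(v) \<inter> S|\<close> from \<open>d |S| / n\<close>; nothing else about the spectrum is used. It shows that every
  set of at least \<open>d / (100 t)\<close> neighbours of a vertex spans many copies of \<open>K\<^sub>t\<^sub>-\<^sub>1\<close>.

  Consider the linear program of fractional packings of copies of \<open>K\<^sub>t\<close> in which the weight of each copy is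
  capped. In a dual solution, given by weights of the vertices and of the copies, the heavy copies are too few to
  matter at most vertices, and the vertices that are lighter than average by some amount have many
  heavier neighbours; expansion turns this into a lower bound on the total weight. So there is an almost perfect
  fractional packing, and because of the caps every pair of vertices carries only polynomially small weight.

  Such a packing is rounded by a nibble. In each round, disjoint copies are selected at random in proportion to
  their weights, the fractional packing is restricted to the surviving vertices and rescaled there. The small
  pair weights make the loads of the vertices concentrate, and truncating the overloaded vertices costs little.
  Only expectations of a single functional are needed, so there are no large deviation estimates.
\<close>

section \<open>The second eigenvalue as an operator norm\<close>

unbundle no vec_syntax

text \<open>Removing copies greedily stalls at linear size: when \<open>lam\<close> is as large as
  allowed, \<open>cliques_lower\<close> yields a \<open>K_t\<close> only in sets of at least
  \<open>n / (25 t)\<close> vertices. The fractional detour needs cliques only inside subsets of the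
  original neighbourhoods, which never shrink. In the hypothesis on \<open>lam\<close>, the factor
  \<open>4^(t-2)\<close> pays for nested neighbourhoods, each of which may be a quarter of its
  expected size; the factor \<open>50 t\<close> fixes the proportion \<open>1 / (100 t)\<close> of a
  neighbourhood that still contains many cliques. A proportion of order \<open>1 / t\<close> is
  wanted because in a clique one light vertex is balanced against \<open>t - 1\<close> others, so
  that the dual argument asks for expansion by the factor \<open>t - 1\<close>. Discrepancy is
  available only in the mean, so exceptional vertices occur in every count and have to be summed out
  rather than excluded. All losses of the rounding are powers of \<open>n\<close> with exponents of
  order at least \<open>1 / t\<close>, or absolute ones such as \<open>1/12\<close> and
  \<open>1/24\<close>; the exponent \<open>1 / (8 t^4)\<close> leaves room to absorb their
  constants.\<close>

lemma proots_prod_linear_factors: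
  "proots (\<Prod>a\<leftarrow>as. [:-a, 1:]) = mset (as :: real list)"
proof (induction as)
  case (Cons a as)
  have "(\<Prod>a\<leftarrow>as. [:-a, 1:]) \<noteq> (0 :: real poly)"
    by (auto simp: prod_list_zero_iff)
  then show ?case using Cons by (simp add: proots_mult del: mult_pCons_left)
qed simp

text \<open>The Hermitian form \<open>S\<close> of an eigenvector is both \<open>c * N\<close> and
  its own conjugate, and \<open>N\<close> is a nonzero real.\<close>

lemma symmetric_eigenvalue_real:
  fixes A :: "real mat"
  assumes A: "A \<in> carrier_mat n n" and sym: "\<And>i j. i < n \<Longrightarrow> j < n \<Longrightarrow> A $$ (i,j) = A $$ (j,i)"
    and ev: "eigenvalue (map_mat complex_of_real A) c"
  shows "c \<in> \<real>"
proof -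
  let ?M = "map_mat complex_of_real A"
  from ev obtain v where v: "v \<in> carrier_vec n" "v \<noteq> 0\<^sub>v n" "?M *\<^sub>v v = c \<cdot>\<^sub>v v"
    unfolding eigenvalue_def eigenvector_def using A by auto
  define S where "S = (\<Sum>i<n. \<Sum>j<n. cnj (v $ i) * of_real (A $$ (i,j)) * v $ j)"
  define N where "N = (\<Sum>i<n. cnj (v $ i) * v $ i)"
  have row: "(\<Sum>j<n. of_real (A $$ (i,j)) * v $ j) = c * v $ i" if "i < n" for i
  proof -
    have "(?M *\<^sub>v v) $ i = (\<Sum>j<n. of_real (A $$ (i,j)) * v $ j)"
      using that A v(1) by (auto simp: scalar_prod_def atLeast0LessThan intro!: sum.cong)
    then show ?thesis using v that by simp
  qed
  have S: "S = c * N"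
  proof -
    have "S = (\<Sum>i<n. cnj (v $ i) * (\<Sum>j<n. of_real (A $$ (i,j)) * v $ j))"
      unfolding S_def by (simp add: sum_distrib_left mult.assoc)
    also have "\<dots> = c * N" unfolding N_def using row by (simp add: sum_distrib_left mult_ac)
    finally show ?thesis .
  qed
  have "cnj S = (\<Sum>i<n. \<Sum>j<n. cnj (v $ j) * of_real (A $$ (j,i)) * v $ i)"
    unfolding S_def using sym by (auto simp: mult_ac intro!: sum.cong)
  also have "\<dots> = S" unfolding S_def by (subst sum.swap) simp
  finally have SS: "cnj S = S" .
  have N: "N = of_real (\<Sum>i<n. (cmod (v $ i))\<^sup>2)" unfolding N_def
    by (simp add: mult.commute flip: complex_norm_square)
  obtain i where i: "i < n" "v $ i \<noteq> 0" using v(1,2) by (metis eq_vecI carrier_vecD index_zero_vec)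
  have "(\<Sum>i<n. (cmod (v $ i))\<^sup>2) > 0" using i by (intro sum_pos2[of _ i]) auto
  then have "N \<noteq> 0" "cnj N = N" unfolding N by (auto simp del: of_real_sum)
  then have "cnj c = c" using SS unfolding S by simp
  then show ?thesis using Reals_cnj_iff by blast
qed

text \<open>Over the complex numbers the polynomial splits, and all its roots are real. The
  factorisation descends because the embedding of the coefficients is injective.\<close>

lemma char_poly_symmetric_splits:
  fixes A :: "real mat"
  assumes A: "A \<in> carrier_mat n n" and sym: "\<And>i j. i < n \<Longrightarrow> j < n \<Longrightarrow> A $$ (i,j) = A $$ (j,i)"
  obtains as where "char_poly A = (\<Prod>a\<leftarrow>as. [:-a, 1:])" "length as = n"
proof -
  let ?M = "map_mat complex_of_real A"
  have M: "?M \<in> carrier_mat n n" using A by simp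
  obtain cs where cs: "char_poly ?M = (\<Prod>a\<leftarrow>cs. [:-a, 1:])" "length cs = n"
    using char_poly_factorized[OF M] by blast
  have real: "c \<in> \<real>" if "c \<in> set cs" for c
  proof (rule symmetric_eigenvalue_real[OF A sym])
    show "eigenvalue ?M c" unfolding eigenvalue_root_char_poly[OF M] cs(1)
      using that by (auto simp: poly_prod_list prod_list_zero_iff)
  qed auto
  have "map_poly complex_of_real (\<Prod>a\<leftarrow>as. [:-a, 1:]) = (\<Prod>a\<leftarrow>map complex_of_real as. [:-a, 1:])" for as
    
  proof (induction as)
    case (Cons a as)
    interpret map_poly_hom: map_poly_comm_ring_hom complex_of_real ..
    have "map_poly complex_of_real (\<Prod>a\<leftarrow>a # as. [:-a, 1:])
        = map_poly complex_of_real [:-a, 1:] * map_poly complex_of_real (\<Prod>a\<leftarrow>as. [:-a, 1:])"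
      by (simp only: list.map prod_list.Cons map_poly_hom.hom_mult)
    also have "map_poly complex_of_real [:-a, 1:] = [:- complex_of_real a, 1:]" by simp
    finally show ?case using Cons by simp
  qed simp
  from this[of "map Re cs"]
  have "map_poly complex_of_real (\<Prod>a\<leftarrow>map Re cs. [:-a, 1:]) = (\<Prod>a\<leftarrow>cs. [:-a, 1:])"
    using real by (simp add: map_idI cong: map_cong)
  also have "\<dots> = map_poly complex_of_real (char_poly A)"
    using of_real_hom.char_poly_hom[OF A] cs(1) by metis
  finally have eq: "map_poly complex_of_real (\<Prod>a\<leftarrow>map Re cs. [:-a, 1:]) = map_poly complex_of_real (char_poly A)" .
  have "char_poly A = (\<Prod>a\<leftarrow>map Re cs. [:-a, 1:])"
  proof (rule poly_eqI)
    fix k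
    show "coeff (char_poly A) k = coeff (\<Prod>a\<leftarrow>map Re cs. [:-a, 1:]) k"
      using arg_cong[OF eq, of "\<lambda>p. coeff p k"] by (simp add: coeff_map_poly)
  qed
  then show ?thesis using that[of "map Re cs"] cs(2) by simp
qed

text \<open>The diagonal is all that the trace needs; the vanishing entries below it are carried
  along to close the induction.\<close>

lemma upper_triangular_pow_index:
  fixes B :: "real mat"
  assumes B: "B \<in> carrier_mat n n" and ut: "upper_triangular B"
  shows "i < n \<Longrightarrow> j \<le> i \<Longrightarrow> (B ^\<^sub>m k) $$ (i,j) = (if i = j then (B $$ (i,i)) ^ k else 0)"
proof (induction k arbitrary: i j)
  case 0
  then show ?case using B by auto
next
  case (Suc k)
  have "(B ^\<^sub>m Suc k) $$ (i,j) = (\<Sum>l<n. (B ^\<^sub>m k) $$ (i,l) * B $$ (l,j))"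
    using Suc.prems B by (simp add: scalar_prod_def atLeast0LessThan)
  also have "\<dots> = (\<Sum>l<n. if l = i then (if i = j then (B $$ (i,i)) ^ Suc k else 0) else 0)"
  proof (rule sum.cong)
    fix l assume l: "l \<in> {..<n}"
    show "(B ^\<^sub>m k) $$ (i,l) * B $$ (l,j) = (if l = i then (if i = j then (B $$ (i,i)) ^ Suc k else 0) else 0)"
    proof (cases "l \<le> i")
      case True
      then show ?thesis using Suc.IH[OF Suc.prems(1) True] upper_triangularD[OF ut, of j i] Suc.prems B by auto
    next
      case False
      then show ?thesis using upper_triangularD[OF ut, of j l] Suc.prems B l by auto
    qed
  qed simp
  finally show ?case using Suc.prems by simp
qed

text \<open>By Schur's decomposition \<open>A^k\<close> is conjugate to a triangular matrix with the
  \<open>k\<close>-th powers of the eigenvalues on its diagonal, and conjugation preserves the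
  trace.\<close>

lemma sum_pow_eigenvalues:
  fixes A :: "real mat"
  assumes A: "A \<in> carrier_mat n n" and cp: "char_poly A = (\<Prod>a\<leftarrow>as. [:-a, 1:])"
  shows "(\<Sum>i<n. (A ^\<^sub>m k) $$ (i,i)) = (\<Sum>a\<leftarrow>as. a ^ k)"
proof -
  obtain B P Q where sd: "schur_decomposition A as = (B, P, Q)" by (cases "schur_decomposition A as") auto
  from schur_decomposition[OF A cp sd]
  have sim: "similar_mat_wit A B P Q" and ut: "upper_triangular B" and diag: "diag_mat B = as" by auto
  note D = similar_mat_witD2[OF A sim]
  have Ak: "A ^\<^sub>m k = P * (B ^\<^sub>m k) * Q" using similar_mat_wit_pow_id[OF sim] .
  define X where "X = B ^\<^sub>m k"
  have X: "X \<in> carrier_mat n n" unfolding X_def using D by simp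
  have "(A ^\<^sub>m k) $$ (i,i) = (\<Sum>l<n. (\<Sum>j<n. P $$ (i,j) * X $$ (j,l)) * Q $$ (l,i))" if "i < n" for i
    unfolding Ak X_def[symmetric] using that D(4-7) X
    by (simp add: scalar_prod_def atLeast0LessThan del: assoc_mult_mat)
  then have "(\<Sum>i<n. (A ^\<^sub>m k) $$ (i,i)) = (\<Sum>i<n. \<Sum>l<n. \<Sum>j<n. P $$ (i,j) * X $$ (j,l) * Q $$ (l,i))"
    by (simp add: sum_distrib_right)
  also have "\<dots> = (\<Sum>l<n. \<Sum>j<n. \<Sum>i<n. P $$ (i,j) * X $$ (j,l) * Q $$ (l,i))"
    by (subst sum.swap, rule sum.cong[OF refl], subst sum.swap) simp
  \<comment> \<open>Cyclicity of the trace in coordinates: \<open>Q\<close> moves next to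
    \<open>P\<close>, and their product is the identity.\<close>
  also have "\<dots> = (\<Sum>l<n. \<Sum>j<n. X $$ (j,l) * (Q * P) $$ (l,j))"
    using D(4-7) by (auto simp: scalar_prod_def atLeast0LessThan sum_distrib_left mult_ac intro!: sum.cong)
  also have "\<dots> = (\<Sum>l<n. \<Sum>j<n. if j = l then X $$ (l,l) else 0)"
    unfolding D(2) by (intro sum.cong) auto
  also have "\<dots> = (\<Sum>l<n. (B $$ (l,l)) ^ k)"
    unfolding X_def using upper_triangular_pow_index[OF D(5) ut] by simp
  also have "\<dots> = (\<Sum>a\<leftarrow>as. a ^ k)"
  proof -
    have "as = map (\<lambda>l. B $$ (l,l)) [0..<n]" using diag D(5) by (auto simp: diag_mat_def)
    then show ?thesis by (simp add: comp_def interv_sum_list_conv_sum_set_nat atLeast0LessThan)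
  qed
  finally show ?thesis .
qed

section \<open>Powers of a symmetric kernel over a finite index set\<close>

primrec mpow :: "'i set \<Rightarrow> ('i \<Rightarrow> 'i \<Rightarrow> real) \<Rightarrow> nat \<Rightarrow> 'i \<Rightarrow> 'i \<Rightarrow> real" where
  "mpow I b 0 i j = (if i = j then 1 else 0)"
| "mpow I b (Suc k) i j = (\<Sum>l\<in>I. mpow I b k i l * b l j)"

lemma mpow_add:
  assumes "finite I" "i \<in> I" "j \<in> I"
  shows "mpow I b (k + m) i j = (\<Sum>l\<in>I. mpow I b k i l * mpow I b m l j)"
  using assms(3)
proof (induction m arbitrary: j)
  case 0
  have "(\<Sum>l\<in>I. mpow I b k i l * mpow I b 0 l j) = (\<Sum>l\<in>I. if l = j then mpow I b k i j else 0)"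
    by (intro sum.cong) auto
  then show ?case using 0 assms(1) by simp
next
  case (Suc m)
  have "mpow I b (k + Suc m) i j = (\<Sum>l\<in>I. (\<Sum>h\<in>I. mpow I b k i h * mpow I b m h l) * b l j)"
    using Suc.IH by simp
  also have "\<dots> = (\<Sum>h\<in>I. mpow I b k i h * (\<Sum>l\<in>I. mpow I b m h l * b l j))"
    by (simp add: sum_distrib_right sum_distrib_left mult.assoc) (rule sum.swap)
  finally show ?case by simp
qed

lemma mpow_sym:
  assumes I: "finite I" and sym: "\<And>i j. i \<in> I \<Longrightarrow> j \<in> I \<Longrightarrow> b i j = b j i"
  shows "i \<in> I \<Longrightarrow> j \<in> I \<Longrightarrow> mpow I b k i j = mpow I b k j i"
proof (induction k arbitrary: i j)
  case (Suc k)
  have one: "mpow I b 1 j l = b j l" if "l \<in> I" for l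
  proof -
    have "mpow I b 1 j l = (\<Sum>h\<in>I. if h = j then b j l else 0)" by (auto intro!: sum.cong)
    then show ?thesis using Suc.prems I by simp
  qed
  have "mpow I b (Suc k) i j = (\<Sum>l\<in>I. b j l * mpow I b k l i)"
    using Suc sym by (auto intro!: sum.cong simp: mult.commute)
  also have "\<dots> = (\<Sum>l\<in>I. mpow I b 1 j l * mpow I b k l i)"
    using one by (intro sum.cong) auto
  also have "\<dots> = mpow I b (1 + k) j i" using mpow_add[OF I Suc.prems(2,1)] by (simp only:)
  finally show ?case by simp
qed auto

text \<open>By self-adjointness the inner product of \<open>b^k x\<close> and \<open>b^m x\<close>
  depends only on \<open>k + m\<close>; this is what log-convexity rests on.\<close>

lemma mpow_inner:
  assumes I: "finite I" and sym: "\<And>i j. i \<in> I \<Longrightarrow> j \<in> I \<Longrightarrow> b i j = b j i"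
  shows "(\<Sum>i\<in>I. (\<Sum>j\<in>I. mpow I b k i j * x j) * (\<Sum>l\<in>I. mpow I b m i l * x l))
    = (\<Sum>j\<in>I. \<Sum>l\<in>I. x j * x l * mpow I b (k + m) j l)"
proof -
  have "(\<Sum>i\<in>I. (\<Sum>j\<in>I. mpow I b k i j * x j) * (\<Sum>l\<in>I. mpow I b m i l * x l))
      = (\<Sum>i\<in>I. \<Sum>j\<in>I. \<Sum>l\<in>I. x j * x l * (mpow I b k j i * mpow I b m i l))"
    unfolding sum_product using mpow_sym[OF I sym] by (auto intro!: sum.cong simp: mult_ac)
  also have "\<dots> = (\<Sum>j\<in>I. \<Sum>l\<in>I. \<Sum>i\<in>I. x j * x l * (mpow I b k j i * mpow I b m i l))"
    by (subst sum.swap, rule sum.cong[OF refl], rule sum.swap)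
  also have "\<dots> = (\<Sum>j\<in>I. \<Sum>l\<in>I. x j * x l * mpow I b (k + m) j l)"
    using mpow_add[OF I] by (simp add: sum_distrib_left)
  finally show ?thesis .
qed

text \<open>
  The squared norms of \<open>b\<^sup>m x\<close> are log-convex in \<open>m\<close>, so they grow at least geometrically with ratio
  \<open>|b x|\<^sup>2 / |x|\<^sup>2\<close>, while the trace of \<open>b\<^sup>2\<^sup>m\<close> dominates them.
\<close>

lemma norm_le_of_trace_pow:
  fixes b :: "'i \<Rightarrow> 'i \<Rightarrow> real"
  assumes I: "finite I" and sym: "\<And>i j. i \<in> I \<Longrightarrow> j \<in> I \<Longrightarrow> b i j = b j i"
    and tr: "\<And>k. k \<ge> 1 \<Longrightarrow> (\<Sum>i\<in>I. mpow I b (2 * k) i i) \<le> C * \<mu> ^ (2 * k)"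
  shows "(\<Sum>i\<in>I. (\<Sum>j\<in>I. b i j * x j)\<^sup>2) \<le> \<mu>\<^sup>2 * (\<Sum>j\<in>I. (x j)\<^sup>2)"
proof -
  define y where "y k i = (\<Sum>j\<in>I. mpow I b k i j * x j)" for k i
  define a where "a k = (\<Sum>i\<in>I. (y k i)\<^sup>2)" for k
  have a_nonneg: "a k \<ge> 0" for k unfolding a_def by (intro sum_nonneg) auto
  have y0: "y 0 i = x i" if "i \<in> I" for i
  proof -
    have "y 0 i = (\<Sum>j\<in>I. if j = i then x i else 0)" unfolding y_def by (auto intro!: sum.cong)
    then show ?thesis using that I by simp
  qed
  have y1: "y 1 i = (\<Sum>j\<in>I. b i j * x j)" if "i \<in> I" for i
  proof -
    have "mpow I b 1 i j = b i j" for j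
    proof -
      have "mpow I b 1 i j = (\<Sum>h\<in>I. if h = i then b i j else 0)" by (auto intro!: sum.cong)
      then show ?thesis using that I by simp
    qed
    then show ?thesis unfolding y_def by simp
  qed
  have a0: "a 0 = (\<Sum>j\<in>I. (x j)\<^sup>2)" unfolding a_def using y0 by simp
  have a1: "a 1 = (\<Sum>i\<in>I. (\<Sum>j\<in>I. b i j * x j)\<^sup>2)" unfolding a_def using y1 by simp
  have inner: "(\<Sum>i\<in>I. y k i * y m i) = (\<Sum>i\<in>I. y k' i * y m' i)" if "k + m = k' + m'" for k m k' m'
    unfolding y_def using that mpow_inner[OF I sym] by simp
  have logconvex: "(a (Suc k))\<^sup>2 \<le> a k * a (Suc (Suc k))" for k
  proof -
    have "a (Suc k) = (\<Sum>i\<in>I. y k i * y (Suc (Suc k)) i)"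
      using inner[of "Suc k" "Suc k" k "Suc (Suc k)"] unfolding a_def by (simp add: power2_eq_square)
    then show ?thesis unfolding a_def using Cauchy_Schwarz_ineq_sum[of "y k" "y (Suc (Suc k))" I] by simp
  qed
  \<comment> \<open>Cauchy-Schwarz bounds \<open>|b^k x|^2\<close> by \<open>|x|^2\<close> times the
    squared Frobenius norm of \<open>b^k\<close>, which by symmetry is the trace of
    \<open>b^(2k)\<close>.\<close>
  have a_tr: "a k \<le> a 0 * (\<Sum>i\<in>I. mpow I b (2 * k) i i)" for k
  proof -
    have "a k \<le> (\<Sum>i\<in>I. (\<Sum>j\<in>I. (mpow I b k i j)\<^sup>2) * a 0)"
      unfolding a_def[of k] y_def a0 by (intro sum_mono Cauchy_Schwarz_ineq_sum)
    also have "\<dots> = (\<Sum>i\<in>I. (\<Sum>j\<in>I. mpow I b k i j * mpow I b k j i) * a 0)"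
      using mpow_sym[OF I sym] by (auto intro!: sum.cong simp: power2_eq_square)
    also have "\<dots> = (\<Sum>i\<in>I. mpow I b (2 * k) i i * a 0)"
      using mpow_add[OF I, of _ _ b k k] by (auto intro!: sum.cong simp: mult_2)
    finally show ?thesis by (simp add: sum_distrib_left mult.commute)
  qed
  have "a 1 \<le> \<mu>\<^sup>2 * a 0"
  proof (cases "a 0 = 0 \<or> a 1 = 0")
    case True
    then show ?thesis using a_tr[of 1] a_nonneg[of 0] by auto
  next
    case False
    then have pos: "a 0 > 0" "a 1 > 0" using a_nonneg[of 0] a_nonneg[of 1] by auto
    \<comment> \<open>Log-convexity keeps every ratio \<open>a (Suc k) / a k\<close> at least as
      large as the first one; positivity is carried along so that \<open>a k\<close> can be
      cancelled.\<close>
    have step: "a k > 0 \<and> a 1 * a k \<le> a 0 * a (Suc k)" for k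
    proof (induction k)
      case (Suc k)
      then have k: "a k > 0" "a 1 * a k \<le> a 0 * a (Suc k)" by auto
      have "0 < a 1 * a k" using pos k by simp
      then have S: "a (Suc k) > 0" using k(2) pos by (smt (verit) mult_nonneg_nonpos)
      have "a 1 * a k * a (Suc k) \<le> a 0 * (a (Suc k))\<^sup>2"
        using mult_right_mono[OF k(2), of "a (Suc k)"] S by (simp add: power2_eq_square mult.assoc)
      also have "\<dots> \<le> a 0 * (a k * a (Suc (Suc k)))"
        using logconvex pos by (intro mult_left_mono) auto
      finally have "a k * (a 1 * a (Suc k)) \<le> a k * (a 0 * a (Suc (Suc k)))" by (simp add: mult_ac)
      then show ?case using k S by simp
    qed (use pos in simp)
    define \<rho> where "\<rho> = a 1 / a 0"
    have \<rho>: "\<rho> > 0" unfolding \<rho>_def using pos by simp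
    have growth: "a 0 * \<rho> ^ k \<le> a k" for k
    proof (induction k)
      case (Suc k)
      have "a 0 * \<rho> ^ Suc k \<le> \<rho> * a k" using mult_left_mono[OF Suc, of \<rho>] \<rho> by (simp add: mult_ac)
      also have "\<dots> \<le> a (Suc k)" using step[of k] pos unfolding \<rho>_def by (simp add: field_simps)
      finally show ?case .
    qed simp
    have bound: "\<rho> ^ k \<le> C * \<mu> ^ (2 * k)" if "k \<ge> 1" for k
    proof -
      have "a 0 * \<rho> ^ k \<le> a 0 * (C * \<mu> ^ (2 * k))"
        using growth[of k] a_tr[of k] mult_left_mono[OF tr[OF that], of "a 0"] pos by linarith
      then show ?thesis using pos by simp
    qed
    have "\<rho> \<le> \<mu>\<^sup>2"
    \<comment> \<open>The constant \<open>C\<close> disappears in the limit: if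
      \<open>\<rho>\<close> exceeded \<open>\<mu>^2\<close>, the powers of their quotient would
      outgrow \<open>C\<close>.\<close>
    proof (rule ccontr)
      assume neg: "\<not> \<rho> \<le> \<mu>\<^sup>2"
      have mu: "\<mu>\<^sup>2 > 0" using bound[of 1] \<rho> by (cases "\<mu> = 0") auto
      then have "\<rho> / \<mu>\<^sup>2 > 1" using neg by (simp add: field_simps)
      then obtain k where k: "C < (\<rho> / \<mu>\<^sup>2) ^ k" using real_arch_pow by blast
      have "(\<rho> / \<mu>\<^sup>2) ^ k \<le> (\<rho> / \<mu>\<^sup>2) ^ Suc k" using \<open>\<rho> / \<mu>\<^sup>2 > 1\<close> by (intro power_increasing) auto
      also have "\<dots> = \<rho> ^ Suc k / \<mu> ^ (2 * Suc k)" by (simp only: power_divide power_mult)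
      also have "\<dots> \<le> C"
      proof -
        have "\<mu> ^ (2 * Suc k) > 0" using mu by (simp only: power_mult zero_less_power)
        then show ?thesis using bound[of "Suc k"] by (simp add: divide_le_eq)
      qed
      finally show False using k by simp
    qed
    then show ?thesis unfolding \<rho>_def using pos by (simp add: field_simps)
  qed
  then show ?thesis using a0 a1 by simp
qed

lemma mpow_row_sum:
  assumes I: "finite I" and row: "\<And>i. i \<in> I \<Longrightarrow> (\<Sum>j\<in>I. a i j) = d" and "i \<in> I"
  shows "(\<Sum>j\<in>I. mpow I a k i j) = d ^ k"
proof (induction k)
  case 0
  then show ?case using assms by simp
next
  case (Suc k)
  have "(\<Sum>j\<in>I. mpow I a (Suc k) i j) = (\<Sum>l\<in>I. mpow I a k i l * (\<Sum>j\<in>I. a l j))"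
    by (simp add: sum_distrib_left) (rule sum.swap)
  also have "\<dots> = d ^ k * d" using row Suc by (simp flip: sum_distrib_right)
  finally show ?case by simp
qed

text \<open>With \<open>J\<close> the all-ones kernel, \<open>a J = d J\<close> and
  \<open>(c J)^2 = d c J\<close>, so only one multiple of \<open>J\<close> survives in each power.
  At exponent 0 both powers are the identity, hence the start at \<open>Suc k\<close>.\<close>

lemma mpow_deflate:
  assumes I: "finite I" and row: "\<And>i. i \<in> I \<Longrightarrow> (\<Sum>j\<in>I. a i j) = d"
    and sym: "\<And>i j. i \<in> I \<Longrightarrow> j \<in> I \<Longrightarrow> a i j = a j i"
    and c: "real (card I) * c = d" and i: "i \<in> I" "j \<in> I"
  shows "mpow I (\<lambda>i j. a i j - c) (Suc k) i j = mpow I a (Suc k) i j - d ^ k * c"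
  using i(2)
proof (induction k arbitrary: j)
  case 0
  have "(\<Sum>l\<in>I. (if i = l then 1 else 0) * f l) = (f i :: real)" for f
  proof -
    have "(\<Sum>l\<in>I. (if i = l then 1 else 0) * f l) = (\<Sum>l\<in>I. if l = i then f i else 0)"
      by (auto intro!: sum.cong)
    then show ?thesis using I i by simp
  qed
  then show ?case by simp
next
  case (Suc k)
  have col: "(\<Sum>l\<in>I. a l j) = d" using row[OF Suc.prems] sym[OF _ Suc.prems] by simp
  define m where "m = mpow I a (Suc k) i"
  define D where "D = d ^ k * c"
  have IH: "mpow I (\<lambda>i j. a i j - c) (Suc k) i l = m l - D" if "l \<in> I" for l
    using Suc.IH[OF that] unfolding m_def D_def .
  have m: "(\<Sum>l\<in>I. m l) = d ^ Suc k" unfolding m_def by (rule mpow_row_sum[OF I row i(1)])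
  have D: "real (card I) * (D * c) = d * D" using c by (simp add: mult_ac)
  have "mpow I (\<lambda>i j. a i j - c) (Suc (Suc k)) i j = (\<Sum>l\<in>I. (m l - D) * (a l j - c))"
    unfolding mpow.simps(2)[of _ _ "Suc k"] by (intro sum.cong refl) (simp only: IH)
  also have "\<dots> = (\<Sum>l\<in>I. m l * a l j - m l * c - D * a l j + D * c)"
    by (simp add: algebra_simps)
  also have "\<dots> = (\<Sum>l\<in>I. m l * a l j) - (\<Sum>l\<in>I. m l) * c - D * (\<Sum>l\<in>I. a l j) + real (card I) * (D * c)"
    by (simp only: sum.distrib sum_subtractf sum_distrib_left sum_distrib_right sum_constant)
  also have "\<dots> = (\<Sum>l\<in>I. m l * a l j) - d ^ Suc k * c"
    unfolding m D col by (simp add: D_def)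
  finally show ?case unfolding m_def mpow.simps(2)[of _ _ "Suc k"] .
qed

text \<open>Read the eigenvalue equation at a coordinate of the eigenvector with the largest
  absolute value.\<close>

lemma eigenvalue_abs_le_row_sum:
  fixes A :: "real mat"
  assumes A: "A \<in> carrier_mat n n" and nn: "\<And>i j. i < n \<Longrightarrow> j < n \<Longrightarrow> A $$ (i,j) \<ge> 0"
    and row: "\<And>i. i < n \<Longrightarrow> (\<Sum>j<n. A $$ (i,j)) = d" and ev: "eigenvalue A c"
  shows "\<bar>c\<bar> \<le> d"
proof -
  from ev obtain v where v: "v \<in> carrier_vec n" "v \<noteq> 0\<^sub>v n" "A *\<^sub>v v = c \<cdot>\<^sub>v v"
    unfolding eigenvalue_def eigenvector_def using A by auto
  obtain i0 where i0: "i0 < n" "v $ i0 \<noteq> 0" using v(1,2) by (metis eq_vecI carrier_vecD index_zero_vec)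
  define M where "M = Max ((\<lambda>i. \<bar>v $ i\<bar>) ` {..<n})"
  have le: "\<bar>v $ i\<bar> \<le> M" if "i < n" for i unfolding M_def using that by (intro Max_ge) auto
  have M: "M > 0" using le[OF i0(1)] i0(2) by linarith
  have "M \<in> (\<lambda>i. \<bar>v $ i\<bar>) ` {..<n}" unfolding M_def using i0 by (intro Max_in) auto
  then obtain m where m: "m < n" "\<bar>v $ m\<bar> = M" by auto
  have "c * v $ m = (A *\<^sub>v v) $ m" using v m by simp
  also have "\<dots> = (\<Sum>j<n. A $$ (m,j) * v $ j)"
    using A v(1) m by (auto simp: scalar_prod_def atLeast0LessThan)
  finally have "\<bar>c\<bar> * M = \<bar>\<Sum>j<n. A $$ (m,j) * v $ j\<bar>" using m by (metis abs_mult)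
  also have "\<dots> \<le> (\<Sum>j<n. \<bar>A $$ (m,j) * v $ j\<bar>)" by (rule sum_abs)
  also have "\<dots> \<le> (\<Sum>j<n. A $$ (m,j) * M)"
    using nn m le by (intro sum_mono) (auto simp: abs_mult intro!: mult_left_mono)
  also have "\<dots> = d * M" using row m by (simp flip: sum_distrib_right)
  finally show ?thesis using M by simp
qed

lemma sum_even_pow_sorted_le:
  fixes as :: "real list"
  assumes bound: "\<And>a. a \<in> set as \<Longrightarrow> \<bar>a\<bar> \<le> d" and n: "length as = n" "n \<ge> 2"
    and L: "rev (sorted_list_of_multiset (image_mset abs (mset as))) ! 1 \<le> lam"
  shows "(\<Sum>a\<leftarrow>as. a ^ (2 * k)) \<le> d ^ (2 * k) + real n * lam ^ (2 * k)"
proof -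
  define L where "L = rev (sorted_list_of_multiset (image_mset abs (mset as)))"
  have mL: "mset L = image_mset abs (mset as)" unfolding L_def by simp
  then have len: "length L = n" using n by (metis mset_map size_mset length_map)
  have setL: "set L = abs ` set as" using mL by (metis set_image_mset set_mset_mset)
  have desc: "L ! j \<le> L ! i" if "i \<le> j" "j < n" for i j
    using that len unfolding L_def by (intro sorted_rev_nth_mono) auto
  have nn: "x \<ge> 0" if "x \<in> set L" for x using that setL by auto
  have lam: "L ! i \<le> lam" if "1 \<le> i" "i < n" for i using desc[OF that] L unfolding L_def by simp
  have ms: "(\<Sum>x\<in>#mset xs. f x) = (\<Sum>x\<leftarrow>xs. f x)" for xs :: "real list" and f :: "real \<Rightarrow> real"
    by (metis mset_map sum_mset_sum_list)
  have "(\<Sum>a\<leftarrow>as. a ^ (2 * k)) = (\<Sum>a\<in>#mset as. \<bar>a\<bar> ^ (2 * k))"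
    unfolding ms by (simp add: power_mult)
  also have "\<dots> = (\<Sum>x\<in>#mset L. x ^ (2 * k))" unfolding mL by (simp add: image_mset.compositionality comp_def)
  also have "\<dots> = (\<Sum>i<n. (L ! i) ^ (2 * k))"
    unfolding ms by (simp add: sum_list_sum_nth len atLeast0LessThan)
  \<comment> \<open>The power of \<open>lam\<close> is added at index 0 too; it is nonnegative
    because the exponent is even, and it makes the count \<open>n\<close> instead of
    \<open>n - 1\<close>.\<close>
  also have "\<dots> \<le> (\<Sum>i<n. (if i = 0 then d ^ (2 * k) else 0) + lam ^ (2 * k))"
  proof (rule sum_mono)
    fix i assume i: "i \<in> {..<n}"
    then have mem: "L ! i \<in> set L" using len by simp
    show "(L ! i) ^ (2 * k) \<le> (if i = 0 then d ^ (2 * k) else 0) + lam ^ (2 * k)"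
    proof (cases "i = 0")
      case True
      have "L ! i \<le> d" using mem setL bound by fastforce
      then have "(L ! i) ^ (2 * k) \<le> d ^ (2 * k)" by (rule power_mono[OF _ nn[OF mem]])
      moreover have "0 \<le> lam ^ (2 * k)" by (simp add: power_mult)
      ultimately have "(L ! i) ^ (2 * k) \<le> d ^ (2 * k) + lam ^ (2 * k)" by linarith
      then show ?thesis using True by simp
    next
      case False
      have "(L ! i) ^ (2 * k) \<le> lam ^ (2 * k)" by (rule power_mono[OF lam nn[OF mem]]) (use False i in auto)
      then show ?thesis using False by simp
    qed
  qed
  also have "\<dots> = d ^ (2 * k) + real n * lam ^ (2 * k)" using n by (simp add: sum.distrib)
  finally show ?thesis .
qed

text \<open>Deflation by \<open>d / n\<close> removes \<open>d^(2k)\<close> from the trace of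
  \<open>A^(2k)\<close>, and at most \<open>n lam^(2k)\<close> is left. The norm bound then comes
  from traces of high powers, without an orthonormal basis of eigenvectors and without identifying
  which eigenvector belongs to \<open>d\<close>.\<close>

lemma second_eigenvalue_norm_bound:
  fixes A :: "real mat"
  assumes A: "A \<in> carrier_mat n n" and sym: "\<And>i j. i < n \<Longrightarrow> j < n \<Longrightarrow> A $$ (i,j) = A $$ (j,i)"
    and nn: "\<And>i j. i < n \<Longrightarrow> j < n \<Longrightarrow> A $$ (i,j) \<ge> 0"
    and row: "\<And>i. i < n \<Longrightarrow> (\<Sum>j<n. A $$ (i,j)) = d" and n: "n \<ge> 2"
    and lam: "second_abs_eigenvalue A \<le> lam"
  shows "(\<Sum>i<n. (\<Sum>j<n. (A $$ (i,j) - d / n) * x j)\<^sup>2) \<le> lam\<^sup>2 * (\<Sum>j<n. (x j)\<^sup>2)"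
proof -
  obtain as where as: "char_poly A = (\<Prod>a\<leftarrow>as. [:-a, 1:])" "length as = n"
    using char_poly_symmetric_splits[OF A sym] by blast
  let ?a = "\<lambda>i j. A $$ (i,j)"
  have mp: "mpow {..<n} ?a k i j = (A ^\<^sub>m k) $$ (i,j)" if "i < n" "j < n" for i j k
    using that
  proof (induction k arbitrary: j)
    case (Suc k)
    then show ?case using A by (auto simp: scalar_prod_def atLeast0LessThan intro!: sum.cong)
  qed (use A in auto)
  have tr: "(\<Sum>i<n. mpow {..<n} ?a k i i) = (\<Sum>a\<leftarrow>as. a ^ k)" for k
    using sum_pow_eigenvalues[OF A as(1)] mp by simp
  have bound: "\<bar>a\<bar> \<le> d" if "a \<in> set as" for a
  proof (rule eigenvalue_abs_le_row_sum[OF A nn row])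
    show "eigenvalue A a" unfolding eigenvalue_root_char_poly[OF A] as(1)
      using that by (auto simp: poly_prod_list prod_list_zero_iff)
  qed auto
  have "rev (sorted_list_of_multiset (image_mset abs (mset as))) ! 1 \<le> lam"
    using lam unfolding second_abs_eigenvalue_def as(1) proots_prod_linear_factors .
  note sums = sum_even_pow_sorted_le[OF bound as(2) n this]
  show ?thesis
  proof (rule norm_le_of_trace_pow[where C = "real n"])
    fix k :: nat assume "k \<ge> 1"
    then obtain m where m: "2 * k = Suc m" by (cases "2 * k") auto
    have "(\<Sum>i<n. mpow {..<n} (\<lambda>i j. A $$ (i,j) - d / n) (2 * k) i i)
        = (\<Sum>i<n. mpow {..<n} ?a (2 * k) i i - d ^ m * (d / n))"
    proof (rule sum.cong[OF refl])
      fix i assume "i \<in> {..<n}"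
      then show "mpow {..<n} (\<lambda>i j. A $$ (i,j) - d / n) (2 * k) i i = mpow {..<n} ?a (2 * k) i i - d ^ m * (d / n)"
        unfolding m by (intro mpow_deflate row sym) (use n in auto)
    qed
    also have "\<dots> = (\<Sum>a\<leftarrow>as. a ^ (2 * k)) - d ^ (2 * k)"
      unfolding sum_subtractf tr using n m by simp
    also have "\<dots> \<le> real n * lam ^ (2 * k)" using sums[of k] by simp
    finally show "(\<Sum>i<n. mpow {..<n} (\<lambda>i j. A $$ (i,j) - d / n) (2 * k) i i) \<le> real n * lam ^ (2 * k)" .
  next
    fix i j assume "i \<in> {..<n}" "j \<in> {..<n}"
    then show "A $$ (i,j) - d / n = A $$ (j,i) - d / n" using sym[of i j] by simp
  qed simp
qed

lemma second_abs_eigenvalue_nonneg: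
  fixes A :: "real mat"
  assumes A: "A \<in> carrier_mat n n" and sym: "\<And>i j. i < n \<Longrightarrow> j < n \<Longrightarrow> A $$ (i,j) = A $$ (j,i)"
    and n: "n \<ge> 2"
  shows "second_abs_eigenvalue A \<ge> 0"
proof -
  obtain as where as: "char_poly A = (\<Prod>a\<leftarrow>as. [:-a, 1:])" "length as = n"
    using char_poly_symmetric_splits[OF A sym] by blast
  define L where "L = rev (sorted_list_of_multiset (image_mset abs (mset as)))"
  have mL: "mset L = image_mset abs (mset as)" unfolding L_def by simp
  then have "length L = n" using as(2) by (metis mset_map size_mset length_map)
  then have "L ! 1 \<in> set L" using n by simp
  moreover have "set L = abs ` set as" using mL by (metis set_image_mset set_mset_mset)
  ultimately have "L ! 1 \<ge> 0" by auto
  then show ?thesis unfolding second_abs_eigenvalue_def as(1) proots_prod_linear_factors L_def .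
qed

section \<open>The nibble\<close>

definition subset_expectation :: "'i set \<Rightarrow> ('i \<Rightarrow> real) \<Rightarrow> ('i set \<Rightarrow> real) \<Rightarrow> real" where
  "subset_expectation I p f = (\<Sum>S\<in>Pow I. (\<Prod>e\<in>S. p e) * (\<Prod>e\<in>I - S. 1 - p e) * f S)"

text \<open>Expand the product over \<open>I\<close> of \<open>p e + (1 - p e)\<close> with the
  first summand deleted on \<open>A\<close>: exactly the sets avoiding \<open>A\<close> survive.
  Deleting the second summand instead proves \<open>subset_expectation_contain\<close>.\<close>

lemma subset_expectation_avoid:
  assumes "finite I" "A \<subseteq> I"
  shows "subset_expectation I p (\<lambda>S. of_bool (S \<inter> A = {})) = (\<Prod>e\<in>A. 1 - p e)"
proof -
  define a where "a e = (if e \<in> A then 0 else p e)" for e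
  have "(\<Prod>e\<in>I. a e + (1 - p e)) = (\<Sum>S\<in>Pow I. (\<Prod>e\<in>S. a e) * (\<Prod>e\<in>I - S. 1 - p e))"
    by (rule prod_add[OF assms(1)])
  also have "\<dots> = subset_expectation I p (\<lambda>S. of_bool (S \<inter> A = {}))" unfolding subset_expectation_def
  proof (rule sum.cong[OF refl])
    fix S assume "S \<in> Pow I"
    then have fin: "finite S" using assms finite_subset by auto
    show "(\<Prod>e\<in>S. a e) * (\<Prod>e\<in>I - S. 1 - p e) = (\<Prod>e\<in>S. p e) * (\<Prod>e\<in>I - S. 1 - p e) * of_bool (S \<inter> A = {})"
    proof (cases "S \<inter> A = {}")
      case True
      then have "(\<Prod>e\<in>S. a e) = (\<Prod>e\<in>S. p e)" unfolding a_def by (intro prod.cong) auto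
      then show ?thesis using True by simp
    next
      case False
      then have "(\<Prod>e\<in>S. a e) = 0" using fin by (auto simp: prod_zero_iff a_def)
      then show ?thesis using False by simp
    qed
  qed
  also have "(\<Prod>e\<in>I. a e + (1 - p e)) = (\<Prod>e\<in>A. 1 - p e) * (\<Prod>e\<in>I - A. 1)"
    unfolding a_def by (subst prod.subset_diff[OF assms(2,1)]) (simp add: mult.commute)
  finally show ?thesis by simp
qed

lemma subset_expectation_contain:
  assumes "finite I" "A \<subseteq> I"
  shows "subset_expectation I p (\<lambda>S. of_bool (A \<subseteq> S)) = (\<Prod>e\<in>A. p e)"
proof -
  define b where "b e = (if e \<in> A then 0 else 1 - p e)" for e
  have "(\<Prod>e\<in>I. p e + b e) = (\<Sum>S\<in>Pow I. (\<Prod>e\<in>S. p e) * (\<Prod>e\<in>I - S. b e))"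
    by (rule prod_add[OF assms(1)])
  also have "\<dots> = subset_expectation I p (\<lambda>S. of_bool (A \<subseteq> S))" unfolding subset_expectation_def
  proof (rule sum.cong[OF refl])
    fix S assume "S \<in> Pow I"
    show "(\<Prod>e\<in>S. p e) * (\<Prod>e\<in>I - S. b e) = (\<Prod>e\<in>S. p e) * (\<Prod>e\<in>I - S. 1 - p e) * of_bool (A \<subseteq> S)"
    proof (cases "A \<subseteq> S")
      case True
      then have "(\<Prod>e\<in>I - S. b e) = (\<Prod>e\<in>I - S. 1 - p e)" unfolding b_def by (intro prod.cong) auto
      then show ?thesis using True by simp
    next
      case False
      then obtain e where "e \<in> A" "e \<notin> S" by auto
      then have "(\<Prod>e\<in>I - S. b e) = 0" using assms by (auto simp: prod_zero_iff b_def)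
      then show ?thesis using False by simp
    qed
  qed
  also have "(\<Prod>e\<in>I. p e + b e) = (\<Prod>e\<in>A. p e) * (\<Prod>e\<in>I - A. 1)"
    unfolding b_def by (subst prod.subset_diff[OF assms(2,1)]) (simp add: mult.commute)
  finally show ?thesis by simp
qed

lemma subset_expectation_add: "subset_expectation I p (\<lambda>S. f S + g S) = subset_expectation I p f + subset_expectation I p g"
  unfolding subset_expectation_def by (simp add: distrib_left sum.distrib)

lemma subset_expectation_diff: "subset_expectation I p (\<lambda>S. f S - g S) = subset_expectation I p f - subset_expectation I p g"
  unfolding subset_expectation_def by (simp add: right_diff_distrib sum_subtractf)

lemma subset_expectation_cmult: "subset_expectation I p (\<lambda>S. c * f S) = c * subset_expectation I p f"
  unfolding subset_expectation_def by (simp add: sum_distrib_left mult_ac)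

lemma subset_expectation_sum: "subset_expectation I p (\<lambda>S. \<Sum>x\<in>A. f x S) = (\<Sum>x\<in>A. subset_expectation I p (f x))"
  unfolding subset_expectation_def by (simp add: sum_distrib_left) (rule sum.swap)

lemma subset_expectation_one: "finite I \<Longrightarrow> subset_expectation I p (\<lambda>S. 1) = 1"
  using subset_expectation_avoid[of I "{}" p] by simp

context
  fixes I :: "'i set" and p :: "'i \<Rightarrow> real"
  assumes I: "finite I" and p: "\<And>e. e \<in> I \<Longrightarrow> 0 \<le> p e \<and> p e \<le> 1"
begin

lemma subset_expectation_weight_nonneg: "S \<in> Pow I \<Longrightarrow> (\<Prod>e\<in>S. p e) * (\<Prod>e\<in>I - S. 1 - p e) \<ge> 0"
  using p by (intro mult_nonneg_nonneg prod_nonneg) auto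

lemma subset_expectation_mono: "(\<And>S. S \<subseteq> I \<Longrightarrow> f S \<le> g S) \<Longrightarrow> subset_expectation I p f \<le> subset_expectation I p g"
  unfolding subset_expectation_def by (intro sum_mono mult_left_mono subset_expectation_weight_nonneg) auto

text \<open>The variance is nonnegative.\<close>

lemma subset_expectation_sqr_le: "(subset_expectation I p f)\<^sup>2 \<le> subset_expectation I p (\<lambda>S. (f S)\<^sup>2)"
proof -
  define m where "m = subset_expectation I p f"
  have "0 = subset_expectation I p (\<lambda>S. 0)" by (simp add: subset_expectation_def)
  also have "\<dots> \<le> subset_expectation I p (\<lambda>S. (f S - m)\<^sup>2)" by (intro subset_expectation_mono) auto
  also have "(\<lambda>S. (f S - m)\<^sup>2) = (\<lambda>S. ((f S)\<^sup>2 - (2 * m) * f S) + m\<^sup>2 * 1)"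
    by (auto simp: power2_eq_square algebra_simps)
  also have "subset_expectation I p \<dots> = subset_expectation I p (\<lambda>S. (f S)\<^sup>2) - 2 * m * m + m\<^sup>2"
    unfolding subset_expectation_add subset_expectation_diff subset_expectation_cmult subset_expectation_one[OF I] m_def by simp
  finally show ?thesis unfolding m_def by (simp add: power2_eq_square)
qed

text \<open>The first moment method. A single functional is made small, so all quantities of a round
  have to be combined into one \<open>f\<close> beforehand.\<close>

lemma subset_expectation_attained: "\<exists>S \<subseteq> I. f S \<le> subset_expectation I p f"
proof (rule ccontr)
  assume neg: "\<not> ?thesis"
  define m where "m = subset_expectation I p f"
  have lt: "m < f S" if "S \<in> Pow I" for S using neg that unfolding m_def by auto
  \<comment> \<open>The minimum over the finitely many subsets turns pointwise strictness into a
    uniform gap, so sets of weight 0 do no harm.\<close>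
  obtain m' where m': "m < m'" "\<And>S. S \<in> Pow I \<Longrightarrow> m' \<le> f S"
  proof
    show "m < Min (f ` Pow I)" using I lt by (subst Min_gr_iff) auto
    show "\<And>S. S \<in> Pow I \<Longrightarrow> Min (f ` Pow I) \<le> f S" using I by (intro Min_le) auto
  qed
  have "m' = subset_expectation I p (\<lambda>S. m' * 1)" unfolding subset_expectation_cmult subset_expectation_one[OF I] by simp
  also have "\<dots> \<le> m" unfolding m_def using m'(2) by (intro subset_expectation_mono) auto
  finally show False using m'(1) by simp
qed

end

section \<open>Fractional matchings with small pair weights\<close>

locale fractional_matching =
  fixes V :: "'a set" and E :: "'a set set" and w :: "'a set \<Rightarrow> real" and k :: nat and \<kappa> :: real
  assumes finV: "finite V" and k2: "k \<ge> 2" and kappa0: "\<kappa> \<ge> 0"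
    and edge: "\<And>e. e \<in> E \<Longrightarrow> e \<subseteq> V \<and> card e = k"
    and w0: "\<And>e. e \<in> E \<Longrightarrow> w e \<ge> 0"
    and load1: "\<And>v. v \<in> V \<Longrightarrow> (\<Sum>e | e \<in> E \<and> v \<in> e. w e) \<le> 1"
    and pair: "\<And>u v. u \<in> V \<Longrightarrow> v \<in> V \<Longrightarrow> u \<noteq> v \<Longrightarrow> (\<Sum>e | e \<in> E \<and> u \<in> e \<and> v \<in> e. w e) \<le> \<kappa>"
begin

definition load :: "'a \<Rightarrow> real" where "load v = (\<Sum>e | e \<in> E \<and> v \<in> e. w e)"
definition deficit :: real where "deficit = real (card V) - real k * sum w E"
definition I :: "'a set set" where "I = E \<union> (\<lambda>v. {v}) ` V"
definition mu :: "'a set \<Rightarrow> real" where "mu e = (if e \<in> E then w e else 1 - load (the_elem e))"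
definition hit :: "'a set \<Rightarrow> 'a set set" where "hit U = {e \<in> I. e \<inter> U \<noteq> {}}"

lemma finE: "finite E" using edge finV by (metis finite_Pow_iff finite_subset PowI subsetI)
lemma finI: "finite I" unfolding I_def using finE finV by simp
lemma single_notin: "{v} \<notin> E" using edge[of "{v}"] k2 by auto
lemma load0: "load v \<ge> 0" unfolding load_def using w0 by (intro sum_nonneg) auto
lemma mu0: "e \<in> I \<Longrightarrow> mu e \<ge> 0"
  unfolding mu_def I_def using w0 load1 single_notin by (auto simp: load_def)

lemma sum_mu_at: "v \<in> V \<Longrightarrow> (\<Sum>e | e \<in> I \<and> v \<in> e. mu e) = 1"
proof -
  assume v: "v \<in> V"
  have eq: "{e. e \<in> I \<and> v \<in> e} = insert {v} {e. e \<in> E \<and> v \<in> e}" unfolding I_def using v by auto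
  have "(\<Sum>e | e \<in> I \<and> v \<in> e. mu e) = mu {v} + (\<Sum>e | e \<in> E \<and> v \<in> e. mu e)"
    unfolding eq using finE single_notin by (subst sum.insert) auto
  also have "(\<Sum>e | e \<in> E \<and> v \<in> e. mu e) = load v" unfolding load_def mu_def by (intro sum.cong) auto
  finally show ?thesis unfolding mu_def using single_notin by simp
qed

lemma sum_mu_pair: "u \<in> V \<Longrightarrow> v \<in> V \<Longrightarrow> u \<noteq> v \<Longrightarrow> (\<Sum>e | e \<in> I \<and> u \<in> e \<and> v \<in> e. mu e) \<le> \<kappa>"
proof -
  assume a: "u \<in> V" "v \<in> V" "u \<noteq> v"
  have eq: "{e. e \<in> I \<and> u \<in> e \<and> v \<in> e} = {e. e \<in> E \<and> u \<in> e \<and> v \<in> e}" unfolding I_def using a by auto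
  have "(\<Sum>e | e \<in> I \<and> u \<in> e \<and> v \<in> e. mu e) = (\<Sum>e | e \<in> E \<and> u \<in> e \<and> v \<in> e. w e)"
    unfolding eq mu_def by (intro sum.cong) auto
  then show ?thesis using pair[OF a] by simp
qed

lemma sum_load: "sum load V = real k * sum w E"
proof -
  have "sum load V = (\<Sum>v\<in>V. \<Sum>e\<in>E. if v \<in> e then w e else 0)"
    unfolding load_def by (intro sum.cong refl sum.inter_filter finE)
  also have "\<dots> = (\<Sum>e\<in>E. \<Sum>v\<in>V. if v \<in> e then w e else 0)" by (rule sum.swap)
  also have "\<dots> = (\<Sum>e\<in>E. real k * w e)"
  proof (rule sum.cong[OF refl])
    fix e assume e: "e \<in> E"
    have "V \<inter> {v. v \<in> e} = e" using edge[OF e] by auto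
    then show "(\<Sum>v\<in>V. if v \<in> e then w e else 0) = real k * w e"
      using finV edge[OF e] by (simp add: sum.If_cases)
  qed
  finally show ?thesis by (simp add: sum_distrib_left)
qed

lemma deficit_eq: "deficit = (\<Sum>v\<in>V. 1 - load v)"
  unfolding deficit_def sum_load[symmetric] by (simp add: sum_subtractf)

lemma deficit_bounds: "0 \<le> deficit" "deficit \<le> card V"
proof -
  show "0 \<le> deficit" unfolding deficit_eq using load1 by (intro sum_nonneg) (auto simp: load_def)
  show "deficit \<le> card V" unfolding deficit_def using w0 by (simp add: sum_nonneg)
qed

lemma card_Int_sum: "finite U \<Longrightarrow> real (card (e \<inter> U)) = (\<Sum>u\<in>U. of_bool (u \<in> e))"
  by (simp add: of_bool_def sum.If_cases Int_commute)

lemma sum_I_if: "(\<Sum>e\<in>I. mu e * of_bool (P e)) = (\<Sum>e | e \<in> I \<and> P e. mu e)"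
  using finI by (simp add: of_bool_def if_distrib[of "\<lambda>x. _ * x"] sum.If_cases Int_def cong: if_cong)

lemma mu_hit_upper:
  assumes "U \<subseteq> V" shows "sum mu (hit U) \<le> card U"
proof -
  have U: "finite U" using assms finV finite_subset by auto
  have "sum mu (hit U) = (\<Sum>e\<in>I. mu e * of_bool (e \<inter> U \<noteq> {}))" unfolding hit_def sum_I_if ..
  also have "\<dots> \<le> (\<Sum>e\<in>I. mu e * (\<Sum>u\<in>U. of_bool (u \<in> e)))"
  proof (intro sum_mono mult_left_mono mu0)
    fix e
    have "of_bool (e \<inter> U \<noteq> {}) \<le> real (card (e \<inter> U))" using U by (cases "e \<inter> U = {}") (auto simp: Suc_le_eq card_gt_0_iff)
    then show "of_bool (e \<inter> U \<noteq> {}) \<le> (\<Sum>u\<in>U. of_bool (u \<in> e) :: real)" unfolding card_Int_sum[OF U] .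
  qed
  also have "\<dots> = (\<Sum>u\<in>U. \<Sum>e\<in>I. mu e * of_bool (u \<in> e))"
    by (simp add: sum_distrib_left) (rule sum.swap)
  also have "\<dots> = (\<Sum>u\<in>U. 1)" unfolding sum_I_if using assms sum_mu_at by (intro sum.cong) auto
  finally show ?thesis by simp
qed

text \<open>A Bonferroni inequality: if an item meets \<open>U\<close> in \<open>j\<close> vertices,
  then \<open>2 j - j^2\<close> is at most 1, and it is 0 for \<open>j = 0\<close>. Summed against
  \<open>mu\<close>, the term \<open>j\<close> gives \<open>card U\<close> exactly, and
  \<open>j^2\<close> exceeds this only by ordered pairs, each of weight at most
  \<open>\<kappa>\<close>.\<close>

lemma mu_hit_lower:
  assumes "U \<subseteq> V" shows "sum mu (hit U) \<ge> card U - (card U)\<^sup>2 * \<kappa>"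
proof -
  have U: "finite U" using assms finV finite_subset by auto
  let ?j = "\<lambda>e. real (card (e \<inter> U))"
  have j2: "(?j e)\<^sup>2 = (\<Sum>u\<in>U. \<Sum>v\<in>U. of_bool (u \<in> e \<and> v \<in> e))" for e
    unfolding card_Int_sum[OF U] power2_eq_square sum_product by (intro sum.cong) auto
  have A: "(\<Sum>e\<in>I. mu e * ?j e) = card U"
  proof -
    have "(\<Sum>e\<in>I. mu e * ?j e) = (\<Sum>u\<in>U. \<Sum>e\<in>I. mu e * of_bool (u \<in> e))"
      unfolding card_Int_sum[OF U] by (simp add: sum_distrib_left) (rule sum.swap)
    also have "\<dots> = (\<Sum>u\<in>U. 1)" unfolding sum_I_if using assms sum_mu_at by (intro sum.cong) auto
    finally show ?thesis by simp
  qed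
  have B: "(\<Sum>e\<in>I. mu e * (?j e)\<^sup>2) \<le> card U + (card U)\<^sup>2 * \<kappa>"
  proof -
    have "(\<Sum>e\<in>I. mu e * (?j e)\<^sup>2) = (\<Sum>u\<in>U. \<Sum>e\<in>I. \<Sum>v\<in>U. mu e * of_bool (u \<in> e \<and> v \<in> e))"
      unfolding j2 by (simp add: sum_distrib_left) (rule sum.swap)
    also have "\<dots> = (\<Sum>u\<in>U. \<Sum>v\<in>U. \<Sum>e\<in>I. mu e * of_bool (u \<in> e \<and> v \<in> e))"
      by (intro sum.cong refl sum.swap)
    also have "\<dots> = (\<Sum>u\<in>U. \<Sum>v\<in>U. \<Sum>e | e \<in> I \<and> u \<in> e \<and> v \<in> e. mu e)" unfolding sum_I_if ..
    also have "\<dots> \<le> (\<Sum>u\<in>U. \<Sum>v\<in>U. (if v = u then 1 else 0) + \<kappa>)"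
    proof (intro sum_mono)
      fix u v assume "u \<in> U" "v \<in> U"
      then show "(\<Sum>e | e \<in> I \<and> u \<in> e \<and> v \<in> e. mu e) \<le> (if v = u then 1 else 0) + \<kappa>"
        using sum_mu_at[of u] sum_mu_pair[of u v] assms kappa0 by auto
    qed
    also have "\<dots> = card U + (card U)\<^sup>2 * \<kappa>" using U by (simp add: sum.distrib power2_eq_square algebra_simps)
    finally show ?thesis .
  qed
  have "card U - (card U)\<^sup>2 * \<kappa> \<le> (\<Sum>e\<in>I. mu e * (2 * ?j e - (?j e)\<^sup>2))"
    using A B by (simp add: right_diff_distrib sum_subtractf) (simp add: mult.left_commute flip: sum_distrib_left)
  also have "\<dots> \<le> (\<Sum>e\<in>I. mu e * of_bool (e \<inter> U \<noteq> {}))"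
  proof (intro sum_mono mult_left_mono mu0)
    fix e
    have "0 \<le> (?j e - 1)\<^sup>2" by simp
    then show "2 * ?j e - (?j e)\<^sup>2 \<le> of_bool (e \<inter> U \<noteq> {})"
      by (cases "e \<inter> U = {}") (simp_all add: power2_eq_square algebra_simps)
  qed
  also have "\<dots> = sum mu (hit U)" unfolding hit_def sum_I_if ..
  finally show ?thesis .
qed

end

text \<open>
  The deficit of each vertex is put on a singleton item. With selection probabilities \<open>1 - exp (- \<theta> mu e)\<close>,
  every vertex then avoids all selected items with probability exactly \<open>exp (- \<theta>)\<close>.
\<close>

locale nibble = fractional_matching +
  fixes \<theta> :: real
  assumes theta: "\<theta> > 0" and theta_k: "\<theta> * real k \<le> 1" and kappa_k: "4 * real k * \<kappa> \<le> 1"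
begin

definition pr :: "'a set \<Rightarrow> real" where "pr e = 1 - exp (- \<theta> * mu e)"
abbreviation Ex :: "('a set set \<Rightarrow> real) \<Rightarrow> real" where "Ex \<equiv> subset_expectation I pr"
definition left :: "'a set set \<Rightarrow> 'a set" where "left S = V - \<Union>S"
definition picked :: "'a set set \<Rightarrow> 'a set set" where
  "picked S = {e \<in> S \<inter> E. \<forall>f\<in>S. f \<noteq> e \<longrightarrow> f \<inter> e = {}}"
definition rest :: "'a set set \<Rightarrow> 'a set set" where "rest S = {e \<in> E. e \<subseteq> left S}"
text \<open>An edge at a surviving vertex has \<open>k - 1\<close> further vertices, each surviving
  with probability \<open>exp (- \<theta>)\<close>; the factor restores the expected load under near
  independence.\<close>

definition w' :: "'a set \<Rightarrow> real" where "w' e = exp (\<theta> * (real k - 1)) * w e"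
definition load' :: "'a set set \<Rightarrow> 'a \<Rightarrow> real" where
  "load' S v = (\<Sum>e | e \<in> E \<and> v \<in> e. w' e * of_bool (e \<subseteq> left S))"

lemma pr01: "e \<in> I \<Longrightarrow> 0 \<le> pr e \<and> pr e \<le> 1"
  unfolding pr_def using mu0[of e] theta by auto

lemma pr_le: "e \<in> I \<Longrightarrow> pr e \<le> \<theta> * mu e"
  unfolding pr_def using exp_ge_add_one_self[of "- \<theta> * mu e"] by simp

text \<open>\<open>U\<close> survives when no item of \<open>hit U\<close> is selected, and the
  non-selection probabilities are exponentials, so their product is a single exponential.\<close>

lemma Ex_survive:
  assumes "U \<subseteq> V" shows "Ex (\<lambda>S. of_bool (U \<subseteq> left S)) = exp (- \<theta> * sum mu (hit U))"
proof -
  have "Ex (\<lambda>S. of_bool (U \<subseteq> left S)) = Ex (\<lambda>S. of_bool (S \<inter> hit U = {}))"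
    unfolding subset_expectation_def
  proof (intro sum.cong refl arg_cong2[where f = "(*)"])
    fix S assume "S \<in> Pow I"
    then show "(of_bool (U \<subseteq> left S) :: real) = of_bool (S \<inter> hit U = {})"
      using assms unfolding left_def hit_def by (intro arg_cong[where f = of_bool]) blast
  qed
  also have "\<dots> = (\<Prod>e\<in>hit U. exp (- \<theta> * mu e))"
    by (subst subset_expectation_avoid) (auto simp: finI pr_def hit_def)
  also have "\<dots> = exp (- \<theta> * sum mu (hit U))"
    using finI by (simp add: exp_sum sum_distrib_left hit_def flip: sum_negf)
  finally show ?thesis .
qed

lemma Ex_survive_ge:
  assumes "U \<subseteq> V" shows "Ex (\<lambda>S. of_bool (U \<subseteq> left S)) \<ge> exp (- \<theta> * card U)"
  unfolding Ex_survive[OF assms] using mu_hit_upper[OF assms] theta by simp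

lemma Ex_survive_le:
  assumes "U \<subseteq> V" shows "Ex (\<lambda>S. of_bool (U \<subseteq> left S)) \<le> exp (- \<theta> * card U + \<theta> * (card U)\<^sup>2 * \<kappa>)"
proof -
  have "\<theta> * (card U - (card U)\<^sup>2 * \<kappa>) \<le> \<theta> * sum mu (hit U)"
    using mu_hit_lower[OF assms] theta by (intro mult_left_mono) auto
  then show ?thesis unfolding Ex_survive[OF assms] by (simp add: right_diff_distrib mult.assoc)
qed

lemma Ex_survive_single: "v \<in> V \<Longrightarrow> Ex (\<lambda>S. of_bool (v \<in> left S)) = exp (- \<theta>)"
proof -
  assume v: "v \<in> V"
  have "hit {v} = {e. e \<in> I \<and> v \<in> e}" unfolding hit_def by auto
  then show ?thesis using Ex_survive[of "{v}"] sum_mu_at[OF v] v by simp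
qed

lemma Ex_mono: "(\<And>S. S \<subseteq> I \<Longrightarrow> f S \<le> g S) \<Longrightarrow> Ex f \<le> Ex g"
  using subset_expectation_mono[OF finI pr01] .

lemma Ex_attained: "\<exists>S \<subseteq> I. F S \<le> Ex F"
  by (rule subset_expectation_attained[OF finI pr01])

lemma left_sub: "left S \<subseteq> V" unfolding left_def by auto

lemma Ex_card_left: "Ex (\<lambda>S. real (card (left S))) = exp (- \<theta>) * card V"
proof -
  have "real (card (left S)) = (\<Sum>v\<in>V. of_bool (v \<in> left S))" for S
    using card_Int_sum[OF finV, of "left S"] left_sub[of S] by (simp add: Int_absorb2)
  then have "Ex (\<lambda>S. real (card (left S))) = (\<Sum>v\<in>V. Ex (\<lambda>S. of_bool (v \<in> left S)))"
    by (simp add: subset_expectation_sum)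
  also have "\<dots> = (\<Sum>v\<in>V. exp (- \<theta>))" using Ex_survive_single by (intro sum.cong) auto
  finally show ?thesis by simp
qed

lemma exp_split: "exp (\<theta> * (real k - 1)) * exp (- \<theta> * real k) = exp (- \<theta>)"
  by (simp add: algebra_simps flip: exp_add)

lemma Ex_edge: "e \<in> E \<Longrightarrow> exp (\<theta> * (real k - 1)) * Ex (\<lambda>S. of_bool (e \<subseteq> left S)) \<ge> exp (- \<theta>)"
  using Ex_survive_ge[of e] edge[of e] mult_left_mono[of "exp (- \<theta> * real k)" _ "exp (\<theta> * (real k - 1))"]
  unfolding exp_split by auto

text \<open>Overlaps among the items only help: an edge survives with probability at least
  \<open>exp (- \<theta> k)\<close>, so its rescaled expected weight is at least
  \<open>exp (- \<theta>) * w e\<close>, while the number of vertices shrinks in expectation by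
  exactly \<open>exp (- \<theta>)\<close>.\<close>

lemma Ex_rest_weight:
  "Ex (\<lambda>S. card (left S) - real k * sum w' (rest S)) \<le> exp (- \<theta>) * deficit"
proof -
  have "sum w' (rest S) = (\<Sum>e\<in>E. w' e * of_bool (e \<subseteq> left S))" for S
    unfolding rest_def using finE by (simp add: of_bool_def sum.inter_filter if_distrib[of "\<lambda>x. _ * x"] cong: if_cong)
  then have "Ex (\<lambda>S. sum w' (rest S)) = (\<Sum>e\<in>E. w' e * Ex (\<lambda>S. of_bool (e \<subseteq> left S)))"
    by (simp add: subset_expectation_sum subset_expectation_cmult)
  also have "\<dots> \<ge> (\<Sum>e\<in>E. w e * exp (- \<theta>))"
  proof (rule sum_mono)
    fix e assume e: "e \<in> E"
    show "w e * exp (- \<theta>) \<le> w' e * Ex (\<lambda>S. of_bool (e \<subseteq> left S))"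
      using mult_left_mono[OF Ex_edge[OF e] w0[OF e]] unfolding w'_def by (simp add: mult_ac)
  qed
  finally have "exp (- \<theta>) * sum w E \<le> Ex (\<lambda>S. sum w' (rest S))" 
    unfolding sum_distrib_right[symmetric] by (simp add: mult.commute)
  then have "real k * (exp (- \<theta>) * sum w E) \<le> real k * Ex (\<lambda>S. sum w' (rest S))" by (intro mult_left_mono) auto
  then show ?thesis unfolding subset_expectation_diff subset_expectation_cmult Ex_card_left deficit_def by (simp add: algebra_simps)
qed

lemma load'_eq: "load' S v = (\<Sum>e | e \<in> rest S \<and> v \<in> e. w' e)"
proof -
  have "load' S v = (\<Sum>e\<in>{e. e \<in> E \<and> v \<in> e}. if e \<subseteq> left S then w' e else 0)"
    unfolding load'_def by (intro sum.cong) auto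
  also have "\<dots> = (\<Sum>e\<in>{e \<in> {e. e \<in> E \<and> v \<in> e}. e \<subseteq> left S}. w' e)"
    using finE by (subst sum.inter_filter) auto
  also have "{e \<in> {e. e \<in> E \<and> v \<in> e}. e \<subseteq> left S} = {e. e \<in> rest S \<and> v \<in> e}" unfolding rest_def by auto
  finally show ?thesis .
qed

lemma Ex_load'_ge: "v \<in> V \<Longrightarrow> Ex (\<lambda>S. load' S v) \<ge> exp (- \<theta>) * load v"
proof -
  have "exp (- \<theta>) * load v = (\<Sum>e | e \<in> E \<and> v \<in> e. w e * exp (- \<theta>))"
    unfolding load_def by (simp add: sum_distrib_left mult.commute)
  also have "\<dots> \<le> (\<Sum>e | e \<in> E \<and> v \<in> e. w' e * Ex (\<lambda>S. of_bool (e \<subseteq> left S)))"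
  proof (rule sum_mono)
    fix e assume "e \<in> {e. e \<in> E \<and> v \<in> e}"
    then have e: "e \<in> E" by simp
    show "w e * exp (- \<theta>) \<le> w' e * Ex (\<lambda>S. of_bool (e \<subseteq> left S))"
      using mult_left_mono[OF Ex_edge[OF e] w0[OF e]] unfolding w'_def by (simp add: mult_ac)
  qed
  also have "\<dots> = Ex (\<lambda>S. load' S v)" unfolding load'_def subset_expectation_sum subset_expectation_cmult ..
  finally show ?thesis .
qed

lemma exp_theta_k: "exp (\<theta> * (real k - 1)) * exp (\<theta> * (real k - 1)) \<le> 9"
proof -
  have "\<theta> * (real k - 1) \<le> 1" using theta theta_k by (simp add: right_diff_distrib)
  then have "exp (\<theta> * (real k - 1)) \<le> 3" using exp_le by (meson exp_le_cancel_iff order_trans)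
  then have "exp (\<theta> * (real k - 1)) * exp (\<theta> * (real k - 1)) \<le> 3 * 3" by (intro mult_mono) auto
  then show ?thesis by simp
qed

text \<open>Edges that meet only in \<open>v\<close> span \<open>2 k - 1\<close> vertices, and the
  two rescalings cancel all survival factors except that of \<open>v\<close>; dependence costs
  \<open>exp (4 k \<kappa>)\<close> because \<open>\<theta> k\<close> is at most 1. If they share
  another vertex, survival is bounded by 1 and the squared rescaling by 9.\<close>

lemma Ex_two_edges:
  assumes e: "e \<in> E" "v \<in> e" and f: "f \<in> E" "v \<in> f"
  shows "exp (\<theta> * (real k - 1)) * exp (\<theta> * (real k - 1)) * Ex (\<lambda>S. of_bool (e \<union> f \<subseteq> left S))
    \<le> exp (- \<theta>) * exp (4 * real k * \<kappa>) + 9 * of_bool (\<exists>u\<in>e - {v}. u \<in> f)"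
proof (cases "\<exists>u\<in>e - {v}. u \<in> f")
  case True
  have "Ex (\<lambda>S. of_bool (e \<union> f \<subseteq> left S)) \<le> Ex (\<lambda>S. 1)" by (rule Ex_mono) auto
  then have "exp (\<theta> * (real k - 1)) * exp (\<theta> * (real k - 1)) * Ex (\<lambda>S. of_bool (e \<union> f \<subseteq> left S)) \<le> 9 * 1"
    using exp_theta_k Ex_survive[of "e \<union> f"] edge e f
    by (intro mult_mono) (auto simp: subset_expectation_one[OF finI])
  then show ?thesis using True by (simp add: add_increasing)
next
  case False
  then have int: "e \<inter> f = {v}" using e f by auto
  have fin: "finite e" "finite f" using edge e f finV finite_subset by blast+
  have "card (e \<union> f) + 1 = 2 * k" using card_Un_Int[OF fin] int edge[OF e(1)] edge[OF f(1)] by simp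
  then have c: "real (card (e \<union> f)) = 2 * real k - 1" by linarith
  have "Ex (\<lambda>S. of_bool (e \<union> f \<subseteq> left S)) \<le> exp (- \<theta> * (2 * real k - 1) + \<theta> * (2 * real k - 1)\<^sup>2 * \<kappa>)"
    using Ex_survive_le[of "e \<union> f"] edge e f unfolding of_nat_power c by auto
  also have "\<dots> \<le> exp (- \<theta> * (2 * real k - 1) + 4 * real k * \<kappa>)"
  proof -
    have "\<theta> * (2 * real k - 1)\<^sup>2 * \<kappa> \<le> \<theta> * (2 * real k)\<^sup>2 * \<kappa>"
      using theta kappa0 k2 by (intro mult_right_mono mult_left_mono power_mono) auto
    also have "\<dots> = 4 * real k * \<kappa> * (\<theta> * real k)" by (simp add: power2_eq_square)
    also have "\<dots> \<le> 4 * real k * \<kappa> * 1" using theta_k kappa0 by (intro mult_left_mono) auto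
    finally show ?thesis by simp
  qed
  finally have "exp (\<theta> * (real k - 1)) * exp (\<theta> * (real k - 1)) * Ex (\<lambda>S. of_bool (e \<union> f \<subseteq> left S))
      \<le> exp (\<theta> * (real k - 1)) * exp (\<theta> * (real k - 1)) * exp (- \<theta> * (2 * real k - 1) + 4 * real k * \<kappa>)"
    by (intro mult_left_mono) auto
  also have "\<dots> = exp (- \<theta>) * exp (4 * real k * \<kappa>)"
    by (simp add: algebra_simps flip: exp_add)
  finally show ?thesis using False by simp
qed

text \<open>A union bound over the at most \<open>k\<close> other vertices of \<open>e\<close>, each
  forming with \<open>v\<close> a pair of weight at most \<open>\<kappa>\<close>. It makes the crude
  case of \<open>Ex_two_edges\<close> affordable.\<close>

lemma sum_intersecting_le:
  assumes e: "e \<in> E" "v \<in> e"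
  shows "(\<Sum>f | f \<in> E \<and> v \<in> f. w f * of_bool (\<exists>u\<in>e - {v}. u \<in> f)) \<le> real k * \<kappa>"
proof -
  have fin: "finite e" using edge e finV finite_subset by blast
  have "(\<Sum>f | f \<in> E \<and> v \<in> f. w f * of_bool (\<exists>u\<in>e - {v}. u \<in> f))
      \<le> (\<Sum>f | f \<in> E \<and> v \<in> f. w f * (\<Sum>u\<in>e - {v}. of_bool (u \<in> f)))"
  proof (intro sum_mono mult_left_mono)
    fix f
    show "(of_bool (\<exists>u\<in>e - {v}. u \<in> f) :: real) \<le> (\<Sum>u\<in>e - {v}. of_bool (u \<in> f))"
    proof (cases "\<exists>u\<in>e - {v}. u \<in> f")
      case True
      then obtain u where u: "u \<in> e - {v}" "u \<in> f" by auto
      have "(of_bool (u \<in> f) :: real) \<le> (\<Sum>u\<in>e - {v}. of_bool (u \<in> f))"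
        using fin u by (intro member_le_sum) auto
      then show ?thesis using True u by simp
    qed (simp add: sum_nonneg)
  qed (use w0 in auto)
  also have "\<dots> = (\<Sum>u\<in>e - {v}. \<Sum>f | f \<in> E \<and> v \<in> f. w f * of_bool (u \<in> f))"
    by (simp add: sum_distrib_left) (rule sum.swap)
  also have "\<dots> \<le> (\<Sum>u\<in>e - {v}. \<kappa>)"
  proof (rule sum_mono)
    fix u assume u: "u \<in> e - {v}"
    have "(\<Sum>f | f \<in> E \<and> v \<in> f. w f * of_bool (u \<in> f)) = (\<Sum>f\<in>{f. f \<in> E \<and> v \<in> f}. if u \<in> f then w f else 0)"
      by (intro sum.cong) auto
    also have "\<dots> = (\<Sum>f\<in>{f \<in> {f. f \<in> E \<and> v \<in> f}. u \<in> f}. w f)" using finE by (subst sum.inter_filter) auto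
    also have "{f \<in> {f. f \<in> E \<and> v \<in> f}. u \<in> f} = {f. f \<in> E \<and> u \<in> f \<and> v \<in> f}" by auto
    also have "(\<Sum>f | f \<in> E \<and> u \<in> f \<and> v \<in> f. w f) \<le> \<kappa>" using pair[of u v] u e edge by auto
    finally show "(\<Sum>f | f \<in> E \<and> v \<in> f. w f * of_bool (u \<in> f)) \<le> \<kappa>" .
  qed
  also have "\<dots> \<le> real k * \<kappa>"
    using card_Diff_subset[of "{v}" e] edge[OF e(1)] e kappa0 fin by (auto intro!: mult_right_mono)
  finally show ?thesis .
qed

lemma Ex_load'_sqr:
  assumes v: "v \<in> V"
  shows "Ex (\<lambda>S. (load' S v)\<^sup>2) \<le> exp (- \<theta>) * exp (4 * real k * \<kappa>) * (load v)\<^sup>2 + 9 * (real k * \<kappa>)"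
proof -
  let ?E = "{e. e \<in> E \<and> v \<in> e}" and ?c = "exp (\<theta> * (real k - 1))"
  have "(load' S v)\<^sup>2 = (\<Sum>e\<in>?E. \<Sum>f\<in>?E. w e * w f * (?c * ?c) * of_bool (e \<union> f \<subseteq> left S))" for S
    unfolding load'_def power2_eq_square sum_product w'_def by (intro sum.cong refl) auto
  then have "Ex (\<lambda>S. (load' S v)\<^sup>2) = (\<Sum>e\<in>?E. \<Sum>f\<in>?E. w e * w f * (?c * ?c) * Ex (\<lambda>S. of_bool (e \<union> f \<subseteq> left S)))"
    by (simp only: subset_expectation_sum subset_expectation_cmult)
  also have "\<dots> \<le> (\<Sum>e\<in>?E. \<Sum>f\<in>?E. w e * w f * (exp (- \<theta>) * exp (4 * real k * \<kappa>) + 9 * of_bool (\<exists>u\<in>e - {v}. u \<in> f)))"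
  proof (intro sum_mono)
    fix e f assume a: "e \<in> ?E" "f \<in> ?E"
    then have "w e * w f * (?c * ?c * Ex (\<lambda>S. of_bool (e \<union> f \<subseteq> left S)))
        \<le> w e * w f * (exp (- \<theta>) * exp (4 * real k * \<kappa>) + 9 * of_bool (\<exists>u\<in>e - {v}. u \<in> f))"
      using w0 by (intro mult_left_mono Ex_two_edges) auto
    then show "w e * w f * (?c * ?c) * Ex (\<lambda>S. of_bool (e \<union> f \<subseteq> left S))
        \<le> w e * w f * (exp (- \<theta>) * exp (4 * real k * \<kappa>) + 9 * of_bool (\<exists>u\<in>e - {v}. u \<in> f))"
      by (simp only: mult.assoc)
  qed
  also have "\<dots> = exp (- \<theta>) * exp (4 * real k * \<kappa>) * (load v)\<^sup>2
      + 9 * (\<Sum>e\<in>?E. w e * (\<Sum>f\<in>?E. w f * of_bool (\<exists>u\<in>e - {v}. u \<in> f)))"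
  proof -
    define X where "X = exp (- \<theta>) * exp (4 * real k * \<kappa>)"
    have "(\<Sum>f\<in>?E. w e * w f * (X + 9 * of_bool (\<exists>u\<in>e - {v}. u \<in> f)))
        = X * (w e * load v) + 9 * (w e * (\<Sum>f\<in>?E. w f * of_bool (\<exists>u\<in>e - {v}. u \<in> f)))" for e
      unfolding load_def by (simp add: distrib_left sum.distrib sum_distrib_left mult_ac)
    moreover have "(\<Sum>e\<in>?E. w e * load v) = (load v)\<^sup>2"
      unfolding load_def power2_eq_square by (simp add: sum_distrib_right)
    ultimately show ?thesis unfolding X_def by (simp add: sum.distrib flip: sum_distrib_left)
  qed
  also have "(\<Sum>e\<in>?E. w e * (\<Sum>f\<in>?E. w f * of_bool (\<exists>u\<in>e - {v}. u \<in> f))) \<le> (\<Sum>e\<in>?E. w e * (real k * \<kappa>))"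
    using w0 by (intro sum_mono mult_left_mono sum_intersecting_le) auto
  also have "\<dots> = load v * (real k * \<kappa>)" unfolding load_def by (simp add: sum_distrib_right)
  also have "\<dots> \<le> 1 * (real k * \<kappa>)" using load1[OF v] kappa0 by (intro mult_right_mono) (auto simp: load_def)
  finally show ?thesis by simp
qed

text \<open>As \<open>load v\<close> is at most 1, the overload of a survivor is at most its
  deviation from \<open>load v\<close>. The lower bound for the first moment and the upper bound for
  the second cancel in the mean square of that deviation, up to a multiple of
  \<open>k * \<kappa>\<close>.\<close>

lemma Ex_overload:
  assumes v: "v \<in> V"
  shows "Ex (\<lambda>S. of_bool (v \<in> left S) * max 0 (load' S v - 1)) \<le> 5 * sqrt (real k * \<kappa>)"
proof -
  define g where "g S = of_bool (v \<in> left S) * \<bar>load' S v - load v\<bar>" for S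
  have dead: "load' S v = 0" if "v \<notin> left S" for S
    unfolding load'_def using that by (intro sum.neutral) auto
  have gsq: "(g S)\<^sup>2 = ((load' S v)\<^sup>2 - (2 * load v) * load' S v) + (load v)\<^sup>2 * of_bool (v \<in> left S)" for S
    unfolding g_def using dead[of S] by (cases "v \<in> left S") (auto simp: power2_eq_square algebra_simps)
  have "(Ex g)\<^sup>2 \<le> Ex (\<lambda>S. (g S)\<^sup>2)" by (rule subset_expectation_sqr_le[OF finI pr01])
  also have "\<dots> = Ex (\<lambda>S. (load' S v)\<^sup>2) - 2 * load v * Ex (\<lambda>S. load' S v) + (load v)\<^sup>2 * exp (- \<theta>)"
    unfolding gsq subset_expectation_add subset_expectation_diff subset_expectation_cmult Ex_survive_single[OF v] ..
  also have "\<dots> \<le> exp (- \<theta>) * exp (4 * real k * \<kappa>) * (load v)\<^sup>2 + 9 * (real k * \<kappa>)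
      - 2 * load v * (exp (- \<theta>) * load v) + (load v)\<^sup>2 * exp (- \<theta>)"
    using Ex_load'_sqr[OF v] mult_left_mono[OF Ex_load'_ge[OF v], of "2 * load v"] load0[of v] by linarith
  also have "\<dots> = (exp (- \<theta>) * (load v)\<^sup>2) * (exp (4 * real k * \<kappa>) - 1) + 9 * (real k * \<kappa>)"
    by (simp add: power2_eq_square algebra_simps)
  also have "\<dots> \<le> 1 * (8 * (real k * \<kappa>)) + 9 * (real k * \<kappa>)"
  proof (intro add_mono mult_mono order_refl)
    have "exp (- \<theta>) * (load v)\<^sup>2 \<le> 1 * 1"
      using theta load0[of v] load1[OF v] by (intro mult_mono) (auto simp: load_def power_le_one)
    then show "exp (- \<theta>) * (load v)\<^sup>2 \<le> 1" by simp
    define x where "x = 4 * real k * \<kappa>"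
    have x: "0 \<le> x" "x \<le> 1" unfolding x_def using kappa0 kappa_k by auto
    have "exp x \<le> 1 + x + x\<^sup>2" using exp_bound x by simp
    also have "x\<^sup>2 \<le> x" using x by (simp add: power2_eq_square mult_left_le)
    finally have "exp x - 1 \<le> 2 * x" by linarith
    moreover have "2 * x = 8 * (real k * \<kappa>)" unfolding x_def by simp
    ultimately show "exp (4 * real k * \<kappa>) - 1 \<le> 8 * (real k * \<kappa>)" unfolding x_def by linarith
    show "0 \<le> exp (4 * real k * \<kappa>) - 1" using x unfolding x_def by simp
  qed (use kappa0 in auto)
  \<comment> \<open>The two errors add up to 17, which is rounded up to the square 25.\<close>
  also have "\<dots> \<le> (5 * sqrt (real k * \<kappa>))\<^sup>2" using kappa0 by (simp add: power_mult_distrib)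
  finally have "Ex g \<le> 5 * sqrt (real k * \<kappa>)" by (rule power2_le_imp_le) (simp add: kappa0)
  moreover have "Ex (\<lambda>S. of_bool (v \<in> left S) * max 0 (load' S v - 1)) \<le> Ex g"
    using load1[OF v] unfolding g_def by (intro Ex_mono mult_left_mono) (auto simp: load_def)
  ultimately show ?thesis by linarith
qed

section \<open>Loss and progress in one round\<close>

definition waste :: "'a set set \<Rightarrow> 'a set" where "waste S = V - left S - \<Union>(picked S)"

text \<open>A touched vertex is wasted either by its own singleton or inside a selected edge that
  meets another selected item; such a conflict wastes at most the \<open>k\<close> vertices of the
  edge.\<close>

lemma card_waste_le:
  assumes S: "S \<subseteq> I"
  shows "real (card (waste S)) \<le> (\<Sum>v\<in>V. of_bool ({{v}} \<subseteq> S))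
    + real k * (\<Sum>e\<in>E. \<Sum>f\<in>hit e - {e}. of_bool ({e, f} \<subseteq> S))"
proof -
  have finS: "finite (hit e - {e})" for e unfolding hit_def using finI by simp
  have pt: "of_bool (v \<in> waste S) \<le> of_bool ({{v}} \<subseteq> S)
      + (\<Sum>e\<in>E. of_bool (v \<in> e) * (\<Sum>f\<in>hit e - {e}. of_bool ({e, f} \<subseteq> S) :: real))" (is "_ \<le> _ + ?R")
    if v: "v \<in> V" for v
  proof (cases "v \<in> waste S \<and> {v} \<notin> S")
    case True
    then obtain e where e: "e \<in> S" "v \<in> e" "e \<notin> picked S" using v unfolding waste_def left_def by auto
    then have eE: "e \<in> E" using True S unfolding I_def by auto
    then obtain f where f: "f \<in> S" "f \<noteq> e" "f \<inter> e \<noteq> {}" using e unfolding picked_def by auto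
    then have fh: "f \<in> hit e - {e}" using S unfolding hit_def by auto
    have "1 \<le> (\<Sum>f\<in>hit e - {e}. of_bool ({e, f} \<subseteq> S) :: real)"
      using member_le_sum[OF fh, of "\<lambda>f. of_bool ({e, f} \<subseteq> S) :: real"] finS e f by auto
    also have "\<dots> \<le> ?R"
      using member_le_sum[OF eE, of "\<lambda>e. of_bool (v \<in> e) * (\<Sum>f\<in>hit e - {e}. of_bool ({e, f} \<subseteq> S) :: real)"] finE e
      by (auto simp: sum_nonneg)
    finally show ?thesis by (simp add: add_increasing)
  next
    case False
    have "?R \<ge> 0" by (intro sum_nonneg mult_nonneg_nonneg) auto
    then show ?thesis using False by auto
  qed
  have "real (card (waste S)) = (\<Sum>v\<in>V. of_bool (v \<in> waste S))"
    using card_Int_sum[OF finV, of "waste S"] by (simp add: waste_def Int_absorb2 Diff_subset subset_iff)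
  also have "\<dots> \<le> (\<Sum>v\<in>V. of_bool ({{v}} \<subseteq> S)
      + (\<Sum>e\<in>E. of_bool (v \<in> e) * (\<Sum>f\<in>hit e - {e}. of_bool ({e, f} \<subseteq> S))))"
    using pt by (rule sum_mono)
  also have "\<dots> = (\<Sum>v\<in>V. of_bool ({{v}} \<subseteq> S))
      + (\<Sum>e\<in>E. (\<Sum>v\<in>V. of_bool (v \<in> e)) * (\<Sum>f\<in>hit e - {e}. of_bool ({e, f} \<subseteq> S)))"
    unfolding sum.distrib sum_distrib_right by (subst sum.swap) simp
  also have "(\<Sum>e\<in>E. (\<Sum>v\<in>V. of_bool (v \<in> e)) * (\<Sum>f\<in>hit e - {e}. of_bool ({e, f} \<subseteq> S) :: real))
      = (\<Sum>e\<in>E. real k * (\<Sum>f\<in>hit e - {e}. of_bool ({e, f} \<subseteq> S)))"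
    using edge by (intro sum.cong refl) (simp add: Int_absorb2 flip: card_Int_sum[OF finV])
  finally show ?thesis by (simp add: sum_distrib_left)
qed

lemma Ex_waste: "Ex (\<lambda>S. real (card (waste S))) \<le> \<theta> * deficit + real k * \<theta>\<^sup>2 * card V"
proof -
  have "Ex (\<lambda>S. real (card (waste S))) \<le> Ex (\<lambda>S. (\<Sum>v\<in>V. of_bool ({{v}} \<subseteq> S))
    + real k * (\<Sum>e\<in>E. \<Sum>f\<in>hit e - {e}. of_bool ({e, f} \<subseteq> S)))"
    by (rule Ex_mono[OF card_waste_le])
  also have "\<dots> = (\<Sum>v\<in>V. Ex (\<lambda>S. of_bool ({{v}} \<subseteq> S)))
      + real k * (\<Sum>e\<in>E. \<Sum>f\<in>hit e - {e}. Ex (\<lambda>S. of_bool ({e, f} \<subseteq> S)))"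
    by (simp only: subset_expectation_add subset_expectation_sum subset_expectation_cmult)
  also have "\<dots> \<le> \<theta> * deficit + real k * (\<theta>\<^sup>2 * card V)"
  proof (intro add_mono mult_left_mono)
    have "(\<Sum>v\<in>V. Ex (\<lambda>S. of_bool ({{v}} \<subseteq> S))) \<le> (\<Sum>v\<in>V. \<theta> * (1 - load v))"
    proof (rule sum_mono)
      fix v assume v: "v \<in> V"
      have "Ex (\<lambda>S. of_bool ({{v}} \<subseteq> S)) = pr {v}" using v by (subst subset_expectation_contain[OF finI]) (auto simp: I_def)
      also have "\<dots> \<le> \<theta> * mu {v}" using v by (intro pr_le) (auto simp: I_def)
      finally show "Ex (\<lambda>S. of_bool ({{v}} \<subseteq> S)) \<le> \<theta> * (1 - load v)" unfolding mu_def using single_notin by simp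
    qed
    then show "(\<Sum>v\<in>V. Ex (\<lambda>S. of_bool ({{v}} \<subseteq> S))) \<le> \<theta> * deficit"
      unfolding deficit_eq by (simp add: sum_distrib_left)
    have "(\<Sum>e\<in>E. \<Sum>f\<in>hit e - {e}. Ex (\<lambda>S. of_bool ({e, f} \<subseteq> S)))
        \<le> (\<Sum>e\<in>E. \<Sum>f\<in>hit e - {e}. (\<theta> * mu e) * (\<theta> * mu f))"
    proof (intro sum_mono)
      fix e f assume e: "e \<in> E" and f: "f \<in> hit e - {e}"
      then have I: "e \<in> I" "f \<in> I" and ne: "e \<noteq> f" unfolding I_def hit_def by auto
      have "Ex (\<lambda>S. of_bool ({e, f} \<subseteq> S)) = pr e * pr f"
        using I ne by (subst subset_expectation_contain[OF finI]) simp_all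
      also have "\<dots> \<le> (\<theta> * mu e) * (\<theta> * mu f)"
        using I pr01 pr_le theta mu0 by (intro mult_mono) auto
      finally show "Ex (\<lambda>S. of_bool ({e, f} \<subseteq> S)) \<le> (\<theta> * mu e) * (\<theta> * mu f)" .
    qed
    \<comment> \<open>The items meeting \<open>e\<close> have total weight at most \<open>k\<close>,
      so conflicts are an effect of second order in \<open>\<theta>\<close>.\<close>
    also have "\<dots> \<le> (\<Sum>e\<in>E. (\<theta> * mu e) * (\<theta> * real k))"
    proof (rule sum_mono)
      fix e assume e: "e \<in> E"
      have "sum mu (hit e - {e}) \<le> sum mu (hit e)"
        using finI mu0 by (intro sum_mono2) (auto simp: hit_def)
      also have "\<dots> \<le> real k" using mu_hit_upper[of e] edge[OF e] by simp
      finally have "(\<theta> * mu e) * (\<theta> * sum mu (hit e - {e})) \<le> (\<theta> * mu e) * (\<theta> * real k)"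
        using theta mu0[of e] e by (intro mult_left_mono) (auto simp: I_def)
      then show "(\<Sum>f\<in>hit e - {e}. (\<theta> * mu e) * (\<theta> * mu f)) \<le> (\<theta> * mu e) * (\<theta> * real k)"
        by (simp add: sum_distrib_left)
    qed
    also have "\<dots> = \<theta>\<^sup>2 * (real k * sum w E)"
      unfolding sum_distrib_left by (intro sum.cong) (auto simp: mu_def power2_eq_square)
    also have "\<dots> \<le> \<theta>\<^sup>2 * card V" using deficit_bounds(1) unfolding deficit_def by (intro mult_left_mono) auto
    finally show "(\<Sum>e\<in>E. \<Sum>f\<in>hit e - {e}. Ex (\<lambda>S. of_bool ({e, f} \<subseteq> S))) \<le> \<theta>\<^sup>2 * card V" .
  qed simp
  finally show ?thesis by simp
qed

text \<open>The functional is the final number of uncovered vertices as the later rounds will bound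
  it: vertices wasted now, \<open>a\<close> times the survivors, and the deficit that remains after
  truncation. Here \<open>a\<close> is the coefficient guaranteed by those later rounds.\<close>

lemma one_round:
  fixes a :: real
  assumes a: "a \<ge> 0"
  shows "\<exists>S. S \<subseteq> I \<and> real (card (waste S)) + a * card (left S)
      + (card (left S) - real k * sum w' (rest S) + real k * (\<Sum>v\<in>left S. max 0 (load' S v - 1)))
    \<le> (a * exp (- \<theta>) + ((real k + 1) * \<theta>\<^sup>2 + 5 * real k * sqrt (real k * \<kappa>))) * card V + deficit"
proof -
  define F where "F S = real (card (waste S)) + a * card (left S)
      + (card (left S) - real k * sum w' (rest S) + real k * (\<Sum>v\<in>V. of_bool (v \<in> left S) * max 0 (load' S v - 1)))" for S
  have "Ex F = Ex (\<lambda>S. real (card (waste S))) + a * Ex (\<lambda>S. card (left S)) + (Ex (\<lambda>S. card (left S) - real k * sum w' (rest S))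
      + real k * (\<Sum>v\<in>V. Ex (\<lambda>S. of_bool (v \<in> left S) * max 0 (load' S v - 1))))"
    unfolding F_def by (simp only: subset_expectation_add subset_expectation_sum subset_expectation_cmult)
  also have "\<dots> \<le> (\<theta> * deficit + real k * \<theta>\<^sup>2 * card V) + a * (exp (- \<theta>) * card V)
      + (exp (- \<theta>) * deficit + real k * (\<Sum>v\<in>V. 5 * sqrt (real k * \<kappa>)))"
    using a by (intro add_mono Ex_waste mult_left_mono Ex_rest_weight sum_mono Ex_overload)
      (auto simp: Ex_card_left)
  also have "\<dots> = (\<theta> + exp (- \<theta>)) * deficit + (real k * \<theta>\<^sup>2 + a * exp (- \<theta>) + 5 * real k * sqrt (real k * \<kappa>)) * card V"
    by (simp add: algebra_simps)
  \<comment> \<open>What is wasted on selected singletons is compensated to first order by the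
    shrinking of the surviving deficit; only a quadratic error is charged to
    \<open>card V\<close>.\<close>
  also have "(\<theta> + exp (- \<theta>)) * deficit \<le> deficit + \<theta>\<^sup>2 * card V"
  proof -
    have "exp (- \<theta>) \<le> 1 / (1 + \<theta>)"
      using exp_ge_add_one_self[of \<theta>] theta by (simp add: exp_minus field_simps)
    also have "\<dots> \<le> 1 - \<theta> + \<theta>\<^sup>2"
    proof -
      have "(1 - \<theta> + \<theta>\<^sup>2) * (1 + \<theta>) = 1 + \<theta> ^ 3" by (simp add: power2_eq_square power3_eq_cube algebra_simps)
      moreover have "\<theta> ^ 3 \<ge> 0" using theta by simp
      ultimately show ?thesis using theta by (subst pos_divide_le_eq) linarith+
    qed
    finally have "(\<theta> + exp (- \<theta>)) * deficit \<le> (1 + \<theta>\<^sup>2) * deficit"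
      using deficit_bounds by (intro mult_right_mono) auto
    also have "\<dots> \<le> deficit + \<theta>\<^sup>2 * card V"
      using mult_left_mono[OF deficit_bounds(2), of "\<theta>\<^sup>2"] by (simp add: algebra_simps)
    finally show ?thesis .
  qed
  finally have "Ex F \<le> (a * exp (- \<theta>) + ((real k + 1) * \<theta>\<^sup>2 + 5 * real k * sqrt (real k * \<kappa>))) * card V + deficit"
    by (simp add: algebra_simps)
  moreover obtain S where "S \<subseteq> I" "F S \<le> Ex F" using Ex_attained by blast
  moreover have "(\<Sum>v\<in>V. of_bool (v \<in> left S) * max 0 (load' S v - 1)) = (\<Sum>v\<in>left S. max 0 (load' S v - 1))"
  proof -
    have "(\<Sum>v\<in>V. of_bool (v \<in> left S) * max 0 (load' S v - 1)) = (\<Sum>v\<in>V. if v \<in> left S then max 0 (load' S v - 1) else 0)"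
      by (intro sum.cong) auto
    also have "\<dots> = (\<Sum>v\<in>V \<inter> left S. max 0 (load' S v - 1))" using finV by (simp add: sum.inter_restrict)
    also have "V \<inter> left S = left S" using left_sub by auto
    finally show ?thesis .
  qed
  ultimately show ?thesis unfolding F_def by (intro exI[of _ S]) auto
qed

section \<open>Truncation of overloaded vertices and iteration\<close>

definition trunc :: "'a set set \<Rightarrow> 'a set \<Rightarrow> real" where
  "trunc S e = w' e / Max ((\<lambda>v. max 1 (load' S v)) ` e)"

lemma w'0: "e \<in> E \<Longrightarrow> w' e \<ge> 0" unfolding w'_def using w0 by simp

lemma trunc_aux:
  assumes e: "e \<in> E"
  shows "v \<in> e \<Longrightarrow> trunc S e \<le> w' e / max 1 (load' S v)" "trunc S e \<ge> 0" "trunc S e \<le> w' e"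
    "w' e - trunc S e \<le> (\<Sum>v\<in>e. w' e * (1 - 1 / max 1 (load' S v)))"
proof -
  let ?l = "\<lambda>v. max 1 (load' S v)"
  have fin: "finite e" and ne: "e \<noteq> {}" using edge[OF e] k2 finV finite_subset by auto
  have "Max (?l ` e) \<in> ?l ` e" using fin ne by simp
  then obtain u where u: "Max (?l ` e) = ?l u" "u \<in> e" by (rule imageE)
  show *: "trunc S e \<le> w' e / max 1 (load' S v)" if "v \<in> e" for v
    unfolding trunc_def using Max_ge[of "?l ` e" "?l v"] fin that w'0[OF e] by (intro divide_left_mono) auto
  show "trunc S e \<ge> 0" unfolding trunc_def u(1) using w'0[OF e] by simp
  have "w' e / ?l u \<le> w' e / 1" using w'0[OF e] by (intro divide_left_mono) auto
  then show "trunc S e \<le> w' e" unfolding trunc_def u(1) by simp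
  have "w' e - trunc S e = w' e * (1 - 1 / ?l u)" unfolding trunc_def u(1) by (simp add: right_diff_distrib)
  also have "\<dots> \<le> (\<Sum>v\<in>e. w' e * (1 - 1 / ?l v))"
    using fin u(2) w'0[OF e] by (intro member_le_sum) auto
  finally show "w' e - trunc S e \<le> (\<Sum>v\<in>e. w' e * (1 - 1 / max 1 (load' S v)))" .
qed

text \<open>Dividing an edge by the largest overload among its vertices serves all of them at once:
  seen from \<open>v\<close>, its weight is at most \<open>w' e / max 1 (load' S v)\<close>. Weights
  never increase under truncation, so the pair bound grows only by the rescaling.\<close>

lemma trunc_fractional_matching:
  "fractional_matching (left S) (rest S) (trunc S) k (exp (\<theta> * (real k - 1)) * \<kappa>)"
proof
  show "finite (left S)" using finV left_sub finite_subset by blast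
  show "0 \<le> exp (\<theta> * (real k - 1)) * \<kappa>" using kappa0 by simp
  show "e \<subseteq> left S \<and> card e = k" "0 \<le> trunc S e" if "e \<in> rest S" for e
    using that edge trunc_aux unfolding rest_def by auto
  show "(\<Sum>e | e \<in> rest S \<and> v \<in> e. trunc S e) \<le> 1" for v
  proof -
    have "(\<Sum>e | e \<in> rest S \<and> v \<in> e. trunc S e) \<le> (\<Sum>e | e \<in> rest S \<and> v \<in> e. w' e / max 1 (load' S v))"
      by (intro sum_mono trunc_aux) (auto simp: rest_def)
    also have "\<dots> = load' S v / max 1 (load' S v)" unfolding load'_eq by (simp add: sum_divide_distrib)
    also have "\<dots> \<le> 1" by (simp add: divide_le_eq)
    finally show ?thesis .
  qed
  show "(\<Sum>e | e \<in> rest S \<and> u \<in> e \<and> v \<in> e. trunc S e) \<le> exp (\<theta> * (real k - 1)) * \<kappa>"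
    if "u \<in> left S" "v \<in> left S" "u \<noteq> v" for u v
  proof -
    have "(\<Sum>e | e \<in> rest S \<and> u \<in> e \<and> v \<in> e. trunc S e) \<le> (\<Sum>e | e \<in> rest S \<and> u \<in> e \<and> v \<in> e. w' e)"
      by (intro sum_mono trunc_aux) (auto simp: rest_def)
    also have "\<dots> \<le> (\<Sum>e | e \<in> E \<and> u \<in> e \<and> v \<in> e. w' e)"
      using finE w'0 by (intro sum_mono2) (auto simp: rest_def)
    also have "\<dots> = exp (\<theta> * (real k - 1)) * (\<Sum>e | e \<in> E \<and> u \<in> e \<and> v \<in> e. w e)"
      unfolding w'_def by (simp add: sum_distrib_left)
    also have "\<dots> \<le> exp (\<theta> * (real k - 1)) * \<kappa>" using pair[of u v] that left_sub by (intro mult_left_mono) auto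
    finally show ?thesis .
  qed
qed (rule k2)

text \<open>The loss of an edge is charged to its vertices; at \<open>v\<close> the charges add up
  to \<open>load' (1 - 1 / max 1 load')\<close>, which is exactly the overload.\<close>

lemma trunc_loss: "sum (trunc S) (rest S) \<ge> sum w' (rest S) - (\<Sum>v\<in>left S. max 0 (load' S v - 1))"
proof -
  let ?l = "\<lambda>v. max 1 (load' S v)"
  have finl: "finite (left S)" using finV left_sub finite_subset by blast
  have finr: "finite (rest S)" using finE unfolding rest_def by simp
  have "sum w' (rest S) - sum (trunc S) (rest S) = (\<Sum>e\<in>rest S. w' e - trunc S e)" by (simp add: sum_subtractf)
  also have "\<dots> \<le> (\<Sum>e\<in>rest S. \<Sum>v\<in>e. w' e * (1 - 1 / ?l v))"
    by (intro sum_mono trunc_aux) (auto simp: rest_def)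
  also have "\<dots> = (\<Sum>e\<in>rest S. \<Sum>v\<in>left S. if v \<in> e then w' e * (1 - 1 / ?l v) else 0)"
  proof (rule sum.cong[OF refl])
    fix e assume "e \<in> rest S"
    then have "left S \<inter> e = e" unfolding rest_def by auto
    then show "(\<Sum>v\<in>e. w' e * (1 - 1 / ?l v)) = (\<Sum>v\<in>left S. if v \<in> e then w' e * (1 - 1 / ?l v) else 0)"
      using sum.inter_restrict[OF finl, of "\<lambda>v. w' e * (1 - 1 / ?l v)" e] by simp
  qed
  also have "\<dots> = (\<Sum>v\<in>left S. \<Sum>e\<in>rest S. if v \<in> e then w' e * (1 - 1 / ?l v) else 0)" by (rule sum.swap)
  also have "\<dots> = (\<Sum>v\<in>left S. load' S v * (1 - 1 / ?l v))"
  proof (rule sum.cong[OF refl])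
    fix v
    have "(\<Sum>e\<in>rest S. if v \<in> e then w' e * (1 - 1 / ?l v) else 0) = (\<Sum>e\<in>{e \<in> rest S. v \<in> e}. w' e * (1 - 1 / ?l v))"
      using finr by (rule sum.inter_filter[symmetric])
    then show "(\<Sum>e\<in>rest S. if v \<in> e then w' e * (1 - 1 / ?l v) else 0) = load' S v * (1 - 1 / ?l v)"
      unfolding load'_eq sum_distrib_right by simp
  qed
  also have "\<dots> = (\<Sum>v\<in>left S. max 0 (load' S v - 1))"
    by (intro sum.cong refl) (auto simp: max_def field_simps)
  finally show ?thesis by linarith
qed

end

text \<open>Pair weights grow by \<open>exp (\<theta> (k - 1))\<close> per round, so the bound is
  discounted by the \<open>r\<close> rounds to come and never exceeds \<open>\<kappa>\<close>.
  \<open>A\<close> collects the losses of all rounds: \<open>AZ\<close> says that the shrinking of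
  the vertex set frees as much of \<open>A * card V\<close> as one round loses, so the errors sum
  geometrically instead of linearly in \<open>r\<close>.\<close>

lemma nibble_matching:
  fixes \<theta> \<kappa> A :: real and k :: nat
  assumes th: "\<theta> > 0" "\<theta> * real k \<le> 1" and kap: "4 * real k * \<kappa> \<le> 1" "\<kappa> \<ge> 0" and A: "A \<ge> 0"
    and AZ: "A * exp (- \<theta>) + ((real k + 1) * \<theta>\<^sup>2 + 5 * real k * sqrt (real k * \<kappa>)) \<le> A"
  shows "fractional_matching V E w k (\<kappa> * exp (- \<theta> * (real k - 1) * real r)) \<Longrightarrow>
    \<exists>M \<subseteq> E. pairwise disjnt M \<and>
      real (card (V - \<Union>M)) \<le> (exp (- \<theta> * real r) + A) * card V + (card V - real k * sum w E)"
proof (induction r arbitrary: V E w)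
  case 0
  then interpret fractional_matching V E w k "\<kappa> * exp (- \<theta> * (real k - 1) * real 0)" .
  have "real (card V) \<le> (1 + A) * card V + (card V - real k * sum w E)"
    using deficit_bounds(1) A unfolding deficit_def by (simp add: algebra_simps add_increasing)
  then show ?case by (intro exI[of _ "{}"]) auto
next
  case (Suc r)
  define K where "K = \<kappa> * exp (- \<theta> * (real k - 1) * real (Suc r))"
  have fm: "fractional_matching V E w k K" using Suc.prems unfolding K_def .
  have K_le: "K \<le> \<kappa> * 1"
    unfolding K_def using kap th fractional_matching.k2[OF fm] by (intro mult_left_mono) auto
  have "4 * real k * K \<le> 4 * real k * \<kappa>" using K_le by (intro mult_left_mono) auto
  then interpret nibble V E w k K \<theta>
    using fm th kap by (intro nibble.intro nibble_axioms.intro) auto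
  define a where "a = exp (- \<theta> * real r) + A"
  obtain S where S: "S \<subseteq> I" "real (card (waste S)) + a * card (left S)
      + (card (left S) - real k * sum w' (rest S) + real k * (\<Sum>v\<in>left S. max 0 (load' S v - 1)))
    \<le> (a * exp (- \<theta>) + ((real k + 1) * \<theta>\<^sup>2 + 5 * real k * sqrt (real k * K))) * card V + deficit"
    using one_round[of a] A unfolding a_def by auto
  have "exp (\<theta> * (real k - 1)) * K = \<kappa> * exp (- \<theta> * (real k - 1) * real r)"
    unfolding K_def by (simp add: algebra_simps flip: exp_add)
  with trunc_fractional_matching[of S] obtain M where M: "M \<subseteq> rest S" "pairwise disjnt M"
    "real (card (left S - \<Union>M)) \<le> a * card (left S) + (card (left S) - real k * sum (trunc S) (rest S))"
    using Suc.IH[of "left S" "rest S" "trunc S"] unfolding a_def by auto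
  define M' where "M' = picked S \<union> M"
  have "M' \<subseteq> E" unfolding M'_def picked_def using M(1) rest_def by auto
  moreover have "pairwise disjnt M'"
  proof -
    have "pairwise disjnt (picked S)" unfolding picked_def pairwise_def disjnt_def by blast
    moreover have "disjnt e f" if "e \<in> picked S" "f \<in> M" for e f
      using that M(1) unfolding picked_def rest_def left_def disjnt_def by blast
    ultimately show ?thesis unfolding M'_def using M(2) by (auto simp: pairwise_def disjnt_sym)
  qed
  moreover have "real (card (V - \<Union>M')) \<le> (exp (- \<theta> * real (Suc r)) + A) * card V + (card V - real k * sum w E)"
  proof -
    have sub: "V - \<Union>M' \<subseteq> waste S \<union> (left S - \<Union>M)" unfolding M'_def waste_def by auto
    have fin: "finite (waste S \<union> (left S - \<Union>M))" using finV left_sub finite_subset[of _ V] unfolding waste_def by auto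
    have "card (V - \<Union>M') \<le> card (waste S) + card (left S - \<Union>M)"
      using card_mono[OF fin sub] card_Un_le[of "waste S" "left S - \<Union>M"] by linarith
    then have "real (card (V - \<Union>M')) \<le> real (card (waste S)) + real (card (left S - \<Union>M))" by linarith
    also have "\<dots> \<le> real (card (waste S)) + a * card (left S) + (card (left S) - real k * sum (trunc S) (rest S))"
      using M(3) by linarith
    also have "\<dots> \<le> real (card (waste S)) + a * card (left S)
      + (card (left S) - real k * sum w' (rest S) + real k * (\<Sum>v\<in>left S. max 0 (load' S v - 1)))"
      using mult_left_mono[OF trunc_loss[of S], of "real k"] by (simp add: algebra_simps)
    also have "\<dots> \<le> (a * exp (- \<theta>) + ((real k + 1) * \<theta>\<^sup>2 + 5 * real k * sqrt (real k * K))) * card V + deficit"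
      by (rule S(2))
    also have "\<dots> \<le> (exp (- \<theta> * real (Suc r)) + A) * card V + deficit"
    proof (intro add_right_mono mult_right_mono)
      have "sqrt (real k * K) \<le> sqrt (real k * \<kappa>)" using K_le by (intro real_sqrt_le_mono mult_left_mono) auto
      then have "5 * real k * sqrt (real k * K) \<le> 5 * real k * sqrt (real k * \<kappa>)" by (intro mult_left_mono) auto
      moreover have "a * exp (- \<theta>) = exp (- \<theta> * real (Suc r)) + A * exp (- \<theta>)"
        unfolding a_def by (simp add: algebra_simps flip: exp_add)
      ultimately show "a * exp (- \<theta>) + ((real k + 1) * \<theta>\<^sup>2 + 5 * real k * sqrt (real k * K)) \<le> exp (- \<theta> * real (Suc r)) + A"
        using AZ by linarith
    qed simp
    finally show ?thesis unfolding deficit_def .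
  qed
  ultimately show ?case by blast
qed

section \<open>Fractional clique packings\<close>

text \<open>
  Multiplicative weights: elements of \<open>KK\<close> are chosen greedily against the dual weights
  \<open>exp (\<eta> load r / b r)\<close>, in steps of size \<open>T / n\<close>. The potential \<open>\<Phi>\<close> then grows by a factor of about
  \<open>exp \<eta>\<close> altogether, which bounds every single load once \<open>\<eta>\<close> is large.
\<close>

lemma packing_duality:
  fixes R :: "'r set" and KK :: "'k set" and inc :: "'k \<Rightarrow> 'r set" and b :: "'r \<Rightarrow> real" and T \<epsilon> :: real
  assumes fin: "finite R" "finite KK" and inc: "\<And>K. K \<in> KK \<Longrightarrow> inc K \<subseteq> R"
    and b: "\<And>r. r \<in> R \<Longrightarrow> b r > 0" and T: "T > 0" and eps: "\<epsilon> > 0"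
    and dual: "\<And>y. (\<And>r. r \<in> R \<Longrightarrow> y r \<ge> 0) \<Longrightarrow> \<exists>K\<in>KK. T * sum y (inc K) \<le> (\<Sum>r\<in>R. b r * y r)"
  shows "\<exists>w. (\<forall>K. w K \<ge> 0) \<and> sum w KK = T \<and> (\<forall>r\<in>R. (\<Sum>K | K \<in> KK \<and> r \<in> inc K. w K) \<le> (1 + \<epsilon>) * b r)"
proof -
  define B where "B = sum b R"
  define L where "L = (\<Sum>r\<in>R. \<bar>ln (B / b r)\<bar>) + 1"
  have L: "ln (B / b r) \<le> L" if "r \<in> R" for r
    using member_le_sum[OF that, of "\<lambda>r. \<bar>ln (B / b r)\<bar>"] fin unfolding L_def by simp
  have L0: "L > 0" unfolding L_def by (intro add_nonneg_pos sum_nonneg) auto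
  \<comment> \<open>So large that the initial potential, compared with any single capacity, costs at
    most \<open>\<epsilon> / 2\<close> in the final load; the other half of
    \<open>\<epsilon>\<close> goes to \<open>\<delta>\<close>, the error of linearising the
    exponential.\<close>
  define \<eta> where "\<eta> = 2 * L / \<epsilon>"
  have eta: "\<eta> > 0" unfolding \<eta>_def using L0 eps by simp
  define \<delta> where "\<delta> = min (\<epsilon> / 2) 1"
  have delta: "0 < \<delta>" "\<delta> \<le> 1" "\<delta> \<le> \<epsilon> / 2" unfolding \<delta>_def using eps by auto
  define bm where "bm = Min (insert 1 (b ` R))"
  have bm: "bm > 0" "\<And>r. r \<in> R \<Longrightarrow> bm \<le> b r" unfolding bm_def using fin b by (auto simp: Min_gr_iff)
  \<comment> \<open>Enough steps that none of them raises an exponent by more than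
    \<open>\<delta>\<close>, where \<open>exp x\<close> is at most
    \<open>1 + (1 + \<delta>) x\<close>.\<close>
  obtain n0 :: nat where n0: "\<eta> * T / (bm * \<delta>) < real n0" using reals_Archimedean2 by blast
  define n where "n = Suc n0"
  define s where "s = T / n"
  have s: "s > 0" unfolding s_def n_def using T by simp
  have small: "\<eta> * s / b r \<le> \<delta>" "0 \<le> \<eta> * s / b r" if "r \<in> R" for r
  proof -
    have "\<eta> * s / b r \<le> \<eta> * s / bm" using bm that eta s by (intro divide_left_mono) (auto intro: mult_pos_pos less_le_trans)
    also have "\<dots> \<le> \<delta>" 
    proof -
      have "\<eta> * T / (bm * \<delta>) < real n" using n0 unfolding n_def by simp
      then have "\<eta> * T < real n * (bm * \<delta>)" using bm delta by (simp add: pos_divide_less_eq)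
      then have "\<eta> * s < \<delta> * bm" unfolding s_def n_def by (simp add: pos_divide_less_eq mult_ac)
      then show ?thesis using bm(1) by (simp add: pos_divide_le_eq)
    qed
    finally show "\<eta> * s / b r \<le> \<delta>" .
    show "0 \<le> \<eta> * s / b r" using eta s b[OF that] by simp
  qed
  define load where "load w r = (\<Sum>K | K \<in> KK \<and> r \<in> inc K. w K)" for w :: "'k \<Rightarrow> real" and r
  define \<Phi> where "\<Phi> w = (\<Sum>r\<in>R. b r * exp (\<eta> * load w r / b r))" for w
  have "\<exists>w. (\<forall>K. w K \<ge> 0) \<and> sum w KK = real j * s \<and> \<Phi> w \<le> B * exp ((1 + \<delta>) * \<eta> * (real j / n))" for j
  proof (induction j)
    case 0
    show ?case by (rule exI[of _ "\<lambda>_. 0"]) (simp add: \<Phi>_def load_def B_def)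
  next
    case (Suc j)
    then obtain w where w: "\<And>K. w K \<ge> 0" "sum w KK = real j * s" "\<Phi> w \<le> B * exp ((1 + \<delta>) * \<eta> * (real j / n))" by blast
    define y where "y r = exp (\<eta> * load w r / b r)" for r
    \<comment> \<open>At these weights the dual objective is the potential itself, so the hypothesis
      supplies an element of cost at most \<open>\<Phi> w / T\<close>.\<close>
    obtain K where K: "K \<in> KK" "T * sum y (inc K) \<le> \<Phi> w"
      using dual[of y] unfolding \<Phi>_def y_def by auto
    define w' where "w' = w(K := w K + s)"
    have load': "load w' r = load w r + (if r \<in> inc K then s else 0)" for r
    proof -
      have "load w' r = (\<Sum>K' | K' \<in> KK \<and> r \<in> inc K'. w K' + (if K' = K then s else 0))"
        unfolding load_def w'_def by (intro sum.cong) auto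
      also have "\<dots> = load w r + (if r \<in> inc K then s else 0)"
        unfolding load_def sum.distrib using fin K by (simp add: sum.delta)
      finally show ?thesis .
    qed
    have "\<Phi> w' \<le> (\<Sum>r\<in>R. b r * y r + (if r \<in> inc K then (1 + \<delta>) * \<eta> * s * y r else 0))"
      unfolding \<Phi>_def
    proof (rule sum_mono)
      fix r assume r: "r \<in> R"
      show "b r * exp (\<eta> * load w' r / b r) \<le> b r * y r + (if r \<in> inc K then (1 + \<delta>) * \<eta> * s * y r else 0)"
      proof (cases "r \<in> inc K")
        case True
        define x where "x = \<eta> * s / b r"
        have x: "0 \<le> x" "x \<le> \<delta>" unfolding x_def using small[OF r] by auto
        have "exp x \<le> 1 + x + x\<^sup>2" using exp_bound x delta by simp
        also have "x\<^sup>2 \<le> \<delta> * x" unfolding power2_eq_square using x by (intro mult_right_mono) auto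
        finally have ex: "exp x \<le> 1 + (1 + \<delta>) * x" by (simp add: algebra_simps)
        have "b r * exp (\<eta> * load w' r / b r) = b r * y r * exp x"
          unfolding load' y_def x_def using True by (simp add: add_divide_distrib distrib_left exp_add)
        also have "\<dots> \<le> b r * y r * (1 + (1 + \<delta>) * x)"
          using ex b[OF r] by (intro mult_left_mono) (auto simp: y_def)
        also have "\<dots> = b r * y r + (1 + \<delta>) * \<eta> * s * y r"
          unfolding x_def using b[OF r] by (simp add: field_simps)
        finally show ?thesis using True by simp
      next
        case False
        then show ?thesis unfolding load' y_def by simp
      qed
    qed
    also have "\<dots> = \<Phi> w + (\<Sum>r\<in>R \<inter> inc K. (1 + \<delta>) * \<eta> * s * y r)"
      unfolding sum.distrib \<Phi>_def y_def using fin by (simp add: sum.inter_restrict)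
    also have "R \<inter> inc K = inc K" using inc[OF K(1)] by auto
    also have "(\<Sum>r\<in>inc K. (1 + \<delta>) * \<eta> * s * y r) = (1 + \<delta>) * \<eta> / n * (T * sum y (inc K))"
      unfolding s_def by (simp add: sum_distrib_left mult.assoc)
    also have "\<Phi> w + \<dots> \<le> \<Phi> w + (1 + \<delta>) * \<eta> / n * \<Phi> w"
      using K delta eta by (intro add_left_mono mult_left_mono) auto
    also have "\<dots> = \<Phi> w * (1 + (1 + \<delta>) * \<eta> / n)" by (simp add: algebra_simps)
    also have "\<dots> \<le> \<Phi> w * exp ((1 + \<delta>) * \<eta> / n)"
    proof (intro mult_left_mono exp_ge_add_one_self)
      show "0 \<le> \<Phi> w" unfolding \<Phi>_def using b by (intro sum_nonneg) (auto simp: less_imp_le)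
    qed
    also have "\<dots> \<le> B * exp ((1 + \<delta>) * \<eta> * (real j / n)) * exp ((1 + \<delta>) * \<eta> / n)"
      using w(3) by (intro mult_right_mono) auto
    also have "\<dots> = B * exp ((1 + \<delta>) * \<eta> * (real (Suc j) / n))"
      by (simp add: mult.assoc add_divide_distrib distrib_left flip: exp_add)
    finally have "\<Phi> w' \<le> B * exp ((1 + \<delta>) * \<eta> * (real (Suc j) / n))" .
    moreover have "w' K' \<ge> 0" for K' unfolding w'_def using w(1) s by (auto simp: add_nonneg_nonneg less_imp_le)
    moreover have "sum w' KK = real (Suc j) * s"
    proof -
      have "sum w' KK = (\<Sum>K'\<in>KK. w K' + (if K' = K then s else 0))" unfolding w'_def by (intro sum.cong) auto
      then show ?thesis unfolding sum.distrib using fin K w(2) by (simp add: algebra_simps)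
    qed
    ultimately show ?case by blast
  qed
  from this[of n] obtain w where w: "\<And>K. w K \<ge> 0" "sum w KK = T" "\<Phi> w \<le> B * exp ((1 + \<delta>) * \<eta>)"
    unfolding s_def n_def by auto
  have "load w r \<le> (1 + \<epsilon>) * b r" if r: "r \<in> R" for r
  proof -
    have Bpos: "B > 0" unfolding B_def using r fin b by (intro sum_pos) auto
    have "b r * exp (\<eta> * load w r / b r) \<le> \<Phi> w" unfolding \<Phi>_def
      using r fin b by (intro member_le_sum) (auto simp: less_imp_le)
    also have "\<dots> \<le> B * exp ((1 + \<delta>) * \<eta>)" by (rule w(3))
    finally have "exp (\<eta> * load w r / b r) \<le> B / b r * exp ((1 + \<delta>) * \<eta>)"
      using b[OF r] by (simp add: field_simps)
    also have "\<dots> = exp (ln (B / b r) + (1 + \<delta>) * \<eta>)" using Bpos b[OF r] by (simp add: exp_add)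
    finally have "\<eta> * load w r / b r \<le> ln (B / b r) + (1 + \<delta>) * \<eta>" by simp
    also have "\<dots> \<le> \<eta> * (\<epsilon> / 2) + \<eta> * (1 + \<epsilon> / 2)"
    proof (rule add_mono)
      have "\<eta> * (\<epsilon> / 2) = L" unfolding \<eta>_def using eps by simp
      then show "ln (B / b r) \<le> \<eta> * (\<epsilon> / 2)" using L[OF r] by simp
      show "(1 + \<delta>) * \<eta> \<le> \<eta> * (1 + \<epsilon> / 2)"
        using delta(3) eta by (subst mult.commute) (intro mult_left_mono, auto)
    qed
    also have "\<dots> = \<eta> * (1 + \<epsilon>)" by (simp add: algebra_simps)
    finally have "\<eta> * (load w r / b r) \<le> \<eta> * (1 + \<epsilon>)" by simp
    then have "load w r / b r \<le> 1 + \<epsilon>" using eta by (rule mult_left_le_imp_le)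
    then show ?thesis using b[OF r] by (simp add: pos_divide_le_eq)
  qed
  then show ?thesis using w unfolding load_def by blast
qed

text \<open>A layer-cake comparison: integrating the two counts over \<open>s\<close> gives the two
  sums. The induction avoids the integral by removing the minimum of \<open>f\<close> together with
  the smallest value of \<open>g\<close> that is at least as large, which keeps the counts at all
  positive levels comparable.\<close>

lemma sum_pos_part_le:
  fixes f :: "'a \<Rightarrow> real" and g :: "'b \<Rightarrow> real"
  assumes "finite A" "finite C"
    and "\<And>s. s > 0 \<Longrightarrow> card {a \<in> A. s \<le> f a} \<le> card {c \<in> C. s \<le> g c}"
  shows "(\<Sum>a\<in>A. max 0 (f a)) \<le> (\<Sum>c\<in>C. max 0 (g c))"
  using assms
proof (induction "card A" arbitrary: A C)
  case 0
  then show ?case by (simp add: sum_nonneg)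
next
  case (Suc n)
  then have "A \<noteq> {}" by auto
  define a where "a = arg_min_on f A"
  have a: "a \<in> A" "\<And>x. x \<in> A \<Longrightarrow> f a \<le> f x"
    using arg_min_if_finite[OF Suc.prems(1) \<open>A \<noteq> {}\<close>, of f] arg_min_least[OF Suc.prems(1) \<open>A \<noteq> {}\<close>, of _ f]
    unfolding a_def by auto
  have n: "n = card (A - {a})" using Suc.hyps(2) a Suc.prems(1) by simp
  have splitA: "(\<Sum>x\<in>A. max 0 (f x)) = max 0 (f a) + (\<Sum>x\<in>A - {a}. max 0 (f x))"
    by (rule sum.remove[OF Suc.prems(1) a(1)])
  show ?case
  proof (cases "f a \<le> 0")
    case True
    have "card {x \<in> A - {a}. s \<le> f x} \<le> card {c \<in> C. s \<le> g c}" if "s > 0" for s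
    proof -
      have "{x \<in> A - {a}. s \<le> f x} = {x \<in> A. s \<le> f x}" using True that by auto
      then show ?thesis using Suc.prems(3)[OF that] by simp
    qed
    then have "(\<Sum>x\<in>A - {a}. max 0 (f x)) \<le> (\<Sum>c\<in>C. max 0 (g c))"
      using Suc.hyps(1)[OF n] Suc.prems by auto
    then show ?thesis using splitA True by simp
  next
    case False
    define C' where "C' = {c \<in> C. f a \<le> g c}"
    have "{x \<in> A. f a \<le> f x} = A" using a by auto
    then have cC': "card A \<le> card C'" using Suc.prems(3)[of "f a"] False unfolding C'_def by simp
    have "card C' > 0" using cC' Suc.hyps(2) by linarith
    then have C': "finite C'" "C' \<noteq> {}" by (auto simp: card_gt_0_iff)
    define c where "c = arg_min_on g C'"
    have c: "c \<in> C'" "\<And>x. x \<in> C' \<Longrightarrow> g c \<le> g x"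
      using arg_min_if_finite[OF C', of g] arg_min_least[OF C', of _ g] unfolding c_def by auto
    have "card {x \<in> A - {a}. s \<le> f x} \<le> card {x \<in> C - {c}. s \<le> g x}" if s: "s > 0" for s
    proof (cases "s \<le> g c")
      case True
      have "card {x \<in> A - {a}. s \<le> f x} \<le> card (A - {a})" using Suc.prems(1) by (intro card_mono) auto
      also have "\<dots> \<le> card (C' - {c})" using cC' a c C' Suc.prems(1) by simp
      also have "\<dots> \<le> card {x \<in> C - {c}. s \<le> g x}"
        using Suc.prems(2) c(2) True unfolding C'_def by (intro card_mono) force+
      finally show ?thesis .
    next
      case False
      have "{x \<in> C - {c}. s \<le> g x} = {x \<in> C. s \<le> g x}" using False by auto
      moreover have "card {x \<in> A - {a}. s \<le> f x} \<le> card {x \<in> A. s \<le> f x}"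
        using Suc.prems(1) by (intro card_mono) auto
      ultimately show ?thesis using Suc.prems(3)[OF s] by simp
    qed
    then have "(\<Sum>x\<in>A - {a}. max 0 (f x)) \<le> (\<Sum>x\<in>C - {c}. max 0 (g x))"
      using Suc.hyps(1)[OF n] Suc.prems by auto
    moreover have "(\<Sum>x\<in>C. max 0 (g x)) = max 0 (g c) + (\<Sum>x\<in>C - {c}. max 0 (g x))"
      using c Suc.prems(2) unfolding C'_def by (intro sum.remove) auto
    moreover have "max 0 (f a) \<le> max 0 (g c)" using c unfolding C'_def by auto
    ultimately show ?thesis using splitA by linarith
  qed
qed

section \<open>Mean square discrepancy and clique counts\<close>

locale pseudorandom_graph =
  fixes V :: "'a set" and N :: "'a \<Rightarrow> 'a set" and d :: nat and lam :: real
  assumes finV: "finite V" and V0: "V \<noteq> {}" and d0: "d > 0" and lam0: "lam \<ge> 0"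
    and N_sub: "v \<in> V \<Longrightarrow> N v \<subseteq> V" and N_irrefl: "v \<notin> N v"
    and N_sym: "u \<in> V \<Longrightarrow> v \<in> V \<Longrightarrow> v \<in> N u \<longleftrightarrow> u \<in> N v"
    and N_card: "v \<in> V \<Longrightarrow> card (N v) = d"
    and discrepancy: "S \<subseteq> V \<Longrightarrow>
      (\<Sum>v\<in>V. (real (card (N v \<inter> S)) - real d / card V * card S)\<^sup>2) \<le> lam\<^sup>2 * card S"
begin

definition p :: real where "p = real d / card V"

lemma n0: "card V > 0" using finV V0 by auto

lemma d_le: "d \<le> card V"
proof -
  obtain v where v: "v \<in> V" using V0 by auto
  then show ?thesis using card_mono[OF finV N_sub[OF v]] N_card[OF v] by simp
qed

lemma p01: "0 < p" "p \<le> 1" unfolding p_def using d0 d_le n0 by auto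

lemma p_n: "p * card V = d" unfolding p_def using n0 by simp

lemma discrepancy_on:
  assumes "S \<subseteq> V" "U \<subseteq> V"
  shows "(\<Sum>v\<in>U. (real (card (N v \<inter> S)) - p * card S)\<^sup>2) \<le> lam\<^sup>2 * card S"
proof -
  have "(\<Sum>v\<in>U. (real (card (N v \<inter> S)) - p * card S)\<^sup>2) \<le> (\<Sum>v\<in>V. (real (card (N v \<inter> S)) - p * card S)\<^sup>2)"
    using assms finV by (intro sum_mono2) auto
  then show ?thesis using discrepancy[OF assms(1)] unfolding p_def by linarith
qed

text \<open>Chebyshev's inequality for the discrepancy; all exceptional sets are bounded this
  way.\<close>

lemma discrepancy_uniform:
  fixes x :: real
  assumes S: "S \<subseteq> V" and U: "U \<subseteq> V" and x: "x \<ge> 0"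
    and far: "\<And>v. v \<in> U \<Longrightarrow> x \<le> \<bar>real (card (N v \<inter> S)) - p * card S\<bar>"
  shows "card U * x\<^sup>2 \<le> lam\<^sup>2 * card S"
proof -
  have "(\<Sum>v\<in>U. x\<^sup>2) \<le> (\<Sum>v\<in>U. (real (card (N v \<inter> S)) - p * card S)\<^sup>2)"
    using far x by (intro sum_mono) (simp add: abs_le_square_iff[symmetric])
  then show ?thesis using discrepancy_on[OF S U] by simp
qed

definition cliques :: "nat \<Rightarrow> 'a set \<Rightarrow> 'a set set" where
  "cliques r S = {K. K \<subseteq> S \<and> card K = r \<and> (\<forall>u\<in>K. \<forall>v\<in>K. u \<noteq> v \<longrightarrow> v \<in> N u)}"

lemma finite_cliques: "S \<subseteq> V \<Longrightarrow> finite (cliques r S)"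
proof -
  assume "S \<subseteq> V"
  then have "cliques r S \<subseteq> Pow V" unfolding cliques_def by auto
  then show ?thesis using finV finite_subset by blast
qed

lemma insert_clique:
  assumes "v \<in> V" "S \<subseteq> V" "K \<in> cliques r (N v \<inter> S)"
  shows "v \<notin> K" "insert v K \<in> cliques (Suc r) (insert v S)"
proof -
  have K: "K \<subseteq> N v \<inter> S" "card K = r" "\<And>u w. u \<in> K \<Longrightarrow> w \<in> K \<Longrightarrow> u \<noteq> w \<Longrightarrow> w \<in> N u"
    using assms(3) unfolding cliques_def by auto
  show vK: "v \<notin> K" using K N_irrefl by auto
  have "finite K" using K finV assms(2) finite_subset[of K V] by auto
  moreover have "v \<in> N u" if "u \<in> K" for u using that K(1) N_sym[of u v] assms(1,2) by blast
  ultimately show "insert v K \<in> cliques (Suc r) (insert v S)"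
    using K vK unfolding cliques_def by auto
qed

lemma card_cliques_at:
  assumes v: "v \<in> S" and S: "S \<subseteq> V"
  shows "card {K \<in> cliques (Suc r) S. v \<in> K} = card (cliques r (N v \<inter> S))"
proof (rule bij_betw_same_card[of "\<lambda>K. K - {v}"], rule bij_betw_byWitness[where f' = "insert v"])
  show "\<forall>K\<in>{K \<in> cliques (Suc r) S. v \<in> K}. insert v (K - {v}) = K" by auto
  show "\<forall>K\<in>cliques r (N v \<inter> S). insert v K - {v} = K" using insert_clique(1)[of v S] v S by auto
  show "(\<lambda>K. K - {v}) ` {K \<in> cliques (Suc r) S. v \<in> K} \<subseteq> cliques r (N v \<inter> S)"
    unfolding cliques_def by (auto simp: card_Diff_singleton)
  show "insert v ` cliques r (N v \<inter> S) \<subseteq> {K \<in> cliques (Suc r) S. v \<in> K}"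
    using insert_clique(2)[of v S] v S by (auto simp: insert_absorb)
qed

lemma sum_card_cliques:
  assumes S: "S \<subseteq> V"
  shows "(\<Sum>v\<in>S. card (cliques r (N v \<inter> S))) = Suc r * card (cliques (Suc r) S)"
proof -
  have fS: "finite S" using S finV finite_subset by auto
  have "(\<Sum>v\<in>S. card (cliques r (N v \<inter> S))) = (\<Sum>v\<in>S. card {K \<in> cliques (Suc r) S. v \<in> K})"
    using card_cliques_at S by simp
  also have "\<dots> = (\<Sum>K\<in>cliques (Suc r) S. card {v \<in> S. v \<in> K})"
    using fS finite_cliques[OF S] by (intro sum_multicount_gen) auto
  also have "\<dots> = (\<Sum>K\<in>cliques (Suc r) S. Suc r)"
  proof (rule sum.cong[OF refl])
    fix K assume "K \<in> cliques (Suc r) S"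
    then have "{v \<in> S. v \<in> K} = K" "card K = Suc r" unfolding cliques_def by auto
    then show "card {v \<in> S. v \<in> K} = Suc r" by simp
  qed
  finally show ?thesis by simp
qed

end

text \<open>The number of edges of a clique on \<open>r + 1\<close> vertices, hence the exponent of
  the density in the expected clique count.\<close>

primrec tri :: "nat \<Rightarrow> nat" where "tri 0 = 0" | "tri (Suc r) = tri r + Suc r"

text \<open>One step of \<open>cliques_lower\<close> keeps half of the vertices, a quarter of the
  expected neighbourhood to the power \<open>r + 1\<close>, and counts every clique
  \<open>r + 2\<close> times.\<close>

primrec lower_const :: "nat \<Rightarrow> real" where
  "lower_const 0 = 1"
| "lower_const (Suc r) = lower_const r / (2 * 4 ^ Suc r * real (r + 2))"

primrec upper_const :: "nat \<Rightarrow> real" where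
  "upper_const 0 = 1"
| "upper_const (Suc r) = 3 * 2 ^ Suc r * upper_const r"

lemma lower_const_pos: "lower_const r > 0" by (induction r) auto
lemma upper_const_pos: "upper_const r > 0" by (induction r) auto

context pseudorandom_graph
begin

lemma card_cliques_1: "S \<subseteq> V \<Longrightarrow> card (cliques 1 S) = card S"
proof -
  assume S: "S \<subseteq> V"
  have "cliques 0 (N v \<inter> S) = {{}}" for v
    using finite_subset[OF _ finV] S unfolding cliques_def by (auto simp: card_eq_0_iff)
  then show ?thesis using sum_card_cliques[OF S, of 0] by simp
qed

text \<open>By discrepancy at least half of \<open>S\<close> have \<open>p s / 4\<close> or more
  neighbours in \<open>S\<close>, and the induction continues there. The quarter makes the
  hypothesis on \<open>lam\<close> pass exactly to \<open>p s / 4\<close> and the smaller exponent: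
  one 4 and one \<open>p\<close> move from one side to the other. The parameter \<open>s\<close>
  stands for \<open>card S\<close> because neighbourhoods are only bounded from below.\<close>

lemma cliques_lower:
  fixes s :: real
  assumes "S \<subseteq> V" "s \<le> card S" "s > 0" "2 * lam * 4 ^ r \<le> 4 * s * p ^ r"
  shows "lower_const r * s ^ Suc r * p ^ tri r \<le> card (cliques (Suc r) S)"
  using assms
proof (induction r arbitrary: S s)
  case 0
  then show ?case using card_cliques_1 by simp
next
  case (Suc r)
  note pp = p01
  have fS: "finite S" using Suc.prems finV finite_subset by auto
  have cond: "2 * lam \<le> s * p"
  proof -
    have "p ^ Suc r \<le> 4 ^ r * p" using pp by (simp add: power_le_one mult_mono one_le_power order.trans[of _ 1])
    then have "2 * lam * 4 ^ Suc r \<le> 4 * s * (4 ^ r * p)"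
      using Suc.prems by (smt (verit) mult_left_mono zero_le_mult_iff)
    then show ?thesis by simp
  qed
  define T where "T = {v \<in> S. card (N v \<inter> S) < p * s / 4}"
  have T: "T \<subseteq> S" unfolding T_def by auto
  have "card T * (3 / 4 * (p * card S))\<^sup>2 \<le> lam\<^sup>2 * card S"
  proof (rule discrepancy_uniform)
    fix v assume "v \<in> T"
    then have "card (N v \<inter> S) < p * s / 4" unfolding T_def by auto
    also have "\<dots> \<le> p * card S / 4" using Suc.prems pp by simp
    finally show "3 / 4 * (p * card S) \<le> \<bar>real (card (N v \<inter> S)) - p * card S\<bar>" by linarith
  qed (use T Suc.prems pp in auto)
  also have "lam\<^sup>2 \<le> (p * card S / 2)\<^sup>2"
  proof (rule power_mono)
    have "s * p \<le> card S * p" using Suc.prems pp by (intro mult_right_mono) auto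
    then show "lam \<le> p * card S / 2" using cond by (simp add: mult.commute)
  qed (rule lam0)
  \<comment> \<open>Thus \<open>T\<close> is at most 4/9 of \<open>S\<close>, and more than half of
    \<open>S\<close> remains.\<close>
  finally have "card T * (9 / 16) * (p * card S)\<^sup>2 \<le> card S / 4 * (p * card S)\<^sup>2"
    by (simp add: power_mult_distrib power_divide algebra_simps mult_right_mono)
  moreover have "(p * card S)\<^sup>2 > 0" using pp Suc.prems by auto
  ultimately have "card T * (9 / 16) \<le> real (card S) / 4" by (simp only: mult_le_cancel_right_pos)
  then have T2: "real (card (S - T)) \<ge> s / 2"
    using card_Diff_subset[OF finite_subset[OF T fS] T] card_mono[OF fS T] Suc.prems(2) by linarith
  define m where "m = lower_const r * (p * s / 4) ^ Suc r * p ^ tri r"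
  have m0: "m \<ge> 0" unfolding m_def using lower_const_pos[of r] pp Suc.prems by simp
  have each: "m \<le> card (cliques (Suc r) (N v \<inter> S))" if v: "v \<in> S - T" for v
    unfolding m_def
  proof (rule Suc.IH)
    show "p * s / 4 \<le> real (card (N v \<inter> S))" using v unfolding T_def by auto
    show "2 * lam * 4 ^ r \<le> 4 * (p * s / 4) * p ^ r" using Suc.prems(4) by (simp add: mult_ac)
  qed (use Suc.prems pp in auto)
  have "s / 2 * m \<le> real (card (S - T)) * m" using T2 m0 by (rule mult_right_mono)
  also have "\<dots> \<le> (\<Sum>v\<in>S - T. real (card (cliques (Suc r) (N v \<inter> S))))"
    using sum_mono[of "S - T" "\<lambda>_. m", OF each] by simp
  also have "\<dots> \<le> (\<Sum>v\<in>S. real (card (cliques (Suc r) (N v \<inter> S))))" using fS by (intro sum_mono2) auto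
  also have "\<dots> = real (Suc (Suc r)) * card (cliques (Suc (Suc r)) S)"
    using sum_card_cliques[OF Suc.prems(1), of "Suc r"] by (metis of_nat_mult of_nat_sum)
  finally have "s / 2 * m / real (r + 2) \<le> card (cliques (Suc (Suc r)) S)" by (subst pos_divide_le_eq) (auto simp: mult_ac)
  moreover have "s / 2 * m / real (r + 2) = lower_const (Suc r) * s ^ Suc (Suc r) * p ^ tri (Suc r)"
    unfolding m_def by (simp add: power_divide power_mult_distrib power_add field_simps)
  ultimately show ?case by simp
qed

text \<open>Some vertices may have far too many neighbours in \<open>S\<close>, so the induction
  hypothesis is used at each \<open>v\<close> with its own bound \<open>p * s + x v\<close>. Small
  deviations only double the main term. Large ones are bounded through their squares, whose sum is
  controlled by discrepancy; this is where the hypothesis on \<open>lam\<close> enters.\<close>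

lemma cliques_upper:
  fixes s :: real
  assumes "S \<subseteq> V" "card S \<le> s" "s > 0" "lam \<le> s * p ^ r"
  shows "card (cliques (Suc r) S) \<le> upper_const r * s ^ Suc r * p ^ tri r"
  using assms
proof (induction r arbitrary: S s)
  case 0
  then show ?case using card_cliques_1 by simp
next
  case (Suc r)
  note pp = p01
  have fS: "finite S" using Suc.prems finV finite_subset by auto
  have ps: "p * s > 0" using pp Suc.prems by simp
  define x where "x v = \<bar>real (card (N v \<inter> S)) - p * card S\<bar>" for v
  have x_le: "x v \<le> s" for v
  proof -
    have "card (N v \<inter> S) \<le> card S" using fS by (intro card_mono) auto
    moreover have "0 \<le> p * card S" "p * card S \<le> 1 * card S"
      using pp mult_right_mono[OF pp(2), of "real (card S)"] by auto
    ultimately show ?thesis unfolding x_def using Suc.prems(2) by linarith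
  qed
  have each: "real (card (cliques (Suc r) (N v \<inter> S)))
      \<le> upper_const r * (2 ^ Suc r * (2 * (p * s) ^ Suc r + (x v)\<^sup>2 * (s ^ r / (p * s)))) * p ^ tri r" for v
  proof -
    have "real (card (cliques (Suc r) (N v \<inter> S))) \<le> upper_const r * (p * s + x v) ^ Suc r * p ^ tri r"
    proof (rule Suc.IH)
      have "p * card S \<le> p * s" using Suc.prems pp by (intro mult_left_mono) auto
      then show "real (card (N v \<inter> S)) \<le> p * s + x v" unfolding x_def by linarith
      show "0 < p * s + x v" using ps unfolding x_def by linarith
      have "lam \<le> p * s * p ^ r" using Suc.prems(4) by (simp add: mult_ac)
      also have "\<dots> \<le> (p * s + x v) * p ^ r" using pp unfolding x_def by (intro mult_right_mono) auto
      finally show "lam \<le> (p * s + x v) * p ^ r" .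
    qed (use Suc.prems in auto)
    also have "(p * s + x v) ^ Suc r \<le> 2 ^ Suc r * (2 * (p * s) ^ Suc r + (x v)\<^sup>2 * (s ^ r / (p * s)))"
    proof (cases "x v \<le> p * s")
      case True
      have "(p * s + x v) ^ Suc r \<le> (2 * (p * s)) ^ Suc r"
      proof (rule power_mono)
        show "0 \<le> p * s + x v" using ps unfolding x_def by linarith
      qed (use True in linarith)
      also have "\<dots> = 2 ^ Suc r * (p * s) ^ Suc r" by (rule power_mult_distrib)
      also have "\<dots> \<le> 2 ^ Suc r * (2 * (p * s) ^ Suc r + (x v)\<^sup>2 * (s ^ r / (p * s)))"
      proof (intro mult_left_mono)
        have "0 \<le> (p * s) ^ Suc r" "0 \<le> (x v)\<^sup>2 * (s ^ r / (p * s))" using ps Suc.prems by auto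
        then show "(p * s) ^ Suc r \<le> 2 * (p * s) ^ Suc r + (x v)\<^sup>2 * (s ^ r / (p * s))" by linarith
      qed simp
      finally show ?thesis .
    next
      case False
      then have xp: "x v > 0" "p * s \<le> x v" using ps by auto
      have "(p * s + x v) ^ Suc r \<le> (2 * x v) ^ Suc r" using False ps by (intro power_mono) auto
      also have "\<dots> = 2 ^ Suc r * (x v * (x v) ^ r)" by (simp add: power_mult_distrib)
      \<comment> \<open>A factor \<open>x v / (p * s)\<close>, at least 1 in this case, is inserted
        and \<open>(x v)^r\<close> is bounded by \<open>s^r\<close>, so that a summable square
        appears.\<close>
      also have "x v * (x v) ^ r \<le> (x v)\<^sup>2 * (s ^ r / (p * s))"
      proof -
        have "x v * (p * s) * (x v) ^ r \<le> (x v * x v) * s ^ r"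
          using xp x_le[of v] ps by (intro mult_mono power_mono) auto
        then show ?thesis using ps by (simp add: pos_le_divide_eq power2_eq_square mult_ac)
      qed
      also have "\<dots> \<le> 2 * (p * s) ^ Suc r + (x v)\<^sup>2 * (s ^ r / (p * s))" using ps by simp
      finally show ?thesis by simp
    qed
    finally show ?thesis using upper_const_pos[of r] pp by simp
  qed
  have "(\<Sum>v\<in>S. (x v)\<^sup>2) \<le> lam\<^sup>2 * card S"
    using discrepancy_on[OF Suc.prems(1) Suc.prems(1)] unfolding x_def by simp
  also have "\<dots> \<le> (s * p ^ Suc r)\<^sup>2 * s"
    using Suc.prems lam0 pp by (intro mult_mono power_mono) auto
  finally have "(\<Sum>v\<in>S. (x v)\<^sup>2) * (s ^ r / (p * s)) \<le> (s * p ^ Suc r)\<^sup>2 * s * (s ^ r / (p * s))"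
    using ps Suc.prems by (intro mult_right_mono) auto
  also have "\<dots> = s * (p * s) ^ Suc r * p ^ r"
    using pp Suc.prems by (simp add: power2_eq_square power_mult_distrib field_simps)
  also have "\<dots> \<le> s * (p * s) ^ Suc r * 1" using pp ps Suc.prems by (intro mult_left_mono power_le_one) auto
  finally have xs: "(\<Sum>v\<in>S. (x v)\<^sup>2) * (s ^ r / (p * s)) \<le> s * (p * s) ^ Suc r" by simp
  have "real (card (cliques (Suc (Suc r)) S)) \<le> real (Suc (Suc r) * card (cliques (Suc (Suc r)) S))"
    by (simp only: of_nat_le_iff) simp
  also have "\<dots> = (\<Sum>v\<in>S. real (card (cliques (Suc r) (N v \<inter> S))))"
    using sum_card_cliques[OF Suc.prems(1), of "Suc r"] by (metis of_nat_sum)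
  also have "\<dots> \<le> (\<Sum>v\<in>S. upper_const r * (2 ^ Suc r * (2 * (p * s) ^ Suc r + (x v)\<^sup>2 * (s ^ r / (p * s)))) * p ^ tri r)"
    by (rule sum_mono) (rule each)
  also have "\<dots> = upper_const r * 2 ^ Suc r * p ^ tri r
      * (card S * (2 * (p * s) ^ Suc r) + (\<Sum>v\<in>S. (x v)\<^sup>2) * (s ^ r / (p * s)))"
  proof -
    define c where "c = s ^ r / (p * s)"
    define D where "D = (p * s) ^ Suc r"
    show ?thesis unfolding c_def[symmetric] D_def[symmetric]
      by (simp add: sum_distrib_left sum_distrib_right sum.distrib distrib_left mult_ac)
  qed
  also have "\<dots> \<le> upper_const r * 2 ^ Suc r * p ^ tri r * (s * (2 * (p * s) ^ Suc r) + s * (p * s) ^ Suc r)"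
    using upper_const_pos[of r] pp xs Suc.prems ps by (intro mult_left_mono add_mono mult_right_mono) auto
  also have "\<dots> = upper_const (Suc r) * s ^ Suc (Suc r) * p ^ tri (Suc r)"
    by (simp add: power_mult_distrib power_add algebra_simps)
  finally show ?case .
qed

end

text \<open>With this value the assumption on \<open>lam\<close> is exactly what \<open>cliques_lower\<close> needs for a set of \<open>nbhd_frac r * d\<close> vertices.\<close>

definition nbhd_frac :: "nat \<Rightarrow> real" where "nbhd_frac r = 1 / (100 * real (r + 2))"

text \<open>Up to powers of \<open>d\<close> and \<open>p\<close>, the bound for the cliques through
  a pair divided by \<open>many\<close>: the pair weight produced by the cap
  \<open>h^2 / many\<close> is \<open>h^2 * spread_const r / (d * p^r)\<close>.\<close>

definition spread_const :: "nat \<Rightarrow> real" where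
  "spread_const r = upper_const (r - 1) / (lower_const r * nbhd_frac r ^ Suc r)"

lemma spread_const_pos: "spread_const r > 0"
  unfolding spread_const_def nbhd_frac_def using upper_const_pos lower_const_pos by simp

text \<open>Here \<open>r\<close> stands for \<open>t - 2\<close>.\<close>

locale dense_pseudorandom_graph = pseudorandom_graph +
  fixes r :: nat
  assumes r1: "r \<ge> 1" and lam_le: "lam \<le> 1 / (50 * real (r + 2) * 4 ^ r) * (d * p ^ r)"
begin

abbreviation "\<alpha> \<equiv> nbhd_frac r"

lemma alpha: "0 < \<alpha>" "\<alpha> \<le> 1 / 4" unfolding nbhd_frac_def by (auto simp: field_simps)

lemma coeff_le: "1 / (50 * real (r + 2) * 4 ^ r) \<le> 1 / (50 * real (r + 2))"
  "1 / (50 * real (r + 2) * 4 ^ r) \<le> 1 / 2"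
proof -
  have "50 * real (r + 2) * 1 \<le> 50 * real (r + 2) * 4 ^ r"
    by (intro mult_left_mono one_le_power) auto
  then show *: "1 / (50 * real (r + 2) * 4 ^ r) \<le> 1 / (50 * real (r + 2))"
    by (intro divide_left_mono) auto
  also have "\<dots> \<le> 1 / 2" by (simp add: field_simps)
  finally show "1 / (50 * real (r + 2) * 4 ^ r) \<le> 1 / 2" .
qed

lemma lam_le_d: "lam \<le> d / (50 * real (r + 2))"
proof -
  have dp: "d * p ^ r \<le> real d * 1" using p01 by (intro mult_left_mono power_le_one) auto
  have "1 / (50 * real (r + 2) * 4 ^ r) * (d * p ^ r) \<le> 1 / (50 * real (r + 2)) * (real d * 1)"
    by (rule mult_mono[OF coeff_le(1) dp]) (use p01 in auto)
  then show ?thesis using lam_le by simp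
qed

definition many :: real where "many = lower_const r * (\<alpha> * d) ^ Suc r * p ^ tri r"

lemma many_pos: "many > 0" unfolding many_def using lower_const_pos p01 alpha d0 by simp

lemma many_cliques_at:
  assumes u: "u \<in> V" and S: "S \<subseteq> N u" "\<alpha> * d \<le> card S"
  shows "many \<le> card {K \<in> cliques (r + 2) V. u \<in> K \<and> K - {u} \<subseteq> S}"
proof -
  have SV: "S \<subseteq> V" and fV: "finite (cliques (r + 2) V)" using S N_sub[OF u] finite_cliques by auto
  have "many \<le> card (cliques (Suc r) S)" unfolding many_def
  proof (rule cliques_lower[OF SV S(2)])
    show "0 < \<alpha> * d" using alpha d0 by simp
    have "2 * lam * 4 ^ r \<le> 2 * (1 / (50 * real (r + 2) * 4 ^ r) * (d * p ^ r)) * 4 ^ r"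
      using lam_le by (intro mult_right_mono mult_left_mono) auto
    also have "\<dots> = 4 * (\<alpha> * d) * p ^ r"
    proof -
      define q where "q = real (r + 2)"
      have "q \<noteq> 0" unfolding q_def by simp
      then show ?thesis unfolding nbhd_frac_def q_def[symmetric] by (simp add: field_simps)
    qed
    finally show "2 * lam * 4 ^ r \<le> 4 * (\<alpha> * d) * p ^ r" .
  qed
  also have "card (cliques (Suc r) S) \<le> card {K \<in> cliques (r + 2) V. u \<in> K \<and> K - {u} \<subseteq> S}"
  proof (rule card_inj_on_le[of "insert u"])
    have K: "K \<in> cliques (Suc r) (N u \<inter> V)" if "K \<in> cliques (Suc r) S" for K
      using that S(1) SV unfolding cliques_def by auto
    show "inj_on (insert u) (cliques (Suc r) S)"
      using insert_clique(1)[OF u order_refl K] by (intro inj_onI) (metis insert_ident)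
    show "insert u ` cliques (Suc r) S \<subseteq> {K \<in> cliques (r + 2) V. u \<in> K \<and> K - {u} \<subseteq> S}"
    proof
      fix K' assume "K' \<in> insert u ` cliques (Suc r) S"
      then obtain K where KS: "K \<in> cliques (Suc r) S" "K' = insert u K" by auto
      have "K' \<in> cliques (Suc (Suc r)) V"
        using insert_clique(2)[OF u order_refl K[OF KS(1)]] u KS(2) by (simp add: insert_absorb)
      then show "K' \<in> {K \<in> cliques (r + 2) V. u \<in> K \<and> K - {u} \<subseteq> S}"
        using KS unfolding cliques_def by auto
    qed
    show "finite {K \<in> cliques (r + 2) V. u \<in> K \<and> K - {u} \<subseteq> S}" using fV by simp
  qed
  finally show ?thesis by simp
qed

lemma cliques_nonempty: "cliques (r + 2) V \<noteq> {}"
proof -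
  obtain u where u: "u \<in> V" using V0 by auto
  have "many \<le> card {K \<in> cliques (r + 2) V. u \<in> K \<and> K - {u} \<subseteq> N u}"
    using alpha by (intro many_cliques_at u) (auto simp: N_card[OF u] mult_left_le_one_le)
  then have "card {K \<in> cliques (r + 2) V. u \<in> K \<and> K - {u} \<subseteq> N u} > 0" using many_pos by linarith
  then show ?thesis by (auto simp: card_gt_0_iff)
qed

text \<open>If \<open>H\<close> covers at most half of the graph, every vertex of \<open>U\<close>
  sees \<open>3 d / 4\<close> or more of its neighbours in \<open>H\<close> where at most
  \<open>d / 2\<close> are expected, so \<open>U\<close> is small relative to \<open>H\<close>. If
  \<open>H\<close> is larger, it suffices that \<open>U\<close> is a small fraction of
  \<open>V\<close>.\<close>

lemma expansion:
  assumes U: "U \<subseteq> V" and H: "H \<subseteq> V" and disj: "U \<inter> H = {}"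
    and few: "\<And>u. u \<in> U \<Longrightarrow> real (card (N u - H)) \<le> \<alpha> * d"
  shows "real (r + 1) * card U \<le> card H"
proof (cases "2 * card H \<le> card V")
  case True
  have "p * card H \<le> p * (card V / 2)" using True p01 by (intro mult_left_mono) auto
  then have pH: "p * card H \<le> d / 2" using p_n by simp
  have ad: "\<alpha> * d \<le> d / 4" using alpha mult_right_mono[OF alpha(2), of "real d"] by simp
  have "card U * (d / 4)\<^sup>2 \<le> lam\<^sup>2 * card H"
  proof (rule discrepancy_uniform[OF H U])
    fix u assume u: "u \<in> U"
    have fin: "finite (N u)" using N_sub[of u] U u finV finite_subset by blast
    have "card (N u) = card (N u \<inter> H) + card (N u - H)"
      using fin by (metis Int_Diff_Un Int_Diff_disjoint card_Un_disjoint finite_Diff finite_Int)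
    then have "real (card (N u \<inter> H)) \<ge> d - \<alpha> * d" using few[OF u] N_card[of u] U u by auto
    then show "real d / 4 \<le> \<bar>real (card (N u \<inter> H)) - p * card H\<bar>" using pH ad by linarith
  qed simp
  also have "\<dots> \<le> (d / (50 * real (r + 2)))\<^sup>2 * card H"
    using lam_le_d lam0 by (intro mult_right_mono power_mono) auto
  also have "\<dots> = (d / 4)\<^sup>2 * (card H * (16 / (50 * real (r + 2))\<^sup>2))"
    by (simp add: power_divide)
  finally have "(d / 4)\<^sup>2 * card U \<le> (d / 4)\<^sup>2 * (card H * (16 / (50 * real (r + 2))\<^sup>2))" by (simp add: mult.commute)
  moreover have "(real d / 4)\<^sup>2 > 0" using d0 by simp
  ultimately have UH: "card U \<le> card H * (16 / (50 * real (r + 2))\<^sup>2)" by (simp only: mult_le_cancel_left_pos)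
  have "0 \<le> real r * real r" by simp
  then have "real (r + 1) * 16 \<le> (50 * real (r + 2))\<^sup>2" by (simp add: power2_eq_square algebra_simps)
  then have "real (r + 1) * (16 / (50 * real (r + 2))\<^sup>2) \<le> 1" by (simp add: divide_le_eq_1)
  then have "card H * (real (r + 1) * (16 / (50 * real (r + 2))\<^sup>2)) \<le> real (card H) * 1"
    by (intro mult_left_mono) auto
  moreover have "real (r + 1) * card U \<le> real (r + 1) * (card H * (16 / (50 * real (r + 2))\<^sup>2))"
    using UH by (intro mult_left_mono) auto
  ultimately show ?thesis by (simp add: mult.left_commute)
next
  case False
  \<comment> \<open>As \<open>U\<close> avoids \<open>H\<close>, its vertices have at most
    \<open>\<alpha> * d\<close> neighbours inside \<open>U\<close>; the discrepancy of
    \<open>U\<close> with itself bounds its size.\<close>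
  have "p * card U \<le> \<alpha> * d + lam"
  proof (rule ccontr)
    assume neg: "\<not> p * card U \<le> \<alpha> * d + lam"
    then have "U \<noteq> {}" using alpha lam0 by auto
    then have cU: "card U > 0" using U finV finite_subset by (auto simp: card_gt_0_iff)
    have "card U * (p * card U - \<alpha> * d)\<^sup>2 \<le> lam\<^sup>2 * card U"
    proof (rule discrepancy_uniform[OF U U])
      show "0 \<le> p * card U - \<alpha> * d" using neg lam0 by linarith
      fix u assume u: "u \<in> U"
      have fin: "finite (N u)" using N_sub[of u] U u finV finite_subset by blast
      have "card (N u \<inter> U) \<le> card (N u - H)" using fin disj by (intro card_mono) auto
      then have "real (card (N u \<inter> U)) \<le> \<alpha> * d" using few[OF u] by linarith
      then show "p * card U - \<alpha> * d \<le> \<bar>real (card (N u \<inter> U)) - p * card U\<bar>" by linarith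
    qed
    then have "(p * card U - \<alpha> * d)\<^sup>2 \<le> lam\<^sup>2" using cU by (simp add: mult.commute)
    then have "p * card U - \<alpha> * d \<le> lam" using lam0 by (rule power2_le_imp_le)
    then show False using neg by linarith
  qed
  also have "\<dots> \<le> 1 / (100 * real (r + 2)) * d + d / (50 * real (r + 2))"
    using lam_le_d unfolding nbhd_frac_def by simp
  also have "\<dots> = p * (card V * 3 / (100 * real (r + 2)))"
  proof -
    define q where "q = real (r + 2)"
    have "q \<noteq> 0" unfolding q_def by simp
    moreover have "p * (card V * 3 / (100 * q)) = d * 3 / (100 * q)" using p_n by simp
    ultimately show ?thesis unfolding q_def[symmetric] by (simp add: field_simps)
  qed
  finally have "card U \<le> card V * 3 / (100 * real (r + 2))"
    by (simp only: mult_le_cancel_left_pos[OF p01(1)])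
  then have "real (r + 1) * card U \<le> real (r + 1) * (card V * 3 / (100 * real (r + 2)))"
    by (intro mult_left_mono) auto
  also have "\<dots> \<le> card V / 2" by (simp add: field_simps)
  also have "\<dots> \<le> card H" using False by linarith
  finally show ?thesis .
qed

text \<open>Weak form of feasibility for the dual program: \<open>y\<close> prices the vertices,
  \<open>z\<close> the caps \<open>h^2 / many\<close>. If every copy cost more than its share
  \<open>s\<close>, cliques with small \<open>z\<close> would force each vertex that is light by
  some amount to have most neighbours heavy by a \<open>1 / (r + 1)\<close> share of it. Expansion
  then makes the total excess outweigh the total shortage, so the vertex weights alone exceed the
  budget.\<close>

lemma dual_bound:
  fixes y :: "'a \<Rightarrow> real" and z :: "'a set \<Rightarrow> real" and h :: real
  assumes h: "h > 3" and y: "\<And>v. v \<in> V \<Longrightarrow> y v \<ge> 0" and z: "\<And>K. K \<in> cliques (r + 2) V \<Longrightarrow> z K \<ge> 0"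
  shows "\<exists>K\<in>cliques (r + 2) V. (1 - 3 / h) * card V / real (r + 2) * (sum y K + z K)
    \<le> sum y V + h\<^sup>2 / many * sum z (cliques (r + 2) V)"
proof (rule ccontr)
  assume neg: "\<not> ?thesis"
  let ?C = "cliques (r + 2) V"
  define t where "t = real (r + 2)"
  define T where "T = (1 - 3 / h) * card V / t"
  have t: "t > 0" unfolding t_def by simp
  have T: "T > 0" unfolding T_def t_def using h n0 by simp
  \<comment> \<open>The dual objective per unit of packing value; the negated claim says that every
    clique costs more than this.\<close>
  define s where "s = (sum y V + h\<^sup>2 / many * sum z ?C) / T"
  have fC: "finite ?C" by (rule finite_cliques) simp
  have Kfacts: "finite K" "card K = r + 2" "K \<subseteq> V" if "K \<in> ?C" for K
    using that finV finite_subset[of K V] unfolding cliques_def by auto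
  have gt: "s < sum y K + z K" if "K \<in> ?C" for K
  proof -
    have "sum y V + h\<^sup>2 / many * sum z ?C < T * (sum y K + z K)"
      using neg that unfolding T_def t_def by (auto simp: not_le)
    then show ?thesis unfolding s_def using T by (simp add: pos_divide_less_eq mult.commute)
  qed
  have ynn: "sum y V \<ge> 0" and znn: "sum z ?C \<ge> 0" using y z by (auto intro: sum_nonneg)
  have cap: "h\<^sup>2 / many > 0" using h many_pos by simp
  have sT: "s * T = sum y V + h\<^sup>2 / many * sum z ?C" unfolding s_def using T by simp
  have Znn: "h\<^sup>2 / many * sum z ?C \<ge> 0" using cap znn by (intro mult_nonneg_nonneg) linarith+
  have s0: "s \<ge> 0" unfolding s_def using T ynn Znn by (intro divide_nonneg_pos) linarith+
  have s: "s > 0"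
  proof (rule ccontr)
    assume "\<not> s > 0"
    then have "sum y V + h\<^sup>2 / many * sum z ?C = 0" using s0 sT by auto
    then have "sum y V = 0" "h\<^sup>2 / many * sum z ?C = 0" using ynn Znn by linarith+
    moreover from this have "sum z ?C = 0" using cap by (metis mult_eq_0_iff less_irrefl)
    ultimately have "sum y V = 0" "sum z ?C = 0" by auto
    then have "\<forall>v\<in>V. y v = 0" "\<forall>K\<in>?C. z K = 0" using y z finV fC by (auto simp: sum_nonneg_eq_0_iff)
    moreover obtain K where "K \<in> ?C" using cliques_nonempty by auto
    ultimately have "sum y K + z K = 0" using Kfacts(3) by (auto intro!: sum.neutral)
    then show False using gt[OF \<open>K \<in> ?C\<close>] s0 by linarith
  qed
  \<comment> \<open>Few copies have a large \<open>z\<close>, so only the few vertices in \<open>B\<close> lie mostly in such copies.\<close>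
  define Bad where "Bad = {K \<in> ?C. s / h < z K}"
  have fBad: "finite Bad" unfolding Bad_def using fC by simp
  have Bad: "card Bad * (h / many) \<le> T"
  proof -
    have "card Bad * (s / h) = (\<Sum>K\<in>Bad. s / h)" by simp
    also have "\<dots> \<le> sum z Bad" unfolding Bad_def by (intro sum_mono) auto
    also have "\<dots> \<le> sum z ?C" using fC z unfolding Bad_def by (intro sum_mono2) auto
    finally have "h\<^sup>2 / many * (card Bad * (s / h)) \<le> h\<^sup>2 / many * sum z ?C" using cap by (intro mult_left_mono) auto
    also have "\<dots> \<le> s * T" using sT ynn by linarith
    finally have "s * (card Bad * (h / many)) \<le> s * T" using h by (simp add: power2_eq_square field_simps)
    then show ?thesis using s by (simp only: mult_le_cancel_left_pos)
  qed
  define B where "B = {u \<in> V. many \<le> card {K \<in> Bad. u \<in> K}}"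
  have fB: "finite B" "B \<subseteq> V" unfolding B_def using finV by auto
  have B: "card B \<le> card V / h"
  proof -
    have "card B * many = (\<Sum>u\<in>B. many)" by simp
    also have "\<dots> \<le> (\<Sum>u\<in>B. real (card {K \<in> Bad. u \<in> K}))" unfolding B_def by (intro sum_mono) auto
    also have "\<dots> \<le> (\<Sum>u\<in>V. real (card {K \<in> Bad. u \<in> K}))" using fB finV by (intro sum_mono2) auto
    also have "\<dots> = real (\<Sum>u\<in>V. card {K \<in> Bad. u \<in> K})" by simp
    also have "(\<Sum>u\<in>V. card {K \<in> Bad. u \<in> K}) = (\<Sum>K\<in>Bad. card {u \<in> V. u \<in> K})"
      using finV fBad by (intro sum_multicount_gen) auto
    also have "\<dots> = (\<Sum>K\<in>Bad. r + 2)"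
    proof (rule sum.cong[OF refl])
      fix K assume "K \<in> Bad"
      then have "K \<in> ?C" unfolding Bad_def by simp
      then have "{u \<in> V. u \<in> K} = K" "card K = r + 2" using Kfacts by auto
      then show "card {u \<in> V. u \<in> K} = r + 2" by simp
    qed
    also have "real \<dots> = t * card Bad" unfolding t_def by (simp add: algebra_simps)
    finally have "card B * many * (h / many) \<le> t * card Bad * (h / many)"
      using h many_pos by (intro mult_right_mono) auto
    also have "\<dots> \<le> t * T" unfolding mult.assoc using Bad t by (intro mult_left_mono) auto
    also have "\<dots> = (1 - 3 / h) * card V" unfolding T_def using t by simp
    also have "\<dots> \<le> 1 * real (card V)" using h by (intro mult_right_mono) auto
    finally have "card B * h \<le> card V" using many_pos by simp
    then show ?thesis using h by (simp add: pos_le_divide_eq)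
  qed
  \<comment> \<open>The reference weight of a vertex: a clique outside \<open>Bad\<close> has
    \<open>z\<close> at most \<open>s / h\<close>, so a vertex sum of at most \<open>t * a\<close>
    would keep its cost within \<open>s\<close>.\<close>
  define a where "a = s * (1 - 1 / h) / t"
  have a0: "a \<ge> 0" unfolding a_def using s h t by simp
  have at: "t * a = s * (1 - 1 / h)" unfolding a_def using t by simp
  \<comment> \<open>Otherwise this set spans \<open>many\<close> cliques with \<open>u\<close>, not
    all of them in \<open>Bad\<close> since \<open>u\<close> is outside \<open>B\<close>. In a good
    one the \<open>r + 1\<close> partners cannot make up for the shortage of \<open>u\<close>, and
    it is too cheap.\<close>
  have few: "real (card {v \<in> N u. (r + 1) * (y v - a) < a - y u}) \<le> \<alpha> * d" if u: "u \<in> V - B" for u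
  proof (rule ccontr)
    assume big: "\<not> ?thesis"
    define S where "S = {v \<in> N u. (r + 1) * (y v - a) < a - y u}"
    define X where "X = {K \<in> ?C. u \<in> K \<and> K - {u} \<subseteq> S}"
    define Y where "Y = {K \<in> Bad. u \<in> K}"
    have "many \<le> card X" unfolding X_def
      using big u by (intro many_cliques_at) (auto simp: S_def)
    moreover have "card Y < many" using u unfolding B_def Y_def by auto
    moreover have "card X \<le> card Y" if "X \<subseteq> Y" using fBad that by (intro card_mono) (auto simp: Y_def)
    ultimately have "\<not> X \<subseteq> Y" by linarith
    then obtain K where "K \<in> X" "K \<notin> Y" by blast
    then have K: "K \<in> ?C" "u \<in> K" "K - {u} \<subseteq> S" "z K \<le> s / h"
      unfolding X_def Y_def Bad_def by auto
    have "(r + 1) * (sum y K - y u - (r + 1) * a) = (\<Sum>v\<in>K - {u}. (r + 1) * (y v - a))"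
      using Kfacts[OF K(1)] K(2)
      by (simp add: sum_distrib_left[symmetric] sum_subtractf sum_diff1)
    also have "\<dots> \<le> (\<Sum>v\<in>K - {u}. a - y u)" using K(3) unfolding S_def by (intro sum_mono) auto
    also have "\<dots> = (r + 1) * (a - y u)" using Kfacts[OF K(1)] K(2) by (simp add: card_Diff_singleton)
    finally have "sum y K - y u - (r + 1) * a \<le> a - y u" by (simp del: of_nat_add)
    then have "sum y K \<le> t * a" unfolding t_def by (simp add: algebra_simps)
    then have "sum y K + z K \<le> s" using K(4) unfolding at by (simp add: right_diff_distrib)
    then show False using gt[OF K(1)] by linarith
  qed
  \<comment> \<open>Each vertex is repeated \<open>t - 1\<close> times to account for the factor in \<open>expansion\<close>.\<close>
  have "(\<Sum>x\<in>(V - B) \<times> {..<r + 1}. max 0 (a - y (fst x))) \<le> (\<Sum>v\<in>V. max 0 ((r + 1) * (y v - a)))"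
  proof (rule sum_pos_part_le)
    fix \<sigma> :: real assume \<sigma>: "\<sigma> > 0"
    define U where "U = {u \<in> V - B. \<sigma> \<le> a - y u}"
    define H where "H = {v \<in> V. \<sigma> \<le> (r + 1) * (y v - a)}"
    have "real (r + 1) * card U \<le> card H"
    proof (rule expansion)
      show "U \<subseteq> V" "H \<subseteq> V" unfolding U_def H_def by auto
      have "False" if "\<sigma> \<le> a - y u" "\<sigma> \<le> (r + 1) * (y u - a)" for u
        using that \<sigma> by (smt (verit) mult_nonneg_nonpos of_nat_0_le_iff)
      then show "U \<inter> H = {}" unfolding U_def H_def by auto
      fix u assume u: "u \<in> U"
      have "N u \<subseteq> V" using u N_sub unfolding U_def by auto
      \<comment> \<open>A neighbour outside \<open>H\<close> has scaled excess below
        \<open>\<sigma>\<close>, and \<open>\<sigma>\<close> is at most the shortage of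
        \<open>u\<close>.\<close>
      then have "card (N u - H) \<le> card {v \<in> N u. (r + 1) * (y v - a) < a - y u}"
        using u finV finite_subset[of "N u" V] unfolding U_def H_def by (intro card_mono) auto
      then show "real (card (N u - H)) \<le> \<alpha> * d" using few[of u] u unfolding U_def by auto
    qed
    moreover have "{x \<in> (V - B) \<times> {..<r + 1}. \<sigma> \<le> a - y (fst x)} = U \<times> {..<r + 1}" unfolding U_def by auto
    then have "real (card {x \<in> (V - B) \<times> {..<r + 1}. \<sigma> \<le> a - y (fst x)}) = real (r + 1) * card U"
      by (simp add: card_cartesian_product algebra_simps)
    ultimately have "real (card {x \<in> (V - B) \<times> {..<r + 1}. \<sigma> \<le> a - y (fst x)}) \<le> real (card H)" by linarith
    then show "card {x \<in> (V - B) \<times> {..<r + 1}. \<sigma> \<le> a - y (fst x)} \<le> card {v \<in> V. \<sigma> \<le> (r + 1) * (y v - a)}"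
      unfolding H_def by simp
  qed (use finV in auto)
  also have "(\<Sum>x\<in>(V - B) \<times> {..<r + 1}. max 0 (a - y (fst x))) = (r + 1) * (\<Sum>u\<in>V - B. max 0 (a - y u))"
  proof -
    have "(\<Sum>x\<in>(V - B) \<times> {..<r + 1}. max 0 (a - y (fst x))) = (\<Sum>(u, i)\<in>(V - B) \<times> {..<r + 1}. max 0 (a - y u))"
      by (simp only: case_prod_unfold)
    also have "\<dots> = (\<Sum>u\<in>V - B. \<Sum>i<r + 1. max 0 (a - y u))" by (rule sum.cartesian_product[symmetric])
    finally show ?thesis by (simp only: sum_constant card_lessThan sum_distrib_left)
  qed
  also have "(\<Sum>v\<in>V. max 0 ((r + 1) * (y v - a))) = (r + 1) * (\<Sum>v\<in>V. max 0 (y v - a))"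
    unfolding sum_distrib_left by (intro sum.cong refl) (simp add: max_def zero_le_mult_iff)
  finally have layer: "(\<Sum>u\<in>V - B. max 0 (a - y u)) \<le> (\<Sum>v\<in>V. max 0 (y v - a))" by (simp del: of_nat_add)
  have "card (V - B) * a = (\<Sum>v\<in>V - B. a)" by simp
  also have "\<dots> \<le> (\<Sum>v\<in>V - B. y v - max 0 (y v - a) + max 0 (a - y v))" by (intro sum_mono) auto
  also have "\<dots> \<le> (\<Sum>v\<in>V - B. y v - max 0 (y v - a)) + (\<Sum>v\<in>V. max 0 (y v - a))"
    unfolding sum.distrib using layer by simp
  also have "\<dots> \<le> (\<Sum>v\<in>V. y v - max 0 (y v - a)) + (\<Sum>v\<in>V. max 0 (y v - a))"
    using y a0 finV by (intro add_right_mono sum_mono2) auto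
  also have "\<dots> = sum y V" by (simp add: sum_subtractf)
  also have "\<dots> \<le> s * T" using sT Znn by linarith
  finally have "card (V - B) * a \<le> s * T" .
  moreover have "card V * (1 - 1 / h) * a \<le> card (V - B) * a"
  proof (rule mult_right_mono[OF _ a0])
    have "real (card (V - B)) = real (card V) - real (card B)"
      using fB card_mono[OF finV fB(2)] by (simp add: card_Diff_subset of_nat_diff)
    then show "card V * (1 - 1 / h) \<le> card (V - B)" using B by (simp add: right_diff_distrib)
  qed
  ultimately have "card V * (1 - 1 / h) * a \<le> s * T" by linarith
  \<comment> \<open>One factor \<open>1 - 1 / h\<close> comes from the vertices in \<open>B\<close>,
    the other from the allowance for \<open>z\<close>; the 3 in \<open>T\<close> exceeds the 2
    needed to first order.\<close>
  then have "(s * card V / t) * ((1 - 1 / h) * (1 - 1 / h)) \<le> (s * card V / t) * (1 - 3 / h)"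
    unfolding a_def T_def by (simp add: mult_ac)
  moreover have "s * card V / t > 0" using s n0 t by simp
  ultimately have "(1 - 1 / h) * (1 - 1 / h) \<le> 1 - 3 / h" by (simp only: mult_le_cancel_left_pos)
  then have "1 / h * (1 + 1 / h) \<le> 0" by (simp add: algebra_simps)
  moreover have "0 < 1 / h * (1 + 1 / h)" using h by (intro mult_pos_pos add_pos_pos) auto
  ultimately show False by linarith
qed

text \<open>Codegrees are controlled only in the mean, so a clique through \<open>u\<close> and
  \<open>v\<close> is bounded by an \<open>r\<close>-clique in the whole neighbourhood of
  \<open>u\<close>.\<close>

lemma card_cliques_pair:
  assumes uv: "u \<in> V" "v \<in> V" "u \<noteq> v"
  shows "card {K \<in> cliques (r + 2) V. u \<in> K \<and> v \<in> K} \<le> upper_const (r - 1) * real d ^ r * p ^ tri (r - 1)"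
proof -
  have fin: "finite (cliques r (N u))" using finite_cliques N_sub uv by auto
  have "card {K \<in> cliques (r + 2) V. u \<in> K \<and> v \<in> K} \<le> card (cliques r (N u))"
  proof (rule card_inj_on_le[of "\<lambda>K. K - {u, v}"])
    show "inj_on (\<lambda>K. K - {u, v}) {K \<in> cliques (r + 2) V. u \<in> K \<and> v \<in> K}"
      by (intro inj_onI) blast
    show "(\<lambda>K. K - {u, v}) ` {K \<in> cliques (r + 2) V. u \<in> K \<and> v \<in> K} \<subseteq> cliques r (N u)"
      using uv finV finite_subset unfolding cliques_def by (auto simp: card_Diff_subset)
  qed (rule fin)
  also have "real \<dots> \<le> upper_const (r - 1) * real d ^ Suc (r - 1) * p ^ tri (r - 1)"
  proof -
    have "lam \<le> real d * p ^ (r - 1)"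
    proof -
      have "1 / (50 * real (r + 2) * 4 ^ r) * (d * p ^ r) \<le> 1 * (d * p ^ (r - 1))"
        using p01 coeff_le(2) by (intro mult_mono mult_left_mono power_decreasing) auto
      then show ?thesis using lam_le by simp
    qed
    then have "card (cliques (Suc (r - 1)) (N u)) \<le> upper_const (r - 1) * real d ^ Suc (r - 1) * p ^ tri (r - 1)"
      using uv N_sub N_card d0 by (intro cliques_upper) auto
    then show ?thesis using r1 by simp
  qed
  finally show ?thesis using r1 by simp
qed

lemma spread_fractional_matching:
  fixes h :: real
  assumes h: "h > 3"
  shows "\<exists>w. fractional_matching V (cliques (r + 2) V) w (r + 2) (h\<^sup>2 * spread_const r / (d * p ^ r)) \<and>
    card V - real (r + 2) * sum w (cliques (r + 2) V) \<le> 6 / h * card V"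
proof -
  let ?C = "cliques (r + 2) V"
  define cap where "cap = h\<^sup>2 / many"
  define T where "T = (1 - 3 / h) * card V / real (r + 2)"
  define \<epsilon> where "\<epsilon> = 3 / h"
  have eps: "0 < \<epsilon>" "\<epsilon> < 1" unfolding \<epsilon>_def using h by auto
  have fC: "finite ?C" by (rule finite_cliques) simp
  have cap: "cap > 0" unfolding cap_def using h many_pos by simp
  \<comment> \<open>Vertices are resources of capacity 1, and every clique is in addition a resource
    of its own with capacity \<open>cap\<close>; this turns the caps into ordinary packing
    constraints.\<close>
  define R where "R = Inl ` V \<union> Inr ` ?C"
  define inc where "inc K = Inl ` K \<union> {Inr K}" for K :: "'a set"
  define b where "b x = (case x of Inl v \<Rightarrow> 1 | Inr K \<Rightarrow> cap)" for x :: "'a + 'a set"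
  have KV: "K \<subseteq> V" "card K = r + 2" "finite K" if "K \<in> ?C" for K
    using that finV finite_subset[of K V] unfolding cliques_def by auto
  have "\<exists>w. (\<forall>K. w K \<ge> 0) \<and> sum w ?C = T \<and> (\<forall>x\<in>R. (\<Sum>K | K \<in> ?C \<and> x \<in> inc K. w K) \<le> (1 + \<epsilon>) * b x)"
  proof (rule packing_duality)
    show "finite R" "finite ?C" unfolding R_def using finV fC by auto
    show "inc K \<subseteq> R" if "K \<in> ?C" for K using that KV unfolding inc_def R_def by auto
    show "b x > 0" for x unfolding b_def using cap by (cases x) auto
    show "T > 0" unfolding T_def using h n0 by simp
    show "\<epsilon> > 0" by (rule eps)
    fix y :: "'a + 'a set \<Rightarrow> real" assume y: "\<And>x. x \<in> R \<Longrightarrow> y x \<ge> 0"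
    obtain K where K: "K \<in> ?C" "T * ((\<Sum>v\<in>K. y (Inl v)) + y (Inr K))
        \<le> (\<Sum>v\<in>V. y (Inl v)) + cap * (\<Sum>K\<in>?C. y (Inr K))"
      using dual_bound[OF h, of "\<lambda>v. y (Inl v)" "\<lambda>K. y (Inr K)"] y unfolding T_def cap_def R_def by auto
    have "sum y (inc K) = (\<Sum>v\<in>K. y (Inl v)) + y (Inr K)"
    proof -
      have "sum y (inc K) = sum y (Inl ` K) + sum y {Inr K}"
        unfolding inc_def using KV(3)[OF K(1)] by (intro sum.union_disjoint) auto
      then show ?thesis by (simp add: sum.reindex)
    qed
    moreover have "(\<Sum>x\<in>R. b x * y x) = (\<Sum>v\<in>V. y (Inl v)) + cap * (\<Sum>K\<in>?C. y (Inr K))"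
    proof -
      have "(\<Sum>x\<in>R. b x * y x) = (\<Sum>x\<in>Inl ` V. b x * y x) + (\<Sum>x\<in>Inr ` ?C. b x * y x)"
        unfolding R_def using finV fC by (intro sum.union_disjoint) auto
      then show ?thesis by (simp add: sum.reindex b_def sum_distrib_left)
    qed
    ultimately have "T * sum y (inc K) \<le> (\<Sum>x\<in>R. b x * y x)" using K(2) by (simp only:)
    then show "\<exists>K\<in>?C. T * sum y (inc K) \<le> (\<Sum>x\<in>R. b x * y x)" using K(1) by (rule bexI)
  qed
  then obtain w where w: "\<And>K. w K \<ge> 0" "sum w ?C = T"
    "\<And>x. x \<in> R \<Longrightarrow> (\<Sum>K | K \<in> ?C \<and> x \<in> inc K. w K) \<le> (1 + \<epsilon>) * b x" by blast
  \<comment> \<open>Scaling makes the approximate constraints exact. Together with the factor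
    \<open>1 - 3 / h\<close> in \<open>T\<close> it costs a proportion of at most
    \<open>2 * \<epsilon> = 6 / h\<close>.\<close>
  define w1 where "w1 K = w K / (1 + \<epsilon>)" for K
  have load: "(\<Sum>K | K \<in> ?C \<and> v \<in> K. w1 K) \<le> 1" if v: "v \<in> V" for v
  proof -
    have "{K. K \<in> ?C \<and> Inl v \<in> inc K} = {K. K \<in> ?C \<and> v \<in> K}" unfolding inc_def by auto
    then have "(\<Sum>K | K \<in> ?C \<and> v \<in> K. w K) \<le> 1 + \<epsilon>" using w(3)[of "Inl v"] v unfolding R_def b_def by auto
    then show ?thesis unfolding w1_def using eps by (simp flip: sum_divide_distrib)
  qed
  have w1cap: "w1 K \<le> cap" if K: "K \<in> ?C" for K
  proof -
    have "{K'. K' \<in> ?C \<and> Inr K \<in> inc K'} = {K}" unfolding inc_def using K by auto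
    then have "w K \<le> (1 + \<epsilon>) * cap" using w(3)[of "Inr K"] K unfolding R_def b_def by auto
    then show ?thesis unfolding w1_def using eps by (simp add: pos_divide_le_eq mult.commute)
  qed
  have kap: "cap * (upper_const (r - 1) * real d ^ r * p ^ tri (r - 1)) = h\<^sup>2 * spread_const r / (d * p ^ r)"
  proof -
    have tri: "tri r = tri (r - 1) + r" using r1 by (cases r) auto
    have nz: "lower_const r \<noteq> 0" "\<alpha> \<noteq> 0" "p \<noteq> 0" "real d \<noteq> 0"
      using lower_const_pos[of r] alpha p01 d0 by auto
    show ?thesis unfolding cap_def many_def spread_const_def tri
      using nz by (simp add: power_add power_mult_distrib field_simps)
  qed
  have "fractional_matching V ?C w1 (r + 2) (h\<^sup>2 * spread_const r / (d * p ^ r))"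
  proof
    show "0 \<le> h\<^sup>2 * spread_const r / (d * p ^ r)"
      using spread_const_pos[of r] p01 d0 by simp
    show "K \<subseteq> V \<and> card K = r + 2" if "K \<in> ?C" for K using KV that by simp
    show "0 \<le> w1 K" for K unfolding w1_def using w(1) eps by simp
    fix u v assume uv: "u \<in> V" "v \<in> V" "u \<noteq> v"
    have "(\<Sum>K | K \<in> ?C \<and> u \<in> K \<and> v \<in> K. w1 K) \<le> (\<Sum>K | K \<in> ?C \<and> u \<in> K \<and> v \<in> K. cap)"
      using w1cap by (intro sum_mono) auto
    also have "\<dots> = cap * card {K \<in> ?C. u \<in> K \<and> v \<in> K}" by simp
    also have "\<dots> \<le> cap * (upper_const (r - 1) * real d ^ r * p ^ tri (r - 1))"
      using card_cliques_pair[OF uv] cap by (intro mult_left_mono) auto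
    finally show "(\<Sum>K | K \<in> ?C \<and> u \<in> K \<and> v \<in> K. w1 K) \<le> h\<^sup>2 * spread_const r / (d * p ^ r)" unfolding kap .
  qed (use finV load in auto)
  moreover have "card V - real (r + 2) * sum w1 ?C \<le> 6 / h * card V"
  proof -
    have "real (r + 2) * sum w1 ?C = real (r + 2) * T / (1 + \<epsilon>)" unfolding w1_def w(2)[symmetric] by (simp flip: sum_divide_distrib)
    also have "\<dots> = (1 - \<epsilon>) / (1 + \<epsilon>) * card V" unfolding T_def \<epsilon>_def by simp
    also have "\<dots> \<ge> (1 - 2 * \<epsilon>) * card V"
    proof (rule mult_right_mono)
      show "1 - 2 * \<epsilon> \<le> (1 - \<epsilon>) / (1 + \<epsilon>)"
        using eps by (subst pos_le_divide_eq) (auto simp: algebra_simps)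
    qed simp
    finally show ?thesis unfolding \<epsilon>_def by (simp add: algebra_simps)
  qed
  ultimately show ?thesis by blast
qed

text \<open>
  The deviations for a single vertex give \<open>d (1 - p) \<le> lam\<^sup>2\<close>, so the assumption on \<open>lam\<close> forces the graph to be dense.
\<close>

lemma card_le_degree_power: "real (card V) \<le> (2 ^ (r + 1) * (d * p ^ r)) ^ 3"
proof -
  obtain v where v: "v \<in> V" using V0 by auto
  have pn: "p ^ Suc r * card V = d * p ^ r" using p_n by (simp add: mult_ac)
  show ?thesis
  proof (cases "p \<le> 1 / 2")
    case True
    have "(\<Sum>u\<in>V. (real (card (N u \<inter> {v})) - p * card {v})\<^sup>2) \<le> lam\<^sup>2 * card {v}"
      using discrepancy_on[of "{v}" V] v by simp
    \<comment> \<open>The variance of a row of the adjacency matrix: \<open>d\<close> entries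
      deviate by \<open>1 - p\<close>, the others by \<open>p\<close>.\<close>
    moreover have "(\<Sum>u\<in>V. (real (card (N u \<inter> {v})) - p * card {v})\<^sup>2) = d * (1 - p)"
    proof -
      have "(\<Sum>u\<in>V. (real (card (N u \<inter> {v})) - p * card {v})\<^sup>2)
          = (\<Sum>u\<in>V. (1 - 2 * p) * (if u \<in> N v then 1 else 0) + p\<^sup>2)"
      proof (rule sum.cong[OF refl])
        fix u assume u: "u \<in> V"
        have "N u \<inter> {v} = (if u \<in> N v then {v} else {})" using N_sym[OF u v] by auto
        then show "(real (card (N u \<inter> {v})) - p * card {v})\<^sup>2 = (1 - 2 * p) * (if u \<in> N v then 1 else 0) + p\<^sup>2"
          by (auto simp: power2_eq_square algebra_simps)
      qed
      also have "\<dots> = (1 - 2 * p) * (\<Sum>u\<in>V. if u \<in> N v then 1 else 0) + card V * p\<^sup>2"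
        by (simp add: sum.distrib sum_distrib_left)
      also have "(\<Sum>u\<in>V. if u \<in> N v then 1 else 0) = real d"
        using finV N_sub[OF v] N_card[OF v] by (simp add: sum.If_cases Int_absorb1)
      also have "card V * p\<^sup>2 = d * p" using p_n by (simp add: power2_eq_square mult_ac)
      finally show ?thesis by (simp add: algebra_simps)
    qed
    ultimately have "d * (1 - p) \<le> lam\<^sup>2" by simp
    also have "lam\<^sup>2 \<le> (1 / 2 * (d * p ^ r))\<^sup>2"
    proof (rule power_mono[OF _ lam0])
      have "1 / (50 * real (r + 2) * 4 ^ r) * (d * p ^ r) \<le> 1 / 2 * (d * p ^ r)"
        using p01 by (intro mult_right_mono coeff_le) auto
      then show "lam \<le> 1 / 2 * (d * p ^ r)" using lam_le by linarith
    qed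
    finally have "d * (1 - p) \<le> 1 / 4 * (d * p ^ r)\<^sup>2" by (simp add: power_mult_distrib power_divide)
    moreover have "real d * (1 / 2) \<le> d * (1 - p)" using True by (intro mult_left_mono) auto
    moreover have "(d * p ^ r)\<^sup>2 = d * (d * (p ^ r)\<^sup>2)" by (simp add: power2_eq_square mult_ac)
    ultimately have "real d * 2 \<le> d * (d * (p ^ r)\<^sup>2)" by linarith
    then have "2 \<le> d * (p ^ r)\<^sup>2" using d0 by (simp only: mult_le_cancel_left_pos of_nat_0_less_iff)
    then have big: "1 \<le> p ^ (2 * r + 1) * card V"
    proof -
      have "p ^ (2 * r + 1) * card V = p * card V * (p ^ r)\<^sup>2"
        unfolding power_mult[symmetric] by (simp add: mult_ac)
      then show ?thesis unfolding p_n using \<open>2 \<le> d * (p ^ r)\<^sup>2\<close> by linarith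
    qed
    have "real (card V) \<le> card V * (p ^ (2 * r + 1) * card V)\<^sup>2"
      using big n0 one_le_power[OF big, of 2] by simp
    also have "\<dots> = p ^ (2 * (2 * r + 1)) * card V ^ 3"
      unfolding power_mult_distrib power_mult[symmetric]
      by (simp add: power2_eq_square power3_eq_cube mult.commute[of 2])
    \<comment> \<open>The cube appears because \<open>3 (r + 1)\<close> is at most
      \<open>2 (2 r + 1)\<close> once \<open>r\<close> is at least 1.\<close>
    also have "\<dots> \<le> p ^ (3 * Suc r) * card V ^ 3"
      using p01 r1 by (intro mult_right_mono power_decreasing) auto
    also have "\<dots> = (d * p ^ r) ^ 3" unfolding pn[symmetric] power_mult_distrib power_mult[symmetric] by (simp add: mult.commute)
    also have "\<dots> \<le> (2 ^ (r + 1) * (d * p ^ r)) ^ 3"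
    proof (rule power_mono)
      have "1 * (d * p ^ r) \<le> 2 ^ (r + 1) * (d * p ^ r)"
        using p01 one_le_power[of "2::real" "r + 1"] by (intro mult_right_mono) auto
      then show "d * p ^ r \<le> 2 ^ (r + 1) * (d * p ^ r)" by simp
    qed (use p01 in auto)
    finally show ?thesis .
  next
    case False
    have "1 = 2 ^ (r + 1) * (1 / 2 :: real) ^ (r + 1)" by (simp add: power_one_over)
    also have "\<dots> \<le> 2 ^ (r + 1) * p ^ (r + 1)" using False by (intro mult_left_mono power_mono) auto
    finally have "real (card V) * 1 \<le> card V * (2 ^ (r + 1) * p ^ (r + 1))" by (intro mult_left_mono) auto
    also have "\<dots> = 2 ^ (r + 1) * (d * p ^ r)" using pn by (simp add: mult_ac)
    finally have le: "card V \<le> 2 ^ (r + 1) * (d * p ^ r)" by simp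
    have "real (card V) \<le> real (card V) ^ 3"
      using n0 self_le_power[of "real (card V)" 3] by simp
    also have "\<dots> \<le> (2 ^ (r + 1) * (d * p ^ r)) ^ 3" using le by (intro power_mono) auto
    finally show ?thesis .
  qed
qed

end

section \<open>Near-perfect clique packings\<close>

lemma eventually_powr_le:
  fixes a b c :: real
  assumes "a < b"
  shows "eventually (\<lambda>n::nat. c * real n powr a \<le> real n powr b) sequentially"
proof -
  have "(\<lambda>n::nat. c * real n powr (a - b)) \<longlonglongrightarrow> c * 0"
    using assms by (intro tendsto_mult_left tendsto_neg_powr filterlim_real_sequentially) auto
  then have "eventually (\<lambda>n::nat. c * real n powr (a - b) < 1) sequentially"
    by (rule order_tendstoD) simp
  then show ?thesis using eventually_gt_at_top[of 0]
  proof eventually_elim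
    case (elim n)
    have "c * real n powr (a - b) * real n powr b \<le> 1 * real n powr b"
      using elim by (intro mult_right_mono) auto
    then show ?case by (simp add: mult.assoc flip: powr_add)
  qed
qed

lemma near_perfect_packing:
  fixes r :: nat
  assumes r: "r \<ge> 1"
  shows "eventually (\<lambda>n. \<forall>(V :: 'a set) N d lam. dense_pseudorandom_graph V N d lam r \<longrightarrow> card V = n \<longrightarrow>
    (\<exists>M \<subseteq> pseudorandom_graph.cliques N (r + 2) V. pairwise disjnt M \<and>
      real (card (V - \<Union>M)) \<le> real n powr (1 - 1 / (8 * real (r + 2) ^ 4)))) sequentially"
proof -
  define k where "k = r + 2"
  have k3: "k \<ge> 3" unfolding k_def using r by simp
  \<comment> \<open>Pair weights start near \<open>n^(-1/6)\<close> and grow by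
    \<open>n^(\<tau> (k - 1))\<close>; the loss is their square root divided by
    \<open>n^(-\<tau>)\<close>, with exponent \<open>- 1/12 + \<tau> (k + 1) / 2\<close>. This
    choice makes it \<open>- 1/24\<close>.\<close>
  define \<tau> where "\<tau> = 1 / (12 * (real k + 1))"
  have tau: "\<tau> > 0" unfolding \<tau>_def by simp
  have tau_k: "\<tau> * (real k + 1) = 1 / 12" unfolding \<tau>_def by simp
  define C where "C = spread_const r * 2 ^ (r + 1) * exp (real k - 1)"
  have C: "C > 0" unfolding C_def using spread_const_pos by simp
  define e where "e = - 1 / (8 * real k ^ 4)"
  define D where "D = 10 * real k * sqrt (real k * C)"
  have k3': "real k \<ge> 3" using k3 by simp
  have e: "- \<tau> < e" "- 1 / 24 < e" "- 1 / 12 < e"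
  proof -
    have "real k ^ 4 \<ge> 27 * real k"
    proof -
      have "(3::real) ^ 3 \<le> real k ^ 3" using k3 by (intro power_mono) auto
      then have "27 * real k \<le> real k ^ 3 * real k" by (intro mult_right_mono) auto
      then show ?thesis by (simp add: power_numeral_reduce)
    qed
    moreover define y where "y = real k ^ 4"
    ultimately have "27 * real k \<le> y" by simp
    then have "8 * y > 12 * (real k + 1)" "8 * y > 24" using k3' by simp_all
    then have *: "8 * real k ^ 4 > 12 * (real k + 1)" "8 * real k ^ 4 > 24" unfolding y_def by simp_all
    have "1 / (8 * real k ^ 4) < 1 / (12 * (real k + 1))" by (rule frac_less2) (use * in auto)
    moreover have "1 / (8 * real k ^ 4) < 1 / 24" by (rule frac_less2) (use * in auto)
    ultimately show "- \<tau> < e" "- 1 / 24 < e" "- 1 / 12 < e" unfolding e_def \<tau>_def by simp_all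
  qed
  have exp_neg: "- 1 / 6 + \<tau> * (real k - 1) < 0"
    using tau_k tau by (simp add: algebra_simps)
  have ev1: "eventually (\<lambda>n. 4 * real n powr 0 \<le> real n powr (1 / 12)) sequentially"
    by (rule eventually_powr_le) simp
  have ev2: "eventually (\<lambda>n. real k * real n powr (- \<tau>) \<le> real n powr 0) sequentially"
    by (rule eventually_powr_le) (use tau in simp)
  have ev3: "eventually (\<lambda>n. (4 * real k * C) * real n powr (- 1 / 6 + \<tau> * (real k - 1)) \<le> real n powr 0) sequentially"
    by (rule eventually_powr_le) (rule exp_neg)
  \<comment> \<open>Each of the three kinds of loss gets a third of the target: here the survivors
    of the last round and the part of \<open>A\<close> linear in \<open>\<theta>\<close>, then the
    square root part of \<open>A\<close>, then the initial deficit \<open>6 / h\<close>.\<close>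
  have ev4: "eventually (\<lambda>n. (3 * (2 * real k + 3)) * real n powr (- \<tau>) \<le> real n powr e) sequentially"
    by (rule eventually_powr_le) (rule e)
  have ev5: "eventually (\<lambda>n. (3 * D) * real n powr (- 1 / 24) \<le> real n powr e) sequentially"
    by (rule eventually_powr_le) (rule e)
  have ev6: "eventually (\<lambda>n. 18 * real n powr (- 1 / 12) \<le> real n powr e) sequentially"
    by (rule eventually_powr_le) (rule e)
  show ?thesis
    using ev1 ev2 ev3 ev4 ev5 ev6 eventually_gt_at_top[of 0]
  proof eventually_elim
    case (elim n)
    show ?case
    proof (intro allI impI)
      fix V :: "'a set" and N d lam
      assume G: "dense_pseudorandom_graph V N d lam r" and card: "card V = n"
      interpret dense_pseudorandom_graph V N d lam r by (rule G)
      have n: "real n > 0" using elim by simp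
      \<comment> \<open>A larger \<open>h\<close> lowers the deficit \<open>6 / h\<close> but raises
        the pair weight, of order \<open>h^2 / (d p^r)\<close>. Since \<open>d p^r\<close> is at
        least of order \<open>n^(1/3)\<close>, this value leaves \<open>n^(-1/6)\<close>.\<close>
      define h where "h = real n powr (1 / 12)"
      have h: "h > 3" using elim(1) n unfolding h_def by simp
      define D0 where "D0 = d * p ^ r"
      have D0: "D0 > 0" unfolding D0_def using d0 p01 by simp
      define K where "K = h\<^sup>2 * spread_const r / D0"
      obtain w where w: "fractional_matching V (cliques k V) w k K"
        "card V - real k * sum w (cliques k V) \<le> 6 / h * card V"
        using spread_fractional_matching[OF h] unfolding k_def K_def D0_def by blast
      have K0: "K \<ge> 0" unfolding K_def using D0 spread_const_pos[of r] by simp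
      have K_le: "K \<le> spread_const r * 2 ^ (r + 1) * real n powr (- 1 / 6)"
      proof -
        have "real n powr (1 / 3) \<le> ((2 ^ (r + 1) * D0) ^ 3) powr (1 / 3)"
          using card_le_degree_power n unfolding D0_def card by (intro powr_mono2) auto
        also have "\<dots> = 2 ^ (r + 1) * D0"
        proof -
          have "(X ^ 3) powr (1 / 3) = X" if "X > 0" for X :: real
          proof -
            have "X ^ 3 = X powr 3" using that by simp
            then show ?thesis using that by (simp only: powr_powr) simp
          qed
          then show ?thesis using D0 by simp
        qed
        finally have "1 / D0 \<le> 2 ^ (r + 1) / real n powr (1 / 3)"
          using D0 n by (simp add: field_simps)
        then have "h\<^sup>2 * spread_const r * (1 / D0) \<le> h\<^sup>2 * spread_const r * (2 ^ (r + 1) / real n powr (1 / 3))"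
          using spread_const_pos[of r] by (intro mult_left_mono) auto
        also have "\<dots> = spread_const r * 2 ^ (r + 1) * (h\<^sup>2 / real n powr (1 / 3))" by simp
        also have "h\<^sup>2 / real n powr (1 / 3) = real n powr (1 / 6) / real n powr (1 / 3)"
          unfolding h_def power2_eq_square by (simp flip: powr_add)
        also have "real n powr (1 / 6) / real n powr (1 / 3) = real n powr (- 1 / 6)"
          by (simp flip: powr_diff)
        finally show ?thesis unfolding K_def by simp
      qed
      define \<theta> where "\<theta> = real n powr (- \<tau>)"
      have th: "\<theta> > 0" "\<theta> * real k \<le> 1" unfolding \<theta>_def using elim(2) n by (auto simp: mult.commute)
      have th1: "\<theta> \<le> 1" using th k3 mult_left_mono[of 1 "real k" \<theta>] by linarith
      \<comment> \<open>Enough rounds to reduce the survivors to \<open>n^(-\<tau>)\<close>;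
        rounding up changes \<open>\<theta> * R\<close> by at most 1, hence the constant
        \<open>exp (k - 1)\<close> in \<open>C\<close>.\<close>
      define R where "R = nat \<lceil>\<tau> * real n powr \<tau> * ln n\<rceil>"
      have nt: "\<theta> * real n powr \<tau> = 1" unfolding \<theta>_def using n by (simp flip: powr_add)
      have ln: "ln (real n) \<ge> 0" using elim by simp
      have R1: "\<tau> * ln n \<le> \<theta> * R"
      proof -
        have "\<tau> * real n powr \<tau> * ln n \<le> R" unfolding R_def by linarith
        then have "\<theta> * (\<tau> * real n powr \<tau> * ln n) \<le> \<theta> * R" using th by (intro mult_left_mono) auto
        moreover have "\<theta> * (\<tau> * real n powr \<tau> * ln n) = (\<theta> * real n powr \<tau>) * (\<tau> * ln n)" by simp
        ultimately show ?thesis unfolding nt by simp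
      qed
      have R2: "\<theta> * R \<le> \<tau> * ln n + 1"
      proof -
        have "0 \<le> \<tau> * real n powr \<tau> * ln n" using tau ln by simp
        then have "R \<le> \<tau> * real n powr \<tau> * ln n + 1" unfolding R_def by linarith
        then have "\<theta> * R \<le> \<theta> * (\<tau> * real n powr \<tau> * ln n + 1)" using th by (intro mult_left_mono) auto
        also have "\<dots> = (\<theta> * real n powr \<tau>) * (\<tau> * ln n) + \<theta>" by (simp add: algebra_simps)
        finally show ?thesis unfolding nt using th1 by simp
      qed
      \<comment> \<open>\<open>K\<close> is the initial pair weight, \<open>\<kappa>\<close> what it
        may have become after \<open>R\<close> rounds.\<close>
      define \<kappa> where "\<kappa> = K * exp (\<theta> * (real k - 1) * R)"
      have kap0: "\<kappa> \<ge> 0" unfolding \<kappa>_def using K0 by simp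
      have kap: "\<kappa> \<le> C * real n powr (- 1 / 6 + \<tau> * (real k - 1))"
      proof -
        have "\<theta> * (real k - 1) * R \<le> (real k - 1) * (\<tau> * ln n + 1)"
          using mult_left_mono[OF R2, of "real k - 1"] k3 by (simp add: mult_ac)
        then have "exp (\<theta> * (real k - 1) * R) \<le> exp ((real k - 1) * (\<tau> * ln n + 1))" by simp
        also have "\<dots> = real n powr (\<tau> * (real k - 1)) * exp (real k - 1)"
          unfolding powr_def using n by (simp add: algebra_simps flip: exp_add)
        finally have "\<kappa> \<le> (spread_const r * 2 ^ (r + 1) * real n powr (- 1 / 6)) * (real n powr (\<tau> * (real k - 1)) * exp (real k - 1))"
          unfolding \<kappa>_def using K_le K0 spread_const_pos[of r] by (intro mult_mono) auto
        also have "\<dots> = C * real n powr (- 1 / 6 + \<tau> * (real k - 1))" unfolding C_def powr_add by simp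
        finally show ?thesis .
      qed
      have kapk: "4 * real k * \<kappa> \<le> 1"
      proof -
        have "4 * real k * \<kappa> \<le> 4 * real k * (C * real n powr (- 1 / 6 + \<tau> * (real k - 1)))"
          using kap by (intro mult_left_mono) auto
        then show ?thesis using elim(3) n by simp
      qed
      define Z where "Z = (real k + 1) * \<theta>\<^sup>2 + 5 * real k * sqrt (real k * \<kappa>)"
      have Z0: "Z \<ge> 0" unfolding Z_def using kap0 by simp
      \<comment> \<open>As \<open>1 - exp (- \<theta>)\<close> is at least
        \<open>\<theta> / 2\<close>, this \<open>A\<close> absorbs a loss of \<open>Z\<close> in
        every round.\<close>
      define A where "A = 2 * Z / \<theta>"
      have A0: "A \<ge> 0" unfolding A_def using Z0 th by simp
      have AZ: "A * exp (- \<theta>) + Z \<le> A"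
      proof -
        have "exp (- \<theta>) \<le> 1 / (1 + \<theta>)"
          using exp_ge_add_one_self[of \<theta>] th by (simp add: exp_minus field_simps)
        also have "\<dots> \<le> 1 - \<theta> / 2"
          using th th1 mult_left_mono[OF th1, of \<theta>] by (subst pos_divide_le_eq) (auto simp: algebra_simps)
        finally have "A * exp (- \<theta>) \<le> A * (1 - \<theta> / 2)" using A0 by (intro mult_left_mono)
        also have "\<dots> = A - Z" unfolding A_def using th by (simp add: field_simps)
        finally show ?thesis by linarith
      qed
      have fm: "fractional_matching V (cliques k V) w k (\<kappa> * exp (- \<theta> * (real k - 1) * real R))"
      proof -
        have "\<kappa> * exp (- \<theta> * (real k - 1) * real R) = K" unfolding \<kappa>_def by (simp flip: exp_add)
        then show ?thesis using w(1) by simp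
      qed
      obtain M where M: "M \<subseteq> cliques k V" "pairwise disjnt M"
        "real (card (V - \<Union>M)) \<le> (exp (- \<theta> * real R) + A) * card V + (card V - real k * sum w (cliques k V))"
        using nibble_matching[OF th kapk kap0 A0 AZ[unfolded Z_def] fm] by blast
      have b1: "exp (- \<theta> * real R) \<le> real n powr (- \<tau>)"
        unfolding powr_def using R1 n by simp
      have b2: "A \<le> 2 * (real k + 1) * real n powr (- \<tau>) + D * real n powr (- 1 / 24)"
      proof -
        have "sqrt (real k * \<kappa>) \<le> sqrt (real k * (C * real n powr (- 1 / 6 + \<tau> * (real k - 1))))"
          using kap by (intro real_sqrt_le_mono mult_left_mono) auto
        also have "\<dots> = sqrt (real k * C) * sqrt (real n powr (- 1 / 6 + \<tau> * (real k - 1)))"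
          by (simp add: real_sqrt_mult mult.assoc)
        also have "sqrt (real n powr (- 1 / 6 + \<tau> * (real k - 1))) = real n powr ((- 1 / 6 + \<tau> * (real k - 1)) / 2)"
          using n by (simp add: powr_half_sqrt[symmetric] powr_powr)
        finally have "sqrt (real k * \<kappa>) / \<theta> \<le> sqrt (real k * C) * real n powr ((- 1 / 6 + \<tau> * (real k - 1)) / 2) / \<theta>"
          using th by (intro divide_right_mono) auto
        also have "\<dots> = sqrt (real k * C) * real n powr ((- 1 / 6 + \<tau> * (real k - 1)) / 2 + \<tau>)"
        proof -
          have "real n powr a / \<theta> = real n powr (a + \<tau>)" for a
            unfolding \<theta>_def by (simp flip: powr_diff)
          then show ?thesis by (simp flip: times_divide_eq_right)
        qed
        also have "(- 1 / 6 + \<tau> * (real k - 1)) / 2 + \<tau> = - 1 / 24"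
          using tau_k by (simp add: field_simps)
        finally have "sqrt (real k * \<kappa>) / \<theta> \<le> sqrt (real k * C) * real n powr (- 1 / 24)" .
        then have "10 * real k * (sqrt (real k * \<kappa>) / \<theta>) \<le> 10 * real k * (sqrt (real k * C) * real n powr (- 1 / 24))"
          by (intro mult_left_mono) auto
        moreover have "A = 2 * (real k + 1) * \<theta> + 10 * real k * (sqrt (real k * \<kappa>) / \<theta>)"
          unfolding A_def Z_def using th by (simp add: field_simps power2_eq_square)
        ultimately show ?thesis unfolding D_def \<theta>_def by (simp add: mult.assoc)
      qed
      have b3: "6 / h = 6 * real n powr (- 1 / 12)"
        unfolding h_def using n by (simp add: powr_minus field_simps)
      have "real (card (V - \<Union>M)) \<le> (exp (- \<theta> * real R) + A + 6 / h) * n"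
        using M(3) w(2) unfolding card by (simp add: algebra_simps)
      also have "\<dots> \<le> real n powr e * n"
        using b1 b2 elim(4-6) unfolding b3 by (intro mult_right_mono) (auto simp: algebra_simps)
      also have "\<dots> = real n powr (1 + e)" using n by (simp add: powr_add)
      also have "1 + e = 1 - 1 / (8 * real (r + 2) ^ 4)" unfolding e_def k_def by simp
      finally show "\<exists>M\<subseteq>cliques (r + 2) V. pairwise disjnt M \<and>
          real (card (V - \<Union>M)) \<le> real n powr (1 - 1 / (8 * real (r + 2) ^ 4))"
        using M(1,2) unfolding k_def by blast
    qed
  qed
qed

section \<open>From the spectral definition to disjoint copies\<close>

lemma ndl_graph_pseudorandom:
  fixes G :: "'a pair_pre_digraph"
  assumes ndl: "ndl_graph n d lam G" and n: "n \<ge> 2" and d: "d > 0"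
  shows "pseudorandom_graph (pverts G) (\<lambda>v. {u. (v, u) \<in> parcs G}) d lam"
proof -
  from ndl obtain vs where G: "pair_graph G" and card: "card (pverts G) = n"
    and deg: "\<And>v. v \<in> pverts G \<Longrightarrow> out_degree (with_proj G) v = d"
    and vs: "distinct vs" "set vs = pverts G" "second_abs_eigenvalue (adjacency_mat vs G) \<le> lam"
    unfolding ndl_graph_def by blast
  interpret pair_graph G by (rule G)
  let ?N = "\<lambda>v. {u. (v, u) \<in> parcs G}"
  let ?V = "pverts G"
  have fin: "finite ?V" by (rule pair_finite_verts)
  have sym: "(u, v) \<in> parcs G \<longleftrightarrow> (v, u) \<in> parcs G" for u v
    using pair_sym_arcs by (auto simp: symmetric_def sym_def)
  have Nsub: "?N v \<subseteq> ?V" for v using in_arcsD2 by auto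
  have Ncard: "card (?N v) = d" if "v \<in> ?V" for v
  proof -
    have "out_arcs (with_proj G) v = Pair v ` ?N v" by (auto simp: out_arcs_def)
    then show ?thesis using deg[OF that] unfolding out_degree_def by (simp add: card_image inj_on_def)
  qed
  have len: "length vs = n" using vs(1,2) card distinct_card by metis
  have bij: "bij_betw (\<lambda>i. vs ! i) {..<n} ?V" using bij_betw_nth[OF vs(1)] vs(2) len by auto
  define A where "A = adjacency_mat vs G"
  have A: "A \<in> carrier_mat n n" unfolding A_def adjacency_mat_def len by simp
  have Aij: "A $$ (i,j) = of_bool (vs ! j \<in> ?N (vs ! i))" if "i < n" "j < n" for i j
    unfolding A_def adjacency_mat_def using that len by simp
  have Asym: "A $$ (i,j) = A $$ (j,i)" if "i < n" "j < n" for i j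
    using Aij that sym by simp
  have Nsum: "(\<Sum>v\<in>?V. of_bool (v \<in> ?N u) * of_bool (v \<in> S)) = real (card (?N u \<inter> S))" for u S
  proof -
    have "(\<Sum>v\<in>?V. of_bool (v \<in> ?N u) * of_bool (v \<in> S)) = (\<Sum>v\<in>?V. if v \<in> ?N u \<inter> S then 1 else (0::real))"
      by (intro sum.cong) auto
    also have "\<dots> = (\<Sum>v\<in>?V \<inter> (?N u \<inter> S). 1)" by (rule sum.inter_restrict[OF fin, symmetric])
    also have "?V \<inter> (?N u \<inter> S) = ?N u \<inter> S" using Nsub by auto
    finally show ?thesis by simp
  qed
  have row: "(\<Sum>j<n. A $$ (i,j)) = real d" if i: "i < n" for i
  proof -
    have "(\<Sum>j<n. A $$ (i,j)) = (\<Sum>j<n. of_bool (vs ! j \<in> ?N (vs ! i)))" using Aij i by simp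
    also have "\<dots> = (\<Sum>v\<in>?V. of_bool (v \<in> ?N (vs ! i)))" by (rule sum.reindex_bij_betw[OF bij])
    also have "\<dots> = real (card (?N (vs ! i)))" using Nsum[of "vs ! i" UNIV] by simp
    also have "\<dots> = real d" using Ncard i len vs(2) nth_mem[of i vs] by simp
    finally show ?thesis .
  qed
  show ?thesis
  proof
    show "finite ?V" by (rule fin)
    show "?V \<noteq> {}" using card n by auto
    show "d > 0" by (rule d)
    show "lam \<ge> 0" using second_abs_eigenvalue_nonneg[OF A Asym n] vs(3) unfolding A_def by linarith
    show "?N v \<subseteq> ?V" for v by (rule Nsub)
    show "v \<notin> ?N v" for v using pair_no_loops[of "(v, v)"] by auto
    show "v \<in> ?N u \<longleftrightarrow> u \<in> ?N v" for u v using sym by simp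
    show "card (?N v) = d" if "v \<in> ?V" for v using Ncard that .
    fix S assume S: "S \<subseteq> ?V"
    \<comment> \<open>The indicator vector of \<open>S\<close> equals its own square, so the norm
      bound at \<open>x\<close> has \<open>card S\<close> on the right.\<close>
    define x where "x j = (of_bool (vs ! j \<in> S) :: real)" for j
    have xs: "(\<Sum>j<n. x j) = card S"
    proof -
      have "(\<Sum>j<n. x j) = (\<Sum>v\<in>?V. of_bool (v \<in> S))" unfolding x_def by (rule sum.reindex_bij_betw[OF bij])
      also have "\<dots> = real (card (?V \<inter> S))" using fin by (simp add: of_bool_def sum.If_cases Int_def)
      also have "?V \<inter> S = S" using S by auto
      finally show ?thesis .
    qed
    have entry: "(\<Sum>j<n. (A $$ (i,j) - real d / n) * x j) = card (?N (vs ! i) \<inter> S) - real d / card ?V * card S"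
      if i: "i < n" for i
    proof -
      have "(\<Sum>j<n. (A $$ (i,j) - real d / n) * x j) = (\<Sum>j<n. A $$ (i,j) * x j) - real d / n * (\<Sum>j<n. x j)"
        by (simp add: left_diff_distrib sum_subtractf sum_distrib_left)
      also have "(\<Sum>j<n. A $$ (i,j) * x j) = (\<Sum>j<n. of_bool (vs ! j \<in> ?N (vs ! i)) * of_bool (vs ! j \<in> S))"
        using Aij i unfolding x_def by simp
      also have "\<dots> = (\<Sum>v\<in>?V. of_bool (v \<in> ?N (vs ! i)) * of_bool (v \<in> S))" by (rule sum.reindex_bij_betw[OF bij])
      finally show ?thesis unfolding Nsum xs card .
    qed
    have "(\<Sum>v\<in>?V. (real (card (?N v \<inter> S)) - real d / card ?V * card S)\<^sup>2)
        = (\<Sum>i<n. (real (card (?N (vs ! i) \<inter> S)) - real d / card ?V * card S)\<^sup>2)"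
      by (rule sum.reindex_bij_betw[OF bij, symmetric])
    also have "\<dots> = (\<Sum>i<n. (\<Sum>j<n. (A $$ (i,j) - real d / n) * x j)\<^sup>2)" using entry by simp
    also have "\<dots> \<le> lam\<^sup>2 * (\<Sum>j<n. (x j)\<^sup>2)"
      by (rule second_eigenvalue_norm_bound[OF A Asym _ row n]) (use vs(3) Aij in \<open>auto simp: A_def\<close>)
    also have "(\<Sum>j<n. (x j)\<^sup>2) = (\<Sum>j<n. x j)" unfolding x_def by (intro sum.cong) auto
    finally show "(\<Sum>v\<in>?V. (real (card (?N v \<inter> S)) - real d / card ?V * card S)\<^sup>2) \<le> lam\<^sup>2 * card S"
      unfolding xs .
  qed
qed

lemma clique_family_copies:
  fixes G :: "'a pair_pre_digraph"
  assumes G: "pair_graph G" and P: "pseudorandom_graph (pverts G) (\<lambda>v. {u. (v, u) \<in> parcs G}) d lam"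
    and M: "M \<subseteq> pseudorandom_graph.cliques (\<lambda>v. {u. (v, u) \<in> parcs G}) t (pverts G)" "pairwise disjnt M"
  shows "\<exists>F. disjoint_clique_copies t G F \<and> (\<Union>H\<in>F. pverts H) = \<Union>M"
proof -
  interpret pair_graph G by (rule G)
  define H where "H K = \<lparr>pverts = K, parcs = {(u, v). (u, v) \<in> K \<times> K \<and> u \<noteq> v}\<rparr>" for K :: "'a set"
  have K: "K \<subseteq> pverts G" "card K = t" "finite K" "\<And>u v. u \<in> K \<Longrightarrow> v \<in> K \<Longrightarrow> u \<noteq> v \<Longrightarrow> (u, v) \<in> parcs G"
    if "K \<in> M" for K
    using that M(1) finite_subset[OF _ pair_finite_verts] unfolding pseudorandom_graph.cliques_def[OF P] by auto
  have "disjoint_clique_copies t G (H ` M)" unfolding disjoint_clique_copies_def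
  proof (intro conjI ballI impI)
    fix X assume "X \<in> H ` M"
    then obtain K where X: "K \<in> M" "X = H K" by auto
    show complete: "K\<^bsub>t\<^esub> (with_proj X)" unfolding complete_digraph_pair_def X(2) H_def using K(2,3)[OF X(1)] by simp
    have "wf_digraph (with_proj X)"
      by unfold_locales (auto simp: X(2) H_def)
    moreover have "wf_digraph (with_proj G)" by unfold_locales
    ultimately show "subgraph (with_proj X) (with_proj G)"
      using K[OF X(1)] unfolding subgraph_def compatible_def by (auto simp: X(2) H_def)
  next
    fix X Y assume XY: "X \<in> H ` M" "Y \<in> H ` M" "X \<noteq> Y"
    then obtain K L where KL: "K \<in> M" "X = H K" "L \<in> M" "Y = H L" by auto
    then have "disjnt K L" using M(2) XY(3) by (auto simp: pairwise_def)
    then show "pverts X \<inter> pverts Y = {}" using KL unfolding H_def disjnt_def by simp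
  qed
  moreover have "(\<Union>X\<in>H ` M. pverts X) = \<Union>M" unfolding H_def by auto
  ultimately show ?thesis by blast
qed

theorem theorem1p3:
  fixes t :: nat
  assumes "t \<ge> 3"
  shows "\<exists>n0 :: nat. n0 > 0 \<and>
    (\<forall>(n :: nat) (d :: nat) (lam :: real) (G :: 'a pair_pre_digraph).
       n \<ge> n0 \<longrightarrow> d > 0 \<longrightarrow> ndl_graph n d lam G \<longrightarrow>
       lam \<le> 1 / (50 * real t * 4 ^ (t - 2)) * (real d ^ (t - 1) / real n ^ (t - 2)) \<longrightarrow>
       (\<exists>F. disjoint_clique_copies t G F \<and>
          real (card (pverts G - (\<Union>H \<in> F. pverts H)))
            \<le> real n powr (1 - 1 / (8 * real t ^ 4))))"
proof -
  define r where "r = t - 2"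
  have r: "r \<ge> 1" and t: "t = r + 2" unfolding r_def using assms by auto
  obtain n0 where n0: "\<And>n V N d lam. n \<ge> n0 \<Longrightarrow> dense_pseudorandom_graph (V :: 'a set) N d lam r \<Longrightarrow> card V = n \<Longrightarrow>
    \<exists>M \<subseteq> pseudorandom_graph.cliques N (r + 2) V. pairwise disjnt M \<and>
      real (card (V - \<Union>M)) \<le> real n powr (1 - 1 / (8 * real (r + 2) ^ 4))"
    using near_perfect_packing[OF r, where 'a = 'a] unfolding eventually_sequentially by blast
  show ?thesis
  \<comment> \<open>With two vertices the sorted spectrum has an entry at index 1, so the second
    eigenvalue is meaningful.\<close>
  proof (intro exI[of _ "max n0 2"] conjI allI impI)
    fix n d :: nat and lam :: real and G :: "'a pair_pre_digraph"
    assume n: "max n0 2 \<le> n" and d: "d > 0" and ndl: "ndl_graph n d lam G"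
      and lam: "lam \<le> 1 / (50 * real t * 4 ^ (t - 2)) * (real d ^ (t - 1) / real n ^ (t - 2))"
    let ?N = "\<lambda>v. {u. (v, u) \<in> parcs G}"
    have card: "card (pverts G) = n" and G: "pair_graph G" using ndl unfolding ndl_graph_def by auto
    have P: "pseudorandom_graph (pverts G) ?N d lam" using ndl_graph_pseudorandom[OF ndl _ d] n by simp
    have dense: "dense_pseudorandom_graph (pverts G) ?N d lam r"
    proof (intro dense_pseudorandom_graph.intro P dense_pseudorandom_graph_axioms.intro r)
      \<comment> \<open>\<open>d^(t-1) / n^(t-2)\<close> is \<open>d\<close> times the
        \<open>r\<close>-th power of the density \<open>d / n\<close>.\<close>
      show "lam \<le> 1 / (50 * real (r + 2) * 4 ^ r) * (d * pseudorandom_graph.p (pverts G) d ^ r)"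
        using lam unfolding pseudorandom_graph.p_def[OF P] card t by (simp add: power_divide)
    qed
    have "n0 \<le> n" using n by simp
    from n0[OF this dense card] obtain M where M: "M \<subseteq> pseudorandom_graph.cliques ?N (r + 2) (pverts G)" "pairwise disjnt M"
      "real (card (pverts G - \<Union>M)) \<le> real n powr (1 - 1 / (8 * real (r + 2) ^ 4))"
      by blast
    have "M \<subseteq> pseudorandom_graph.cliques ?N t (pverts G)" using M(1) t by simp
    from clique_family_copies[OF G P this M(2)]
    obtain F where F: "disjoint_clique_copies t G F" "(\<Union>H\<in>F. pverts H) = \<Union>M"
      by (elim exE conjE) (rule that)
    show "\<exists>F. disjoint_clique_copies t G F \<and>
        real (card (pverts G - (\<Union>H \<in> F. pverts H))) \<le> real n powr (1 - 1 / (8 * real t ^ 4))"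
      using F M(3) t by (intro exI[of _ F]) simp
  qed simp
qed

end
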